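(* Let $d$ be a positive integer, let $\mathsf w:\partial\mathbb B^d\to[0,\infty)$ be a bounded measurable function, and let $\mu_{\mathsf w}$ be the weighted surface area measure $d\mu_{\mathsf w}=\mathsf w\,d\sigma$ on $\partial\mathbb B^d$. Then the $d$-tuple $\mathscr M_z=(\mathscr M_{z_1},\ldots,\mathscr M_{z_d})$ of operators of multiplication by the coordinate functions on the Dirichlet-type space $\mathscr D(\mu_{\mathsf w})$ is a joint $2$-isometry (in particular each $z_j$ is a multiplier of $\mathscr D(\mu_{\mathsf w})$).
   Context: $\mathbb B^d$ is the open Euclidean unit ball of $\mathbb C^d$, $\partial\mathbb B^d$ the unit sphere, $V$ the normalized volume measure on $\mathbb B^d$, $\sigma$ the normalized surface area measure on $\partial\mathbb B^d$. Poisson kernel: $P(z,\zeta)=\frac{1-\|z\|^2}{\|z-\zeta\|^{2d}}$; for a finite positive Borel measure $\mu$ on $\partial\mathbb B^d$, $P[\mu](z)=\int_{\partial\mathbb B^d}P(z,\zeta)\,d\mu(\zeta)$, $z\in\mathbb B^d$. $H^2(\mathbb B^d)$ is the Hardy space of holomorphic $f(z)=\sum_{\alpha\in\mathbb Z_+^d}a_\alpha z^\alpha$ on $\mathbb B^d$ with $\|f\|^2_{H^2(\mathbb B^d)}=\sum_\alpha|a_\alpha|^2\frac{\alpha!\,(d-1)!}{(|\alpha|+d-1)!}<\infty$. The Dirichlet-type space $\mathscr D(\mu)$ is the Hilbert space of holomorphic $f:\mathbb B^d\to\mathbb C$ with $$\|f\|^2_{\mathscr D(\mu)}:=\|f\|^2_{H^2(\mathbb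 B^d)}+\frac1d\int_{\mathbb B^d}\sum_{j=1}^d\Big|\frac{\partial f}{\partial z_j}(z)\Big|^2P[\mu](z)\,dV(z)<\infty.$$ $z_j$ is a multiplier of $\mathscr D(\mu)$ if $z_jf\in\mathscr D(\mu)$ for all $f\in\mathscr D(\mu)$. A commuting $d$-tuple $T=(T_1,\ldots,T_d)$ of bounded operators on a Hilbert space is a joint $m$-isometry if $\sum_{n=0}^m(-1)^n\binom mn Q_T^n(I)=0$, where $Q_T(X)=\sum_{j=1}^dT_j^*XT_j$, $Q_T^0(X)=X$, $Q_T^n(X)=Q_T(Q_T^{n-1}(X))$. *)

theory Defs
  imports "HOL-Analysis.Analysis" "HOL-Library.Function_Algebras"
begin

section \<open>Joint m-isometries on a complex Hilbert space\<close>

text \<open>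
  The Hilbert space is a subspace \<open>H\<close> of an ambient complex vector space (scalar action \<open>scl\<close>)
  with an inner product \<open>ip\<close> on \<open>H\<close>, linear in the first argument. Operators on \<open>H\<close> are functions
  on the ambient type of which only the values on \<open>H\<close> matter.
\<close>

definition ip_norm :: "('v \<Rightarrow> 'v \<Rightarrow> complex) \<Rightarrow> 'v \<Rightarrow> real" where
  "ip_norm ip x = sqrt (Re (ip x x))"

locale complex_hilbert_space = vector_space scl
  for scl :: "complex \<Rightarrow> 'v::ab_group_add \<Rightarrow> 'v" +
  fixes H :: "'v set" and ip :: "'v \<Rightarrow> 'v \<Rightarrow> complex"
  assumes subspace_carrier: "subspace H"
    and ip_add_left: "\<lbrakk>x \<in> H; y \<in> H; u \<in> H\<rbrakk> \<Longrightarrow> ip (x + y) u = ip x u + ip y u"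
    and ip_scale_left: "\<lbrakk>x \<in> H; u \<in> H\<rbrakk> \<Longrightarrow> ip (scl c x) u = c * ip x u"
    and ip_commute: "\<lbrakk>x \<in> H; y \<in> H\<rbrakk> \<Longrightarrow> ip y x = cnj (ip x y)"
    and ip_positive: "\<lbrakk>x \<in> H; x \<noteq> 0\<rbrakk> \<Longrightarrow> 0 < Re (ip x x)"
    and complete_carrier:
      "\<lbrakk>\<And>n. X n \<in> H; \<forall>e>0. \<exists>N::nat. \<forall>m\<ge>N. \<forall>n\<ge>N. ip_norm ip (X m - X n) < e\<rbrakk>
        \<Longrightarrow> \<exists>x\<in>H. (\<lambda>n. ip_norm ip (X n - x)) \<longlonglongrightarrow> 0"

definition bounded_operator_on ::
  "(complex \<Rightarrow> 'v \<Rightarrow> 'v) \<Rightarrow> 'v::ab_group_add set \<Rightarrow> ('v \<Rightarrow> 'v \<Rightarrow> complex) \<Rightarrow> ('v \<Rightarrow> 'v) \<Rightarrow> bool" where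
  "bounded_operator_on scl H ip T \<longleftrightarrow>
     (\<forall>x\<in>H. T x \<in> H) \<and>
     (\<forall>x\<in>H. \<forall>y\<in>H. T (x + y) = T x + T y) \<and>
     (\<forall>c. \<forall>x\<in>H. T (scl c x) = scl c (T x)) \<and>
     (\<exists>C. \<forall>x\<in>H. ip_norm ip (T x) \<le> C * ip_norm ip x)"

definition adjoint_on ::
  "'v set \<Rightarrow> ('v \<Rightarrow> 'v \<Rightarrow> complex) \<Rightarrow> ('v \<Rightarrow> 'v) \<Rightarrow> 'v \<Rightarrow> 'v" where
  "adjoint_on H ip T y = (THE x. x \<in> H \<and> (\<forall>u\<in>H. ip (T u) y = ip u x))"

definition Q_operator ::
  "'v::ab_group_add set \<Rightarrow> ('v \<Rightarrow> 'v \<Rightarrow> complex) \<Rightarrow> ('j::finite \<Rightarrow> 'v \<Rightarrow> 'v) \<Rightarrow> ('v \<Rightarrow> 'v) \<Rightarrow> 'v \<Rightarrow> 'v" where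
  "Q_operator H ip T X = (\<lambda>x. \<Sum>j\<in>UNIV. adjoint_on H ip (T j) (X (T j x)))"

definition joint_isometry ::
  "nat \<Rightarrow> (complex \<Rightarrow> 'v \<Rightarrow> 'v) \<Rightarrow> 'v::ab_group_add set \<Rightarrow> ('v \<Rightarrow> 'v \<Rightarrow> complex) \<Rightarrow> ('j::finite \<Rightarrow> 'v \<Rightarrow> 'v) \<Rightarrow> bool"
  where
  "joint_isometry m scl H ip T \<longleftrightarrow>
     complex_hilbert_space scl H ip \<and>
     (\<forall>j. bounded_operator_on scl H ip (T j)) \<and>
     (\<forall>i j. \<forall>x\<in>H. T i (T j x) = T j (T i x)) \<and>
     (\<forall>x\<in>H. (\<Sum>n\<le>m. scl ((-1) ^ n * of_nat (m choose n)) ((Q_operator H ip T ^^ n) id x)) = 0)"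


section \<open>Measures on the ball and the sphere, Poisson integrals\<close>

definition ball_volume :: "(complex ^ 'd::finite) measure" where
  "ball_volume = restrict_space (uniform_measure lborel (ball 0 1)) (ball 0 1)"

text \<open>
  Polar coordinates: the normalized surface area of a Borel set \<open>A\<close> in the sphere is the normalized
  volume of the cone of all \<open>r \<zeta>\<close> with \<open>\<zeta> \<in> A\<close> and \<open>0 < r < 1\<close>; \<open>sgn z\<close> is \<open>z / \<parallel>z\<parallel>\<close>.
\<close>
definition surface_measure :: "(complex ^ 'd::finite) measure" where
  "surface_measure = restrict_space (distr ball_volume borel sgn) (sphere 0 1)"

definition weighted_surface_measure :: "(complex ^ 'd::finite \<Rightarrow> real) \<Rightarrow> (complex ^ 'd) measure" where
  "weighted_surface_measure w = density surface_measure (\<lambda>\<zeta>. ennreal (w \<zeta>))"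

definition poisson_kernel :: "complex ^ 'd::finite \<Rightarrow> complex ^ 'd \<Rightarrow> real" where
  "poisson_kernel z \<zeta> = (1 - (norm z)\<^sup>2) / norm (z - \<zeta>) ^ (2 * CARD('d))"

definition poisson_integral :: "(complex ^ 'd::finite) measure \<Rightarrow> complex ^ 'd \<Rightarrow> real" where
  "poisson_integral \<mu> z = (\<integral>\<zeta>. poisson_kernel z \<zeta> \<partial>\<mu>)"


section \<open>Holomorphic functions on the ball and their power series\<close>

definition holomorphic_on_ball :: "(complex ^ 'd::finite \<Rightarrow> complex) \<Rightarrow> bool" where
  "holomorphic_on_ball f \<longleftrightarrow>
     (\<forall>z\<in>ball 0 1. \<exists>L. (f has_derivative L) (at z) \<and> (\<forall>c v. L (c *s v) = c * L v))"

definition partial_deriv :: "'d::finite \<Rightarrow> (complex ^ 'd \<Rightarrow> complex) \<Rightarrow> complex ^ 'd \<Rightarrow> complex" where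
  "partial_deriv j f z = deriv (\<lambda>t. f (z + axis j t)) 0"

text \<open>Multi-indices are functions \<open>'d \<Rightarrow> nat\<close>; multi-index series are unordered sums.\<close>

definition monomial_eval :: "('d::finite \<Rightarrow> nat) \<Rightarrow> complex ^ 'd \<Rightarrow> complex" where
  "monomial_eval \<alpha> z = (\<Prod>j\<in>UNIV. (z $ j) ^ \<alpha> j)"

definition power_series_on_ball ::
  "(complex ^ 'd::finite \<Rightarrow> complex) \<Rightarrow> (('d \<Rightarrow> nat) \<Rightarrow> complex) \<Rightarrow> bool" where
  "power_series_on_ball f a \<longleftrightarrow>
     (\<forall>z\<in>ball 0 1. ((\<lambda>\<alpha>. a \<alpha> * monomial_eval \<alpha> z) has_sum f z) UNIV)"

definition power_coeff :: "(complex ^ 'd::finite \<Rightarrow> complex) \<Rightarrow> ('d \<Rightarrow> nat) \<Rightarrow> complex" where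
  "power_coeff f = (THE a. power_series_on_ball f a)"

text \<open>\<open>\<alpha>! (d - 1)! / (|\<alpha>| + d - 1)!\<close>\<close>
definition hardy_weight :: "('d::finite \<Rightarrow> nat) \<Rightarrow> real" where
  "hardy_weight \<alpha> =
     (\<Prod>j\<in>UNIV. fact (\<alpha> j)) * fact (CARD('d) - 1) / fact ((\<Sum>j\<in>UNIV. \<alpha> j) + CARD('d) - 1)"


section \<open>Dirichlet-type spaces\<close>

definition hardy_norm_sq :: "(complex ^ 'd::finite \<Rightarrow> complex) \<Rightarrow> ennreal" where
  "hardy_norm_sq f = (\<Sum>\<^sub>\<infinity>\<alpha>. ennreal ((cmod (power_coeff f \<alpha>))\<^sup>2 * hardy_weight \<alpha>))"

definition dirichlet_norm_sq :: "(complex ^ 'd::finite) measure \<Rightarrow> (complex ^ 'd \<Rightarrow> complex) \<Rightarrow> ennreal" where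
  "dirichlet_norm_sq \<mu> f = hardy_norm_sq f +
     ennreal (1 / CARD('d)) *
       (\<integral>\<^sup>+ z. ennreal ((\<Sum>j\<in>UNIV. (cmod (partial_deriv j f z))\<^sup>2) * poisson_integral \<mu> z) \<partial>ball_volume)"

text \<open>
  A function on the ball is represented by its extension by zero, so that equality of functions is
  equality on the ball and the pointwise vector space operations apply. The expansion
  \<open>f(z) = \<Sum> a\<^sub>\<alpha> z\<^sup>\<alpha>\<close> through which the Hardy norm is defined is part of the definition; every
  holomorphic function on the ball has one.
\<close>
definition dirichlet_space :: "(complex ^ 'd::finite) measure \<Rightarrow> (complex ^ 'd \<Rightarrow> complex) set" where
  "dirichlet_space \<mu> =
     {f. (\<forall>z. z \<notin> ball 0 1 \<longrightarrow> f z = 0) \<and> holomorphic_on_ball f \<and>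
         (\<exists>a. power_series_on_ball f a) \<and> dirichlet_norm_sq \<mu> f < \<infinity>}"

text \<open>The polarization of \<open>dirichlet_norm_sq\<close>, see \<open>dirichlet_inner_self\<close> below.\<close>
definition dirichlet_inner ::
  "(complex ^ 'd::finite) measure \<Rightarrow> (complex ^ 'd \<Rightarrow> complex) \<Rightarrow> (complex ^ 'd \<Rightarrow> complex) \<Rightarrow> complex" where
  "dirichlet_inner \<mu> f g =
     (\<Sum>\<^sub>\<infinity>\<alpha>. power_coeff f \<alpha> * cnj (power_coeff g \<alpha>) * of_real (hardy_weight \<alpha>)) +
     of_real (1 / CARD('d)) *
       (\<integral>z. (\<Sum>j\<in>UNIV. partial_deriv j f z * cnj (partial_deriv j g z)) *
             of_real (poisson_integral \<mu> z) \<partial>ball_volume)"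

definition multiplier :: "(complex ^ 'd::finite) measure \<Rightarrow> (complex ^ 'd \<Rightarrow> complex) \<Rightarrow> bool" where
  "multiplier \<mu> \<phi> \<longleftrightarrow> (\<forall>f\<in>dirichlet_space \<mu>. (\<lambda>z. \<phi> z * f z) \<in> dirichlet_space \<mu>)"

definition coord_mult :: "'d::finite \<Rightarrow> (complex ^ 'd \<Rightarrow> complex) \<Rightarrow> complex ^ 'd \<Rightarrow> complex" where
  "coord_mult j f = (\<lambda>z. z $ j * f z)"

definition pointwise_scale :: "complex \<Rightarrow> ('x \<Rightarrow> complex) \<Rightarrow> 'x \<Rightarrow> complex" where
  "pointwise_scale c f = (\<lambda>z. c * f z)"


section \<open>Consistency of norm, inner product and measures\<close>

lemma vector_space_pointwise_scale: "vector_space (pointwise_scale :: complex \<Rightarrow> ('x \<Rightarrow> complex) \<Rightarrow> _)"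
  by unfold_locales (auto simp: pointwise_scale_def fun_eq_iff algebra_simps)

lemma emeasure_unit_ball_pos:
  "emeasure lborel (ball (0::complex^'d::finite) 1) \<noteq> 0"
  "emeasure lborel (ball (0::complex^'d::finite) 1) < \<infinity>"
  "emeasure lborel (ball (0::complex^'d::finite) 1) \<noteq> \<infinity>"
proof -
  have "0 < measure lborel (ball (0::complex^'d) 1)" by (rule content_ball_pos) simp
  then show "emeasure lborel (ball (0::complex^'d) 1) \<noteq> 0"
    by (auto simp: measure_def)
  show a: "emeasure lborel (ball (0::complex^'d) 1) < \<infinity>"
    using emeasure_lborel_ball_finite by auto
  then show "emeasure lborel (ball (0::complex^'d) 1) \<noteq> \<infinity>" by auto
qed

lemma space_ball_volume [simp]: "space ball_volume = ball (0::complex^'d::finite) 1"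
  by (simp add: ball_volume_def space_restrict_space)

lemma sets_ball_volume [measurable_cong]: "sets ball_volume = sets (restrict_space borel (ball (0::complex^'d::finite) 1))"
  by (simp add: ball_volume_def sets_restrict_space)

lemma emeasure_ball_volume_space: "emeasure (ball_volume :: (complex^'d::finite) measure) (space ball_volume) = 1"
proof -
  show "emeasure (ball_volume :: (complex^'d) measure) (space ball_volume) = 1"
    using emeasure_unit_ball_pos[where 'd='d]
    by (simp add: ball_volume_def emeasure_restrict_space space_restrict_space emeasure_uniform_measure_1)
qed

lemma emeasure_surface_measure_space: "emeasure (surface_measure :: (complex^'d::finite) measure) (space surface_measure) = 1"
proof -
  let ?V = "ball_volume :: (complex^'d) measure"
  have m: "sgn \<in> ?V \<rightarrow>\<^sub>M borel"
  proof -
    have "sgn \<in> borel_measurable (borel :: (complex^'d) measure)"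
      unfolding sgn_div_norm[abs_def] by measurable
    then show ?thesis
      by (simp add: measurable_restrict_space1 cong: measurable_cong_sets[OF sets_ball_volume refl])
  qed
  have "emeasure (surface_measure :: (complex^'d) measure) (space surface_measure)
      = emeasure (distr ?V borel sgn) (sphere 0 1)"
    by (simp add: surface_measure_def emeasure_restrict_space space_restrict_space)
  also have "\<dots> = emeasure ?V (sgn -` sphere 0 1 \<inter> space ?V)"
    by (rule emeasure_distr[OF m]) auto
  also have "sgn -` sphere 0 1 \<inter> space ?V = space ?V - {0}"
    by (auto simp: norm_sgn)
  also have "emeasure ?V (space ?V - {0}) = emeasure ?V (space ?V)"
  proof (rule emeasure_Diff_null_set)
    have "emeasure lborel (ball (0::complex^'d) 1 \<inter> {0}) = 0"
      by (rule emeasure_lborel_countable) auto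
    then show "{0} \<in> null_sets ?V"
      by (auto simp: ball_volume_def null_sets_def sets_restrict_space emeasure_restrict_space
          emeasure_uniform_measure)
    show "space ?V \<in> sets ?V" by (rule sets.top)
  qed
  also have "\<dots> = 1" by (rule emeasure_ball_volume_space)
  finally show "emeasure (surface_measure :: (complex^'d) measure) (space surface_measure) = 1" by simp
qed

lemma measurable_partial_deriv:
  assumes "f \<in> dirichlet_space (\<mu> :: (complex^'d::finite) measure)"
  shows "(\<lambda>z. if z \<in> ball 0 1 then partial_deriv j f z else 0) \<in> borel_measurable borel"
proof -
  have hol: "holomorphic_on_ball f" and zero: "\<And>z. z \<notin> ball 0 1 \<Longrightarrow> f z = 0"
    using assms by (auto simp: dirichlet_space_def)
  have "continuous_on (ball 0 1) f"
    using hol unfolding holomorphic_on_ball_def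
    by (meson continuous_at_imp_continuous_on has_derivative_continuous)
  then have "(\<lambda>z. indicator (ball 0 1) z *\<^sub>R f z) \<in> borel_measurable borel"
    by (intro borel_measurable_continuous_on_indicator) auto
  also have "(\<lambda>z. indicator (ball 0 1) z *\<^sub>R f z) = f"
    using zero by (auto simp: fun_eq_iff indicator_def)
  finally have f[measurable]: "f \<in> borel_measurable borel" .
  define e :: "nat \<Rightarrow> complex" where "e n = of_real (1 / Suc n)" for n
  have e0: "e \<longlonglongrightarrow> 0" unfolding e_def
    using tendsto_of_real[OF LIMSEQ_inverse_real_of_nat, where 'a=complex]
    by (simp add: inverse_eq_divide)
  have ax: "axis j c = c *s axis j 1" for c :: complex
    by (simp add: vec_eq_iff axis_def)
  show ?thesis
  proof (rule borel_measurable_LIMSEQ_metric)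
    show "(\<lambda>z. if z \<in> ball 0 1 then (f (z + axis j (e n)) - f z) / e n else 0) \<in> borel_measurable borel" for n
      by (intro measurable_If_set) (measurable, auto)
    fix z :: "complex^'d"
    show "(\<lambda>n. if z \<in> ball 0 1 then (f (z + axis j (e n)) - f z) / e n else 0) \<longlonglongrightarrow>
      (if z \<in> ball 0 1 then partial_deriv j f z else 0)"
    proof (cases "z \<in> ball 0 1")
      case True
      then obtain L where L: "(f has_derivative L) (at z)" "\<And>c v. L (c *s v) = c * L v"
        using hol unfolding holomorphic_on_ball_def by blast
      have bl: "bounded_linear (\<lambda>t::complex. axis j t :: complex^'d)"
      proof (rule linear_conv_bounded_linear[THEN iffD1])
        show "linear (\<lambda>t::complex. axis j t :: complex^'d)"
          by (intro linearI) (auto simp: vec_eq_iff axis_def)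
      qed
      have "((\<lambda>t. z + axis j t) has_derivative (\<lambda>t. axis j t)) (at (0::complex))"
        using bounded_linear_imp_has_derivative[OF bl] by (auto intro!: derivative_eq_intros)
      moreover have "axis j (0::complex) = (0 :: complex^'d)" by (auto simp: vec_eq_iff axis_def)
      ultimately have "((\<lambda>t. f (z + axis j t)) has_derivative (\<lambda>t. L (axis j t))) (at (0::complex))"
        using has_derivative_compose[of "\<lambda>t. z + axis j t" "\<lambda>t. axis j t" 0 UNIV f L] L(1) by (simp only: add_0_right)
      moreover have "(\<lambda>t. L (axis j t)) = (*) (L (axis j 1))"
        by (subst ax) (auto simp: L(2))
      ultimately have D: "((\<lambda>t. f (z + axis j t)) has_field_derivative L (axis j 1)) (at (0::complex))"
        by (simp add: has_field_derivative_def)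
      then have "partial_deriv j f z = L (axis j 1)"
        unfolding partial_deriv_def by (rule DERIV_imp_deriv)
      moreover have lim: "((\<lambda>h. (f (z + axis j h) - f z) / h) \<longlongrightarrow> L (axis j 1)) (at 0)"
        using D \<open>axis j 0 = 0\<close> by (simp add: DERIV_def)
      moreover have lime: "filterlim e (at 0) sequentially"
        using e0 by (auto simp: filterlim_at e_def simp del: of_nat_Suc)
      ultimately have "(\<lambda>n. (f (z + axis j (e n)) - f z) / e n) \<longlonglongrightarrow> partial_deriv j f z"
        using filterlim_compose[OF lim lime] by simp
      then show ?thesis using True by simp
    qed auto
  qed
qed

lemma measurable_poisson_integral:
  assumes "finite_measure (\<mu> :: (complex^'d::finite) measure)" "sets \<mu> = sets surface_measure"
  shows "poisson_integral \<mu> \<in> borel_measurable borel"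
proof -
  interpret finite_measure \<mu> by fact
  have ss[measurable_cong]: "sets \<mu> = sets (restrict_space borel (sphere 0 1))"
    using assms(2) by (simp add: surface_measure_def sets_restrict_space)
  have [measurable]: "(\<lambda>x. x) \<in> \<mu> \<rightarrow>\<^sub>M borel"
    by (simp add: measurable_cong_sets[OF ss refl] measurable_restrict_space1)
  have "(\<lambda>z. \<integral>\<zeta>. poisson_kernel z \<zeta> \<partial>\<mu>) \<in> borel_measurable borel"
    unfolding poisson_kernel_def by measurable
  then show ?thesis by (simp add: poisson_integral_def[abs_def])
qed

lemma poisson_integral_nonneg: "z \<in> ball 0 1 \<Longrightarrow> 0 \<le> poisson_integral \<mu> z"
  unfolding poisson_integral_def poisson_kernel_def
  by (intro Bochner_Integration.integral_nonneg divide_nonneg_nonneg) (auto simp: power_le_one)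

lemma hardy_weight_nonneg: "0 \<le> hardy_weight \<alpha>"
  by (auto simp: hardy_weight_def intro!: divide_nonneg_nonneg mult_nonneg_nonneg prod_nonneg)

lemma infsum_ennreal_finite:
  fixes h :: "'a \<Rightarrow> real"
  assumes "(\<Sum>\<^sub>\<infinity>x. ennreal (h x)) < \<infinity>" "\<And>x. 0 \<le> h x"
  shows "h summable_on UNIV" "ennreal (infsum h UNIV) = (\<Sum>\<^sub>\<infinity>x. ennreal (h x))"
proof -
  let ?S = "\<Sum>\<^sub>\<infinity>x. ennreal (h x)"
  have "sum h F \<le> enn2real ?S" if "finite F" for F
  proof -
    have "ennreal (sum h F) = (\<Sum>x\<in>F. ennreal (h x))" using assms by simp
    also have "\<dots> = (\<Sum>\<^sub>\<infinity>x\<in>F. ennreal (h x))" using that by simp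
    also have "\<dots> \<le> ?S" by (rule infsum_mono_neutral) (auto intro: nonneg_summable_on_complete)
    finally show ?thesis using assms(1)
      by (metis enn2real_mono enn2real_ennreal infinity_ennreal_def sum_nonneg assms(2))
  qed
  then show *: "h summable_on UNIV"
    by (intro nonneg_bdd_above_summable_on bdd_aboveI[where M="enn2real ?S"]) (auto simp: assms)
  have "?S = (SUP F\<in>{F. finite F \<and> F \<subseteq> UNIV}. (\<Sum>x\<in>F. ennreal (h x)))"
    by (subst nonneg_infsum_complete) auto
  also have "\<dots> = ennreal (infsum h UNIV)"
    using infsum_nonneg_is_SUPREMUM_ennreal[OF *] assms(2) by simp
  finally show "ennreal (infsum h UNIV) = ?S" by simp
qed

lemma dirichlet_inner_self:
  assumes \<mu>: "finite_measure (\<mu> :: (complex^'d::finite) measure)" "sets \<mu> = sets surface_measure"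
    and f: "f \<in> dirichlet_space \<mu>"
  shows "dirichlet_inner \<mu> f f = of_real (enn2real (dirichlet_norm_sq \<mu> f))"
proof -
  let ?h = "\<lambda>\<alpha>. (cmod (power_coeff f \<alpha>))\<^sup>2 * hardy_weight \<alpha>"
  let ?g = "\<lambda>z. (\<Sum>j\<in>UNIV. (cmod (partial_deriv j f z))\<^sup>2) * poisson_integral \<mu> z"
  have dm: "(\<lambda>z. partial_deriv j f z) \<in> borel_measurable ball_volume" for j
  proof -
    have "(\<lambda>z. if z \<in> ball 0 1 then partial_deriv j f z else 0) \<in> borel_measurable ball_volume"
      using measurable_partial_deriv[OF f, of j]
      by (simp add: measurable_restrict_space1 cong: measurable_cong_sets[OF sets_ball_volume refl])
    then show ?thesis by (rule measurable_cong[THEN iffD1, rotated]) simp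
  qed
  have pm: "poisson_integral \<mu> \<in> borel_measurable ball_volume"
      using measurable_poisson_integral[OF \<mu>]
      by (simp add: measurable_restrict_space1 cong: measurable_cong_sets[OF sets_ball_volume refl])
  note [measurable] = dm pm
  have fin: "dirichlet_norm_sq \<mu> f < \<infinity>" using f by (simp add: dirichlet_space_def)
  then have fin1: "hardy_norm_sq f < \<infinity>"
    by (auto simp: dirichlet_norm_sq_def)
  have fin2: "ennreal (1 / CARD('d)) * (\<integral>\<^sup>+z. ennreal (?g z) \<partial>ball_volume) < \<infinity>"
    using fin by (auto simp: dirichlet_norm_sq_def)
  have fin1': "(\<Sum>\<^sub>\<infinity>\<alpha>. ennreal (?h \<alpha>)) < \<infinity>"
    using fin1 by (simp only: hardy_norm_sq_def)
  have h0: "0 \<le> ?h \<alpha>" for \<alpha> by (intro mult_nonneg_nonneg hardy_weight_nonneg) simp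
  have H: "(\<Sum>\<^sub>\<infinity>\<alpha>. ?h \<alpha>) = enn2real (hardy_norm_sq f)"
    unfolding hardy_norm_sq_def infsum_ennreal_finite(2)[OF fin1' h0, symmetric]
    by (rule enn2real_ennreal[symmetric]) (rule infsum_nonneg, rule h0)
  have g: "?g \<in> borel_measurable ball_volume" by measurable
  have I: "(\<integral>z. ?g z \<partial>ball_volume) = enn2real (\<integral>\<^sup>+z. ennreal (?g z) \<partial>ball_volume)"
    by (rule integral_eq_nn_integral[OF g])
       (auto intro!: AE_I2 mult_nonneg_nonneg sum_nonneg poisson_integral_nonneg)
  have 1: "(\<Sum>\<^sub>\<infinity>\<alpha>. power_coeff f \<alpha> * cnj (power_coeff f \<alpha>) * of_real (hardy_weight \<alpha>)) =
      complex_of_real (\<Sum>\<^sub>\<infinity>\<alpha>. ?h \<alpha>)"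
  proof -
    have "((\<lambda>\<alpha>. complex_of_real (?h \<alpha>)) has_sum complex_of_real (\<Sum>\<^sub>\<infinity>\<alpha>. ?h \<alpha>)) UNIV"
      by (rule has_sum_of_real[OF has_sum_infsum[OF infsum_ennreal_finite(1)[OF fin1' h0]]])
    then show ?thesis
      unfolding of_real_mult complex_norm_square by (rule infsumI)
  qed
  have 2: "(\<integral>z. (\<Sum>j\<in>UNIV. partial_deriv j f z * cnj (partial_deriv j f z)) *
      of_real (poisson_integral \<mu> z) \<partial>ball_volume) = complex_of_real (\<integral>z. ?g z \<partial>ball_volume)"
    by (simp add: complex_norm_square[symmetric] flip: integral_complex_of_real of_real_mult of_real_power of_real_sum)
  have "enn2real (dirichlet_norm_sq \<mu> f) = enn2real (hardy_norm_sq f) +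
     1 / CARD('d) * enn2real (\<integral>\<^sup>+z. ennreal (?g z) \<partial>ball_volume)"
    unfolding dirichlet_norm_sq_def using fin1 fin2
    by (subst enn2real_plus) (auto simp: enn2real_mult)
  then show ?thesis
    unfolding dirichlet_inner_def 1 2 H I by simp
qed
end

theory Submission
  imports Defs
begin

text \<open>
  Write \<open>P\<close> for the Poisson integral of \<open>\<mu>\<close> and \<open>u = \<bar>f\<bar>\<^sup>2\<close>. The Hardy part of the norm is a joint isometry
  because \<open>\<Sum>\<^sub>j \<parallel>z\<^sup>\<alpha> z\<^sub>j\<parallel>\<^sup>2 = \<parallel>z\<^sup>\<alpha>\<parallel>\<^sup>2\<close>. For the Dirichlet part, the second difference of
  \<open>\<bar>\<nabla> f\<bar>\<^sup>2\<close> under multiplication by the coordinates is pointwise a quarter of the Laplacian of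
  \<open>(1 - \<parallel>z\<parallel>\<^sup>2)\<^sup>2 u\<close>. This function vanishes to second order on the sphere and \<open>P\<close> is harmonic, so the
  integral of the Laplacian against \<open>P\<close> is zero; boundary values are avoided by replacing
  \<open>(1 - x)\<^sup>2\<close> with compactly supported functions \<open>\<phi>\<close> and passing to the limit.
  The same formula, tested with a \<open>\<phi>\<close> for which \<open>\<phi>''\<close> is a cutoff function, bounds the \<open>P\<close>-weighted mass
  of \<open>u\<close> near the sphere by the energy of \<open>f\<close> and its mass on a smaller ball, where the Hardy norm
  controls \<open>u\<close>. Hence the coordinates are bounded multipliers. Completeness and the Riesz representation
  theorem turn the identity of quadratic forms into one of operators.
\<close>

section \<open>Adjoints in a Hilbert space\<close>

text \<open>For holomorphic g, |grad g|^2 is a quarter of the Laplacian of |g|^2, and the squared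
  moduli of the z_j g add up to ||z||^2 |g|^2. Applying the coordinates n times therefore replaces
  |f|^2 by ||z||^(2n) |f|^2 under the Laplacian, and the alternating binomial sum over n = 0, 1, 2
  gives (1 - ||z||^2)^2 |f|^2. This is the origin of the squared weight. The obstacle is that the
  norm gives no direct control of |f|^2 against the Poisson integral, although this function occurs
  in the Laplacian. The estimate near the sphere is therefore used twice: it keeps the products z_j
  f in the space, so that every term of the second difference is finite, and it supplies the
  dominating function for the limit. The Poisson kernel is unbounded near its pole. So Green's
  formula is proved for one boundary point and a test function supported away from the sphere, and
  is integrated over the measure only afterwards.\<close>

context complex_hilbert_space
begin

lemma carrier_closed:
  "0 \<in> H" "x \<in> H \<Longrightarrow> y \<in> H \<Longrightarrow> x + y \<in> H" "x \<in> H \<Longrightarrow> scl c x \<in> H"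
  "x \<in> H \<Longrightarrow> y \<in> H \<Longrightarrow> x - y \<in> H"
  using subspace_carrier subspace_0 subspace_add subspace_scale subspace_diff by blast+

lemma carrier_sum: "(\<And>i. i \<in> I \<Longrightarrow> f i \<in> H) \<Longrightarrow> sum f I \<in> H"
  using subspace_sum[OF subspace_carrier] by blast

lemma ip_add_right: "\<lbrakk>x \<in> H; y \<in> H; u \<in> H\<rbrakk> \<Longrightarrow> ip u (x + y) = ip u x + ip u y"
  by (metis ip_add_left ip_commute carrier_closed(2) complex_cnj_add)

lemma ip_scale_right: "\<lbrakk>x \<in> H; u \<in> H\<rbrakk> \<Longrightarrow> ip u (scl c x) = cnj c * ip u x"
  by (metis ip_scale_left ip_commute carrier_closed(3) complex_cnj_mult)

lemma ip_zero_left: "u \<in> H \<Longrightarrow> ip 0 u = 0"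
  using ip_scale_left[of 0 u 0] carrier_closed(1) by simp

lemma ip_zero_right: "u \<in> H \<Longrightarrow> ip u 0 = 0"
  using ip_scale_right[of 0 u 0] carrier_closed(1) by simp

lemma ip_diff_left: "\<lbrakk>x \<in> H; y \<in> H; u \<in> H\<rbrakk> \<Longrightarrow> ip (x - y) u = ip x u - ip y u"
  by (metis add_diff_cancel_right' carrier_closed(4) diff_add_cancel ip_add_left)

lemma ip_diff_right: "\<lbrakk>x \<in> H; y \<in> H; u \<in> H\<rbrakk> \<Longrightarrow> ip u (x - y) = ip u x - ip u y"
  by (metis add_diff_cancel_right' carrier_closed(4) diff_add_cancel ip_add_right)

lemma ip_sum_right:
  assumes "\<And>i. i \<in> I \<Longrightarrow> f i \<in> H" "u \<in> H"
  shows "ip u (sum f I) = (\<Sum>i\<in>I. ip u (f i))"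
  using assms
proof (induction I rule: infinite_finite_induct)
  case (insert x F)
  then show ?case using ip_add_right[of "f x" "sum f F" u] carrier_sum[of F f] by simp
qed (simp_all add: ip_zero_right)

abbreviation (input) q where "q x \<equiv> Re (ip x x)"

lemma ip_self: "x \<in> H \<Longrightarrow> ip x x = of_real (q x)"
  using ip_commute[of x x] by (auto simp: complex_eq_iff)

lemma q_nonneg: "x \<in> H \<Longrightarrow> 0 \<le> q x"
  using ip_positive[of x] ip_zero_left[OF carrier_closed(1)] by (cases "x = 0") auto

lemma q_add:
  assumes "x \<in> H" "y \<in> H"
  shows "q (x + y) = q x + q y + 2 * Re (ip x y)"
  using assms ip_commute[OF assms] by (simp add: ip_add_left ip_add_right carrier_closed)

lemma q_scale: "x \<in> H \<Longrightarrow> q (scl c x) = (cmod c)\<^sup>2 * q x"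
proof -
  assume x: "x \<in> H"
  then have "ip (scl c x) (scl c x) = (c * cnj c) * ip x x"
    by (simp add: ip_scale_left ip_scale_right carrier_closed)
  also have "\<dots> = (c * cnj c) * of_real (q x)"
    by (subst ip_self[OF x]) simp
  also have "\<dots> = of_real ((cmod c)\<^sup>2 * q x)" by (simp add: complex_norm_square[symmetric])
  finally show ?thesis by simp
qed

lemma q_diff:
  assumes "x \<in> H" "y \<in> H"
  shows "q (x - y) = q x + q y - 2 * Re (ip x y)"
  using assms ip_commute[OF assms] by (simp add: ip_diff_left ip_diff_right carrier_closed)

lemma cauchy_schwarz:
  assumes "x \<in> H" "y \<in> H"
  shows "(cmod (ip x y))\<^sup>2 \<le> q x * q y"
proof (cases "y = 0")
  case False
  define c where "c = ip x y / q y"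
  have y: "q y > 0" using False assms ip_positive by blast
  have "0 \<le> q (x - scl c y)" by (intro q_nonneg carrier_closed assms)
  also have "\<dots> = q x + (cmod c)\<^sup>2 * q y - 2 * Re (cnj c * ip x y)"
    using assms q_scale[of y c] by (subst q_diff) (simp_all add: carrier_closed ip_scale_right)
  also have "Re (cnj c * ip x y) = (cmod (ip x y))\<^sup>2 / q y"
    by (simp add: c_def cmod_power2 add_divide_distrib) (simp add: power2_eq_square)
  also have "(cmod c)\<^sup>2 * q y = (cmod (ip x y))\<^sup>2 / q y"
    using y by (simp add: c_def norm_divide power_divide power2_eq_square)
  finally have "(cmod (ip x y))\<^sup>2 / q y \<le> q x" by simp
  then show ?thesis using y by (simp add: field_simps)
qed (use assms ip_zero_right in auto)

lemma cauchy_schwarz_norm: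
  assumes "x \<in> H" "y \<in> H"
  shows "cmod (ip x y) \<le> ip_norm ip x * ip_norm ip y"
  using real_sqrt_le_mono[OF cauchy_schwarz[OF assms]] by (simp add: ip_norm_def real_sqrt_mult)

lemma ip_nondegenerate:
  assumes "x \<in> H" "\<And>u. u \<in> H \<Longrightarrow> ip u x = 0"
  shows "x = 0"
  using assms ip_positive[of x] by force

text \<open>The representing vector minimises \<open>\<parallel>x\<parallel>\<^sup>2 - 2 Re L(x)\<close>.\<close>
lemma riesz_representation:
  assumes add: "\<And>x y. x \<in> H \<Longrightarrow> y \<in> H \<Longrightarrow> L (x + y) = L x + L y"
    and scale: "\<And>c x. x \<in> H \<Longrightarrow> L (scl c x) = c * L x"
    and bound: "\<And>x. x \<in> H \<Longrightarrow> cmod (L x) \<le> K * ip_norm ip x"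
  shows "\<exists>x\<in>H. \<forall>u\<in>H. L u = ip u x"
proof -
  define J where "J x = q x - 2 * Re (L x)" for x
  \<comment> \<open>Completing the square: \<open>J x\<close> is at least
    \<open>(ip_norm ip x - K)\<^sup>2 - K\<^sup>2\<close>.\<close>
  have J_low: "- K\<^sup>2 \<le> J x" if "x \<in> H" for x
  proof -
    have "Re (L x) \<le> K * ip_norm ip x" using bound[OF that] complex_Re_le_cmod order_trans by blast
    moreover have "q x = (ip_norm ip x)\<^sup>2" using q_nonneg[OF that] by (simp add: ip_norm_def)
    moreover have "0 \<le> (ip_norm ip x - K)\<^sup>2" by simp
    ultimately show ?thesis unfolding J_def by (auto simp: power2_diff algebra_simps)
  qed
  have bdd: "bdd_below (J ` H)" by (rule bdd_belowI2[of _ "- K\<^sup>2"]) (rule J_low)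
  define m where "m = Inf (J ` H)"
  have m_le: "m \<le> J x" if "x \<in> H" for x
    unfolding m_def using bdd that by (intro cInf_lower) auto
  have "\<exists>x\<in>H. J x < m + inverse (real (Suc n))" for n
    using cInf_lessD[of "J ` H" "m + inverse (real (Suc n))"] carrier_closed(1) unfolding m_def by auto
  then obtain X where X: "\<And>n. X n \<in> H" "\<And>n. J (X n) < m + inverse (real (Suc n))" by metis
  \<comment> \<open>Parallelogram law: comparing \<open>J\<close> at the midpoint with the infimum
    \<open>m\<close> turns near-minimality of \<open>x\<close> and \<open>y\<close> into closeness,
    so a minimising sequence is Cauchy.\<close>
  have par: "q (x - y) \<le> 2 * (J x + J y - 2 * m)" if "x \<in> H" "y \<in> H" for x y
  proof -
    have "m \<le> J (scl (1/2) (x + y))" by (intro m_le carrier_closed that)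
    also have "\<dots> = (q x + q y + 2 * Re (ip x y)) / 4 - Re (L x + L y)"
      using that q_scale[of "x + y" "1/2"] unfolding J_def
      by (simp add: q_add carrier_closed scale add power_divide add_divide_distrib del: scale_right_distrib)
    finally show ?thesis using that unfolding J_def by (simp add: q_diff field_simps)
  qed
  have "\<forall>e>0. \<exists>N::nat. \<forall>m\<ge>N. \<forall>n\<ge>N. ip_norm ip (X m - X n) < e"
  proof (intro allI impI)
    fix e :: real assume e: "e > 0"
    obtain N where N: "4 * inverse (real (Suc N)) < e\<^sup>2"
      using reals_Archimedean[of "e\<^sup>2 / 4"] e by (auto simp: field_simps)
    have "ip_norm ip (X i - X j) < e" if "N \<le> i" "N \<le> j" for i j
    proof -
      define r where "r = inverse (real (Suc N))"
      have "J (X k) < m + r" if "N \<le> k" for k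
      proof -
        have "inverse (real (Suc k)) \<le> r" using that by (simp add: r_def field_simps)
        then show ?thesis using X(2)[of k] by linarith
      qed
      from this[OF that(1)] this[OF that(2)] have "J (X i) + J (X j) - 2 * m < 2 * r" by linarith
      from mult_strict_left_mono[OF this, of 2]
      have "2 * (J (X i) + J (X j) - 2 * m) < 2 * (2 * r)" by simp
      also have "\<dots> < e\<^sup>2" using N[folded r_def] by simp
      finally have "2 * (J (X i) + J (X j) - 2 * m) < e\<^sup>2" .
      then have "q (X i - X j) < e\<^sup>2" by (rule le_less_trans[OF par[OF X(1) X(1)]])
      then show ?thesis unfolding ip_norm_def using e real_less_lsqrt by auto
    qed
    then show "\<exists>N::nat. \<forall>m\<ge>N. \<forall>n\<ge>N. ip_norm ip (X m - X n) < e" by blast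
  qed
  from complete_carrier[OF X(1) this] obtain x where x: "x \<in> H" "(\<lambda>n. ip_norm ip (X n - x)) \<longlonglongrightarrow> 0" by blast
  have lim: "(\<lambda>n. ip u (X n)) \<longlonglongrightarrow> ip u x" if u: "u \<in> H" for u
  proof (rule Lim_null[THEN iffD2], rule Lim_null_comparison)
    show "\<forall>\<^sub>F n in sequentially. norm (ip u (X n) - ip u x) \<le> ip_norm ip u * ip_norm ip (X n - x)"
      using cauchy_schwarz_norm[OF u carrier_closed(4)[OF X(1) x(1)]] u X(1) x(1)
      by (auto simp: ip_diff_right)
    show "(\<lambda>n. ip_norm ip u * ip_norm ip (X n - x)) \<longlonglongrightarrow> 0"
      using tendsto_mult_left[OF x(2), of "ip_norm ip u"] by simp
  qed
  have Re0: "Re (ip u x) = Re (L u)" if u: "u \<in> H" for u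
  proof -
    \<comment> \<open>First variation: a step \<open>t\<close> in direction \<open>u\<close> from
      \<open>X n\<close> cannot push \<open>J\<close> below \<open>m\<close>, and
      \<open>J (X n)\<close> exceeds \<open>m\<close> by less than
      \<open>inverse (real (Suc n))\<close>. The limit is a quadratic in \<open>t\<close> without
      constant term that is never negative, so its linear coefficient must vanish.\<close>
    have ineq: "0 \<le> t\<^sup>2 * q u + 2 * t * Re (ip u x - L u)" for t :: real
    proof (rule LIMSEQ_le[OF _ _])
      show "(\<lambda>n. - inverse (real (Suc n))) \<longlonglongrightarrow> 0"
        using tendsto_minus[OF LIMSEQ_inverse_real_of_nat] by simp
      show "(\<lambda>n. t\<^sup>2 * q u + 2 * t * Re (ip u (X n) - L u)) \<longlonglongrightarrow> t\<^sup>2 * q u + 2 * t * Re (ip u x - L u)"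
        by (intro tendsto_intros lim u)
      have "- inverse (real (Suc n)) \<le> t\<^sup>2 * q u + 2 * t * Re (ip u (X n) - L u)" for n
      proof -
        have "m \<le> J (X n + scl (of_real t) u)" by (intro m_le carrier_closed X u)
        also have "\<dots> = J (X n) + t\<^sup>2 * q u + 2 * t * Re (ip u (X n) - L u)"
          using X(1)[of n] u ip_commute[OF u X(1)[of n]]
          by (simp add: J_def q_add carrier_closed ip_scale_left ip_scale_right add scale power2_eq_square algebra_simps)
        finally show ?thesis using X(2)[of n] by simp
      qed
      then show "\<exists>N. \<forall>n\<ge>N. - inverse (real (Suc n)) \<le> t\<^sup>2 * q u + 2 * t * Re (ip u (X n) - L u)" by blast
    qed
    show ?thesis
    proof (rule ccontr)
      define r where "r = Re (ip u x - L u)"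
      assume "Re (ip u x) \<noteq> Re (L u)"
      then have r: "r\<^sup>2 > 0" by (simp add: r_def)
      have p: "q u + 1 > 0" using q_nonneg[OF u] by simp
      \<comment> \<open>The step is \<open>- r / (q u + 1)\<close>; the exact minimiser would divide
        by \<open>q u\<close>, which may be 0.\<close>
      have "0 \<le> (r / (q u + 1))\<^sup>2 * q u - 2 * (r\<^sup>2 / (q u + 1))"
        using ineq[of "- r / (q u + 1)", folded r_def] by (simp add: power2_eq_square mult_ac)
      also have "\<dots> \<le> (r / (q u + 1))\<^sup>2 * (q u + 1) - 2 * (r\<^sup>2 / (q u + 1))"
        by (intro diff_right_mono mult_left_mono) auto
      also have "(r / (q u + 1))\<^sup>2 * (q u + 1) = r\<^sup>2 / (q u + 1)"
        using p by (simp add: power_divide power2_eq_square[of "q u + 1"])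
      finally show False using divide_pos_pos[OF r p] by simp
    qed
  qed
  have "L u = ip u x" if u: "u \<in> H" for u
  proof (rule complex_eqI)
    show "Re (L u) = Re (ip u x)" using Re0[OF u] by simp
    \<comment> \<open>Both sides are complex linear in \<open>u\<close>, so the real part at
      \<open>scl \<i> u\<close> determines the imaginary part at \<open>u\<close>.\<close>
    show "Im (L u) = Im (ip u x)"
      using Re0[OF carrier_closed(3)[OF u, of \<i>]] u x(1) by (simp add: scale ip_scale_left)
  qed
  then show ?thesis using x(1) by blast
qed

text \<open>\<open>adjoint_on\<close> is a definite description and says nothing before existence
  and uniqueness are known. Existence is Riesz representation of the functional sending
  \<open>u\<close> to \<open>ip (T u) y\<close>; uniqueness is nondegeneracy of the inner
  product.\<close>

lemma adjoint_on_spec: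
  assumes T: "bounded_operator_on scl H ip T" and y: "y \<in> H"
  shows "adjoint_on H ip T y \<in> H" "\<And>u. u \<in> H \<Longrightarrow> ip (T u) y = ip u (adjoint_on H ip T y)"
proof -
  from T obtain C where TH: "\<And>x. x \<in> H \<Longrightarrow> T x \<in> H"
    and T': "\<And>x y. x \<in> H \<Longrightarrow> y \<in> H \<Longrightarrow> T (x + y) = T x + T y" "\<And>c x. x \<in> H \<Longrightarrow> T (scl c x) = scl c (T x)"
    and C: "\<And>x. x \<in> H \<Longrightarrow> ip_norm ip (T x) \<le> C * ip_norm ip x"
    unfolding bounded_operator_on_def by metis
  have "\<exists>x\<in>H. \<forall>u\<in>H. ip (T u) y = ip u x"
  proof (rule riesz_representation[where K = "C * ip_norm ip y"])
    fix x assume x: "x \<in> H"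
    have "0 \<le> ip_norm ip y" using q_nonneg[OF y] by (simp add: ip_norm_def)
    then have "ip_norm ip (T x) * ip_norm ip y \<le> C * ip_norm ip x * ip_norm ip y"
      by (intro mult_right_mono C x)
    then show "cmod (ip (T x) y) \<le> C * ip_norm ip y * ip_norm ip x"
      using cauchy_schwarz_norm[OF TH[OF x] y] by (simp add: algebra_simps)
  qed (use TH T' y in \<open>auto simp: ip_add_left ip_scale_left\<close>)
  then have "\<exists>!x. x \<in> H \<and> (\<forall>u\<in>H. ip (T u) y = ip u x)"
  proof (elim bexE, intro ex1I conjI)
    fix x x' assume *: "x \<in> H" "\<forall>u\<in>H. ip (T u) y = ip u x" "x' \<in> H \<and> (\<forall>u\<in>H. ip (T u) y = ip u x')"
    have "x' - x = 0" by (rule ip_nondegenerate) (use * in \<open>auto simp: carrier_closed ip_diff_right\<close>)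
    then show "x' = x" by simp
  qed auto
  from theI'[OF this] show "adjoint_on H ip T y \<in> H"
    "\<And>u. u \<in> H \<Longrightarrow> ip (T u) y = ip u (adjoint_on H ip T y)"
    unfolding adjoint_on_def by blast+
qed

text \<open>Polarization: the Hermitian form \<open>B\<close> of the defect operator vanishes on the
  diagonal, hence everywhere, so the defect of every \<open>x\<close> is orthogonal to the whole
  space.\<close>

lemma joint_2_isometryI:
  fixes T :: "'j::finite \<Rightarrow> 'v \<Rightarrow> 'v"
  assumes T: "\<And>j. bounded_operator_on scl H ip (T j)"
    and comm: "\<And>i j x. x \<in> H \<Longrightarrow> T i (T j x) = T j (T i x)"
    and id: "\<And>x. x \<in> H \<Longrightarrow>
      q x - 2 * (\<Sum>j\<in>UNIV. q (T j x)) + (\<Sum>j\<in>UNIV. \<Sum>i\<in>UNIV. q (T i (T j x))) = 0"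
  shows "joint_isometry 2 scl H ip T"
  unfolding joint_isometry_def
proof (intro conjI allI ballI)
  show "complex_hilbert_space scl H ip" by (rule complex_hilbert_space_axioms)
  fix x assume x: "x \<in> H"
  have TH: "T j y \<in> H" if "y \<in> H" for j y using T[of j] that unfolding bounded_operator_on_def by blast
  have Tadd: "T j (y + z) = T j y + T j z" if "y \<in> H" "z \<in> H" for j y z
    using T[of j] that unfolding bounded_operator_on_def by blast
  have Tscl: "T j (scl c y) = scl c (T j y)" if "y \<in> H" for j c y
    using T[of j] that unfolding bounded_operator_on_def by blast
  note adj = adjoint_on_spec[OF T]
  define B where "B u v = ip u v - 2 * (\<Sum>j\<in>UNIV. ip (T j u) (T j v)) +
    (\<Sum>j\<in>UNIV. \<Sum>i\<in>UNIV. ip (T i (T j u)) (T i (T j v)))" for u v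
  have B_self: "Re (B u u) = 0" if "u \<in> H" for u
    using id[OF that] by (simp add: B_def)
  have B_cnj: "B v u = cnj (B u v)" if "u \<in> H" "v \<in> H" for u v
    using that by (simp add: B_def ip_commute[of u v] ip_commute[of "T _ u" "T _ v"]
        ip_commute[of "T _ (T _ u)" "T _ (T _ v)"] TH)
  have B_add: "B (u + v) (u + v) = B u u + B u v + B v u + B v v" if "u \<in> H" "v \<in> H" for u v
    using that by (simp add: B_def Tadd TH carrier_closed ip_add_left ip_add_right sum.distrib algebra_simps)
  have B_i: "B (scl \<i> u) v = \<i> * B u v" if "u \<in> H" "v \<in> H" for u v
    using that by (simp add: B_def Tscl TH carrier_closed ip_scale_left sum_distrib_left algebra_simps)
  have B_Re: "Re (B u v) = 0" if "u \<in> H" "v \<in> H" for u v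
    using that B_self[of "u + v"] B_self[of u] B_self[of v] B_add[of u v] B_cnj[of u v]
    by (simp add: carrier_closed)
  \<comment> \<open>The diagonal at \<open>u + v\<close> only kills the real part of
    \<open>B\<close>; replacing \<open>u\<close> by \<open>scl \<i> u\<close> moves the imaginary
    part into its place.\<close>
  have B_0: "B u v = 0" if "u \<in> H" "v \<in> H" for u v
    using B_Re[of u v] B_Re[of "scl \<i> u" v] that by (simp add: B_i carrier_closed complex_eq_iff)
  define Q1 where "Q1 y = (\<Sum>j\<in>UNIV. adjoint_on H ip (T j) (T j y))" for y
  define Q2 where "Q2 y = (\<Sum>j\<in>UNIV. adjoint_on H ip (T j) (Q1 (T j y)))" for y
  have Q1H: "Q1 y \<in> H" if "y \<in> H" for y unfolding Q1_def by (intro carrier_sum adj TH that)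
  have Q2H: "Q2 y \<in> H" if "y \<in> H" for y unfolding Q2_def by (intro carrier_sum adj TH Q1H that)
  have Q1: "ip u (Q1 y) = (\<Sum>j\<in>UNIV. ip (T j u) (T j y))" if "u \<in> H" "y \<in> H" for u y
    unfolding Q1_def using that by (subst ip_sum_right) (auto simp: adj TH)
  have Q2: "ip u (Q2 y) = (\<Sum>j\<in>UNIV. \<Sum>i\<in>UNIV. ip (T i (T j u)) (T i (T j y)))"
    if "u \<in> H" "y \<in> H" for u y
    unfolding Q2_def using that
    by (subst ip_sum_right) (auto simp: adj(1) adj(2)[symmetric] TH Q1H Q1)
  have "(\<Sum>n\<le>2. scl ((- 1) ^ n * of_nat (2 choose n)) ((Q_operator H ip T ^^ n) id x)) =
     x - scl 2 (Q1 x) + Q2 x"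
    by (simp add: numeral_2_eq_2 Q_operator_def Q1_def Q2_def)
  also have "\<dots> = 0"
  proof (rule ip_nondegenerate)
    show "x - scl 2 (Q1 x) + Q2 x \<in> H" by (intro carrier_closed Q1H Q2H x)
    fix u assume u: "u \<in> H"
    have "ip u (x - scl 2 (Q1 x) + Q2 x) = B u x"
      using u x by (simp add: ip_add_right ip_diff_right carrier_closed Q1H Q2H ip_scale_right Q1 Q2 B_def)
    then show "ip u (x - scl 2 (Q1 x) + Q2 x) = 0" using B_0[OF u x] by simp
  qed
  finally show "(\<Sum>n\<le>2. scl ((- 1) ^ n * of_nat (2 choose n)) ((Q_operator H ip T ^^ n) id x)) = 0" .
qed (use T comm in auto)

end

section \<open>Power series on the ball\<close>

text \<open>For \<open>\<alpha> j = 0\<close> the truncated subtraction does no harm, because the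
  factor \<open>of_nat (\<alpha> j)\<close> is 0.\<close>

definition monomial_partial :: "'d::finite \<Rightarrow> ('d \<Rightarrow> nat) \<Rightarrow> complex ^ 'd \<Rightarrow> complex" where
  "monomial_partial j \<alpha> z = of_nat (\<alpha> j) * monomial_eval (\<alpha>(j := \<alpha> j - 1)) z"

lemma monomial_eval_remove:
  "monomial_eval \<alpha> z = z $ j ^ \<alpha> j * (\<Prod>k\<in>UNIV - {j}. z $ k ^ \<alpha> k)"
  unfolding monomial_eval_def by (subst prod.remove[of UNIV j]) auto

lemma monomial_eval_upd:
  "monomial_eval (\<alpha>(j := n)) z = z $ j ^ n * (\<Prod>k\<in>UNIV - {j}. z $ k ^ \<alpha> k)"
  by (subst monomial_eval_remove[of _ _ j]) (auto intro!: prod.cong)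

lemma monomial_eval_Suc: "monomial_eval (\<alpha>(j := Suc (\<alpha> j))) z = z $ j * monomial_eval \<alpha> z"
  unfolding monomial_eval_upd monomial_eval_remove[of \<alpha> z j] by simp

lemma norm_monomial_eval: "cmod (monomial_eval \<alpha> z) = (\<Prod>k\<in>UNIV. cmod (z $ k) ^ \<alpha> k)"
  by (simp add: monomial_eval_def prod_norm[symmetric] norm_power)

lemma monomial_eval_has_derivative:
  "(monomial_eval \<alpha> has_derivative (\<lambda>h. \<Sum>j\<in>UNIV. h $ j * monomial_partial j \<alpha> z)) (at z)"
proof -
  have "((\<lambda>z. z $ j ^ \<alpha> j) has_derivative (\<lambda>h. of_nat (\<alpha> j) * (h $ j) * (z $ j) ^ (\<alpha> j - 1))) (at z)" for j
    by (intro has_derivative_power[OF bounded_linear_imp_has_derivative] bounded_linear_vec_nth)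
  then have "((\<lambda>z. \<Prod>j\<in>UNIV. z $ j ^ \<alpha> j) has_derivative
     (\<lambda>h. \<Sum>i\<in>UNIV. of_nat (\<alpha> i) * (h $ i) * (z $ i) ^ (\<alpha> i - 1) * (\<Prod>j\<in>UNIV-{i}. z $ j ^ \<alpha> j))) (at z)"
    by (intro has_derivative_prod) auto
  moreover have "monomial_eval \<alpha> = (\<lambda>z. \<Prod>j\<in>UNIV. z $ j ^ \<alpha> j)"
    by (simp add: monomial_eval_def fun_eq_iff)
  ultimately show ?thesis
    unfolding monomial_partial_def monomial_eval_upd by (simp add: mult_ac)
qed

text \<open>The left side is the linear term of the binomial expansion of the right side, whose
  terms are all nonnegative.\<close>

lemma power_diff_quotient_bound:
  fixes r \<delta> :: real
  assumes "0 \<le> r" "0 \<le> \<delta>"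
  shows "real n * r ^ (n - 1) * \<delta> \<le> (r + \<delta>) ^ n"
proof (induction n)
  case (Suc n)
  have "real (Suc n) * r ^ (Suc n - 1) * \<delta> = r * (real n * r ^ (n - 1) * \<delta>) + \<delta> * r ^ n"
    by (cases n) (auto simp: algebra_simps)
  also have "\<dots> \<le> r * (r + \<delta>) ^ n + \<delta> * (r + \<delta>) ^ n"
    using Suc assms by (intro add_mono mult_left_mono power_mono) auto
  finally show ?case by (simp add: algebra_simps)
qed auto

text \<open>The factor 2 leaves room to bound derivatives of monomials on the ball of radius \<open>\<delta>\<close> about \<open>z\<close>.\<close>
definition enlarged :: "complex ^ 'd::finite \<Rightarrow> real \<Rightarrow> complex ^ 'd" where
  "enlarged z \<delta> = (\<chi> k. of_real (cmod (z $ k) + 2 * \<delta>))"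

lemma enlarged_in_ball:
  fixes z :: "complex ^ 'd::finite"
  assumes "z \<in> ball 0 1"
  obtains \<delta> where "\<delta> > 0" "enlarged z \<delta> \<in> ball 0 1"
proof
  define c where "c = norm ((\<chi> k. 1) :: complex ^ 'd)"
  \<comment> \<open>\<open>c\<close> is the norm of the all-ones vector, so the enlargement adds at
    most \<open>2 * \<delta> * (c + 1)\<close> to the norm, which is half the distance from
    \<open>z\<close> to the sphere. The summand 1 keeps the denominator positive from
    \<open>c \<ge> 0\<close> alone.\<close>
  define \<delta> where "\<delta> = (1 - norm z) / (4 * (c + 1))"
  have c: "c \<ge> 0" by (simp add: c_def)
  show \<delta>: "\<delta> > 0" using assms c by (simp add: \<delta>_def)
  have 1: "enlarged z \<delta> = (\<chi> k. of_real (cmod (z $ k))) + (2 * \<delta>) *\<^sub>R ((\<chi> k. 1) :: complex ^ 'd)"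
    by (simp add: enlarged_def vec_eq_iff of_real_def scaleR_add_left)
  have 2: "norm ((\<chi> k. of_real (cmod (z $ k))) :: complex ^ 'd) = norm z"
    by (simp add: norm_vec_def)
  have "norm (enlarged z \<delta>) \<le> norm z + 2 * \<delta> * c"
    unfolding 1 by (rule order_trans[OF norm_triangle_ineq]) (use \<delta> in \<open>simp add: 2 c_def\<close>)
  also have "2 * \<delta> * c \<le> 2 * \<delta> * (c + 1)" using \<delta> by simp
  also have "2 * \<delta> * (c + 1) = (1 - norm z) / 2" using c by (simp add: \<delta>_def field_simps)
  finally show "enlarged z \<delta> \<in> ball 0 1" using assms by (simp add: field_simps)
qed

lemma norm_nth_le_of_ball:
  assumes "w \<in> ball z \<delta>"
  shows "cmod (w $ k) \<le> cmod (z $ k) + \<delta>"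
proof -
  have "cmod (w $ k) \<le> cmod (z $ k) + cmod ((w - z) $ k)"
    using norm_triangle_ineq[of "z $ k" "(w - z) $ k"] by simp
  also have "cmod ((w - z) $ k) \<le> norm (w - z)" by (rule Finite_Cartesian_Product.norm_nth_le)
  finally show ?thesis using assms by (simp add: dist_norm norm_minus_commute)
qed

lemma enlarged_ball_subset:
  assumes "\<delta> > 0" "enlarged z \<delta> \<in> ball 0 1"
  shows "ball z \<delta> \<subseteq> ball 0 1"
proof
  fix w assume w: "w \<in> ball z \<delta>"
  have "norm w \<le> norm (enlarged z \<delta>)"
    unfolding norm_vec_def
  proof (rule L2_set_mono)
    fix k show "cmod (w $ k) \<le> cmod (enlarged z \<delta> $ k)"
      using norm_nth_le_of_ball[OF w, of k] assms(1)
      by (simp add: enlarged_def del: of_real_add of_real_mult)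
  qed auto
  then show "w \<in> ball 0 1" using assms(2) by simp
qed

text \<open>A Cauchy estimate without contour integrals: one \<delta> covers the way from
  \<open>z\<close> to \<open>w\<close>, the other pays for the derivative through
  \<open>power_diff_quotient_bound\<close>. The bound does not depend on \<open>w\<close>, so a
  single convergent series majorizes the differentiated series on a whole neighbourhood.\<close>

lemma norm_monomial_partial_le:
  assumes \<delta>: "\<delta> > 0" and w: "w \<in> ball z \<delta>"
  shows "cmod (monomial_partial j \<alpha> w) \<le> cmod (monomial_eval \<alpha> (enlarged z \<delta>)) / \<delta>"
proof -
  note [simp del] = of_real_add of_real_mult
  have le: "cmod (w $ k) \<le> cmod (z $ k) + \<delta>" for k by (rule norm_nth_le_of_ball[OF w])
  have "cmod (monomial_partial j \<alpha> w) * \<delta> =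
      (real (\<alpha> j) * cmod (w $ j) ^ (\<alpha> j - 1) * \<delta>) * (\<Prod>k\<in>UNIV - {j}. cmod (w $ k) ^ \<alpha> k)"
    by (simp add: monomial_partial_def monomial_eval_upd norm_mult norm_power prod_norm[symmetric])
  also have "\<dots> \<le> (cmod (z $ j) + 2 * \<delta>) ^ \<alpha> j * (\<Prod>k\<in>UNIV - {j}. (cmod (z $ k) + 2 * \<delta>) ^ \<alpha> k)"
  proof (rule mult_mono)
    have "real (\<alpha> j) * cmod (w $ j) ^ (\<alpha> j - 1) * \<delta> \<le> (cmod (w $ j) + \<delta>) ^ \<alpha> j"
      using \<delta> by (intro power_diff_quotient_bound) auto
    also have "\<dots> \<le> (cmod (z $ j) + 2 * \<delta>) ^ \<alpha> j"
      using \<delta> le[of j] by (intro power_mono) auto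
    finally show "real (\<alpha> j) * cmod (w $ j) ^ (\<alpha> j - 1) * \<delta> \<le> (cmod (z $ j) + 2 * \<delta>) ^ \<alpha> j" .
    show "(\<Prod>k\<in>UNIV - {j}. cmod (w $ k) ^ \<alpha> k) \<le> (\<Prod>k\<in>UNIV - {j}. (cmod (z $ k) + 2 * \<delta>) ^ \<alpha> k)"
    proof (intro prod_mono conjI power_mono)
      show "cmod (w $ k) \<le> cmod (z $ k) + 2 * \<delta>" for k using le[of k] \<delta> by simp
    qed auto
  qed (use \<delta> in \<open>auto intro!: prod_nonneg\<close>)
  also have "\<dots> = cmod (monomial_eval \<alpha> (enlarged z \<delta>))"
    using \<delta> by (simp add: norm_monomial_eval prod.remove[of UNIV j] enlarged_def)
  finally show ?thesis using \<delta> by (simp add: field_simps)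
qed

lemma power_series_abs_summable:
  assumes "power_series_on_ball f a" "z \<in> ball 0 1"
  shows "(\<lambda>\<alpha>. cmod (a \<alpha>) * cmod (monomial_eval \<alpha> z)) summable_on UNIV"
proof -
  have "(\<lambda>\<alpha>. a \<alpha> * monomial_eval \<alpha> z) summable_on UNIV"
    using assms unfolding power_series_on_ball_def by (meson has_sum_imp_summable)
  then show ?thesis
    by (simp add: summable_on_iff_abs_summable_on_complex norm_mult)
qed

lemma infinite_multi_indices: "infinite (UNIV :: ('d::finite \<Rightarrow> nat) set)"
proof
  assume "finite (UNIV :: ('d \<Rightarrow> nat) set)"
  then have "finite (range (\<lambda>n. (\<lambda>_. n) :: 'd \<Rightarrow> nat))" by (rule finite_subset[rotated]) auto
  moreover have "inj (\<lambda>n. (\<lambda>_. n) :: 'd \<Rightarrow> nat)" by (auto simp: inj_def fun_eq_iff)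
  ultimately show False using finite_imageD infinite_UNIV_nat by blast
qed

text \<open>Term-by-term differentiation: the series of moduli at
  \<open>enlarged z \<delta>\<close>, divided by \<delta>, is a Weierstrass majorant for each
  partial derivative on \<open>ball z \<delta>\<close>.\<close>

lemma power_series_has_derivative:
  fixes f :: "complex ^ 'd::finite \<Rightarrow> complex"
  assumes ps: "power_series_on_ball f a" and z: "z \<in> ball 0 1"
  shows "(\<lambda>\<alpha>. a \<alpha> * monomial_partial j \<alpha> z) summable_on UNIV" (is ?thesis1)
    and "(f has_derivative (\<lambda>h. \<Sum>j\<in>UNIV. h $ j * (\<Sum>\<^sub>\<infinity>\<alpha>. a \<alpha> * monomial_partial j \<alpha> z))) (at z)"
      (is ?thesis2)
proof -
  obtain \<delta> where \<delta>: "\<delta> > 0" "enlarged z \<delta> \<in> ball 0 1" using enlarged_in_ball[OF z] by blast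
  define M where "M \<alpha> = cmod (a \<alpha>) * cmod (monomial_eval \<alpha> (enlarged z \<delta>)) / \<delta>" for \<alpha>
  have M: "M summable_on UNIV"
    unfolding M_def[abs_def] divide_inverse
    by (intro summable_on_cmult_left power_series_abs_summable[OF ps] \<delta>)
  have bound: "cmod (a \<alpha> * monomial_partial j \<alpha> w) \<le> M \<alpha>" if "w \<in> ball z \<delta>" for w \<alpha> j
    using mult_left_mono[OF norm_monomial_partial_le[OF \<delta>(1) that], of "cmod (a \<alpha>)"]
    by (simp add: M_def norm_mult)
  have smb: "(\<lambda>\<alpha>. a \<alpha> * monomial_partial j \<alpha> w) summable_on UNIV" if "w \<in> ball z \<delta>" for w j
    by (rule abs_summable_summable, rule summable_on_comparison_test[OF M])
       (use bound[OF that] in auto)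
  then show ?thesis1 using \<delta> by simp
  \<comment> \<open>The M-test and \<open>has_derivative_series\<close> speak of sequences of
    partial sums. Absolute summability makes the order irrelevant, so any enumeration of the
    multi-indices will do.\<close>
  define e :: "nat \<Rightarrow> 'd \<Rightarrow> nat" where "e = from_nat_into UNIV"
  have e: "bij_betw e UNIV UNIV"
    unfolding e_def by (intro bij_betw_from_nat_into infinite_multi_indices) auto
  have Me: "summable (\<lambda>n. M (e n))"
    using summable_on_imp_summable[of "\<lambda>n. M (e n)"] M summable_on_reindex_bij_betw[OF e, of M] by simp
  have sums: "(\<lambda>n. g (e n)) sums infsum g UNIV" if "g summable_on UNIV" for g :: "_ \<Rightarrow> complex"
    using has_sum_imp_sums[of "\<lambda>n. g (e n)"] has_sum_reindex_bij_betw[OF e, of g] has_sum_infsum[OF that] by blast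
  define D where "D j w = (\<Sum>\<^sub>\<infinity>\<alpha>. a \<alpha> * monomial_partial j \<alpha> w)" for j w
  have unif: "\<forall>\<^sub>F n in sequentially. \<forall>w\<in>ball z \<delta>.
      cmod ((\<Sum>i<n. a (e i) * monomial_partial j (e i) w) - D j w) < \<epsilon>" if "\<epsilon> > 0" for \<epsilon> j
  proof -
    have "uniform_limit (ball z \<delta>) (\<lambda>n w. \<Sum>i<n. a (e i) * monomial_partial j (e i) w)
       (\<lambda>w. suminf (\<lambda>i. a (e i) * monomial_partial j (e i) w)) sequentially"
      by (rule Weierstrass_m_test[OF _ Me]) (rule bound)
    then have "\<forall>\<^sub>F n in sequentially. \<forall>w\<in>ball z \<delta>.
      cmod ((\<Sum>i<n. a (e i) * monomial_partial j (e i) w) - suminf (\<lambda>i. a (e i) * monomial_partial j (e i) w)) < \<epsilon>"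
      using that by (simp add: uniform_limit_iff dist_norm)
    then show ?thesis
      by eventually_elim (use sums_unique[OF sums[OF smb]] in \<open>auto simp: D_def\<close>)
  qed
  have "\<exists>g. \<forall>w\<in>ball z \<delta>. (\<lambda>n. a (e n) * monomial_eval (e n) w) sums g w \<and>
     (g has_derivative (\<lambda>h. \<Sum>j\<in>UNIV. h $ j * D j w)) (at w within ball z \<delta>)"
  proof (rule has_derivative_series[where f = "\<lambda>n w. a (e n) * monomial_eval (e n) w" and
        f' = "\<lambda>n w h. a (e n) * (\<Sum>j\<in>UNIV. h $ j * monomial_partial j (e n) w)"])
    show "((\<lambda>w. a (e n) * monomial_eval (e n) w) has_derivative
        (\<lambda>h. a (e n) * (\<Sum>j\<in>UNIV. h $ j * monomial_partial j (e n) w))) (at w within ball z \<delta>)" for n w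
      by (intro has_derivative_mult_right has_derivative_at_withinI[OF monomial_eval_has_derivative])
    show "z \<in> ball z \<delta>" using \<delta> by simp
    show "(\<lambda>n. a (e n) * monomial_eval (e n) z) sums (\<Sum>\<^sub>\<infinity>\<alpha>. a \<alpha> * monomial_eval \<alpha> z)"
      by (rule sums) (use ps z in \<open>auto simp: power_series_on_ball_def intro: has_sum_imp_summable\<close>)
    fix \<epsilon> :: real assume \<epsilon>: "\<epsilon> > 0"
    have "\<forall>\<^sub>F n in sequentially. \<forall>j\<in>(UNIV::'d set). \<forall>w\<in>ball z \<delta>.
      cmod ((\<Sum>i<n. a (e i) * monomial_partial j (e i) w) - D j w) < \<epsilon> / CARD('d)"
      by (intro eventually_ball_finite ballI unif) (use \<epsilon> in auto)
    then show "\<forall>\<^sub>F n in sequentially. \<forall>w\<in>ball z \<delta>. \<forall>h. norm ((\<Sum>i<n. a (e i) * (\<Sum>j\<in>UNIV. h $ j * monomial_partial j (e i) w)) -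
         (\<Sum>j\<in>UNIV. h $ j * D j w)) \<le> \<epsilon> * norm h"
    proof eventually_elim
      case (elim n)
      show ?case
      proof (intro ballI allI)
        fix w and h :: "complex ^ 'd" assume w: "w \<in> ball z \<delta>"
        have "(\<Sum>i<n. a (e i) * (\<Sum>j\<in>UNIV. h $ j * monomial_partial j (e i) w)) - (\<Sum>j\<in>UNIV. h $ j * D j w)
          = (\<Sum>j\<in>UNIV. h $ j * ((\<Sum>i<n. a (e i) * monomial_partial j (e i) w) - D j w))"
          unfolding sum_distrib_left right_diff_distrib sum_subtractf
          by (subst sum.swap) (simp add: mult_ac)
        also have "norm \<dots> \<le> (\<Sum>j\<in>(UNIV::'d set). norm h * (\<epsilon> / CARD('d)))"
        proof (rule sum_norm_le)
          fix j :: 'd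
          show "norm (h $ j * ((\<Sum>i<n. a (e i) * monomial_partial j (e i) w) - D j w)) \<le> norm h * (\<epsilon> / CARD('d))"
            unfolding norm_mult using elim w
            by (intro mult_mono Finite_Cartesian_Product.norm_nth_le) (auto intro: less_imp_le)
        qed
        also have "\<dots> = \<epsilon> * norm h" by simp
        finally show "norm ((\<Sum>i<n. a (e i) * (\<Sum>j\<in>UNIV. h $ j * monomial_partial j (e i) w)) -
         (\<Sum>j\<in>UNIV. h $ j * D j w)) \<le> \<epsilon> * norm h" .
      qed
    qed
  qed auto
  then obtain g where g: "\<And>w. w \<in> ball z \<delta> \<Longrightarrow> (\<lambda>n. a (e n) * monomial_eval (e n) w) sums g w"
    "\<And>w. w \<in> ball z \<delta> \<Longrightarrow> (g has_derivative (\<lambda>h. \<Sum>j\<in>UNIV. h $ j * D j w)) (at w within ball z \<delta>)" by blast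
  have fg: "f w = g w" if "w \<in> ball z \<delta>" for w
  proof -
    have "((\<lambda>\<alpha>. a \<alpha> * monomial_eval \<alpha> w) has_sum f w) UNIV"
      using ps enlarged_ball_subset[OF \<delta>] that by (auto simp: power_series_on_ball_def)
    then have "(\<lambda>n. a (e n) * monomial_eval (e n) w) sums f w"
      using sums[OF has_sum_imp_summable] by (simp add: infsumI)
    then show ?thesis using g(1)[OF that] sums_unique2 by blast
  qed
  have "(g has_derivative (\<lambda>h. \<Sum>j\<in>UNIV. h $ j * D j z)) (at z)"
    using g(2)[of z] \<delta> by (simp add: at_within_open[of z "ball z \<delta>"])
  then show ?thesis2
    unfolding D_def[symmetric]
    by (rule has_derivative_transform_within_open[of _ _ _ _ "ball z \<delta>"]) (use \<delta> fg in auto)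
qed

lemma axis_conv_scale: "axis j c = c *s axis j (1::complex)"
  by (simp add: vec_eq_iff axis_def)

lemma axis_has_derivative:
  fixes z :: "complex ^ 'd::finite"
  shows "((\<lambda>t. z + axis j t) has_derivative (\<lambda>t. axis j t)) (at (t::complex))"
proof -
  have "linear (\<lambda>t::complex. axis j t :: complex^'d)"
    by (intro linearI) (auto simp: vec_eq_iff axis_def)
  then show ?thesis
    by (auto intro!: derivative_eq_intros bounded_linear_imp_has_derivative simp: linear_conv_bounded_linear)
qed

lemma has_derivative_imp_partial_deriv:
  fixes z :: "complex ^ 'd::finite"
  assumes "(f has_derivative L) (at z)" "\<And>c v. L (c *s v) = c * L v"
  shows "((\<lambda>t. f (z + axis j t)) has_field_derivative L (axis j 1)) (at 0)"
    and "partial_deriv j f z = L (axis j 1)"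
proof -
  have 0: "z + axis j (0::complex) = z" by (simp add: vec_eq_iff axis_def)
  have "((\<lambda>t. f (z + axis j t)) has_derivative (\<lambda>t. L (axis j t))) (at 0)"
    using has_derivative_compose[OF axis_has_derivative[of z j 0], of f L] assms(1) by (simp add: 0)
  moreover have "(\<lambda>t. L (axis j t)) = (*) (L (axis j 1))"
    by (subst axis_conv_scale) (auto simp: assms(2))
  ultimately show *: "((\<lambda>t. f (z + axis j t)) has_field_derivative L (axis j 1)) (at 0)"
    by (simp add: has_field_derivative_def)
  then show "partial_deriv j f z = L (axis j 1)"
    unfolding partial_deriv_def by (rule DERIV_imp_deriv)
qed

lemma holomorphic_on_ball_DERIV:
  assumes "holomorphic_on_ball f" "z \<in> ball 0 1"
  shows "((\<lambda>t. f (z + axis j t)) has_field_derivative partial_deriv j f z) (at 0)"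
proof -
  obtain L where "(f has_derivative L) (at z)" "\<And>c v. L (c *s v) = c * L v"
    using assms unfolding holomorphic_on_ball_def by blast
  from has_derivative_imp_partial_deriv[OF this, of j] show ?thesis by simp
qed

lemma holomorphic_on_ball_continuous_on:
  "holomorphic_on_ball f \<Longrightarrow> continuous_on (ball 0 1) f"
  unfolding holomorphic_on_ball_def
  by (meson continuous_at_imp_continuous_on has_derivative_continuous)

lemma power_series_holomorphic:
  assumes "power_series_on_ball f a"
  shows "holomorphic_on_ball f"
  unfolding holomorphic_on_ball_def
proof (intro ballI exI conjI allI)
  fix z :: "complex ^ 'a" assume z: "z \<in> ball 0 1"
  show "(f has_derivative (\<lambda>h. \<Sum>j\<in>UNIV. h $ j * (\<Sum>\<^sub>\<infinity>\<alpha>. a \<alpha> * monomial_partial j \<alpha> z))) (at z)"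
    by (rule power_series_has_derivative(2)[OF assms z])
qed (simp add: sum_distrib_left mult.assoc)

lemma power_series_partial_deriv:
  assumes "power_series_on_ball f a" "z \<in> ball 0 1"
  shows "((\<lambda>\<alpha>. a \<alpha> * monomial_partial j \<alpha> z) has_sum partial_deriv j f z) UNIV"
proof -
  have "partial_deriv j f z = (\<Sum>i\<in>UNIV. axis j 1 $ i * (\<Sum>\<^sub>\<infinity>\<alpha>. a \<alpha> * monomial_partial i \<alpha> z))"
    by (rule has_derivative_imp_partial_deriv(2)[OF power_series_has_derivative(2)[OF assms]])
       (simp add: sum_distrib_left mult.assoc)
  also have "\<dots> = (\<Sum>\<^sub>\<infinity>\<alpha>. a \<alpha> * monomial_partial j \<alpha> z)"
    by (simp add: axis_def if_distrib[where f="\<lambda>x. x * _"] cong: if_cong)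
  finally show ?thesis
    using has_sum_infsum[OF power_series_has_derivative(1)[OF assms]] by simp
qed

section \<open>Shifting a multi-index in one coordinate\<close>

lemma bump_image: "range (\<lambda>\<beta>::'d \<Rightarrow> nat. \<beta>(j := Suc (\<beta> j))) = {\<alpha>. \<alpha> j \<noteq> 0}"
proof (intro set_eqI iffI)
  fix \<alpha> :: "'d \<Rightarrow> nat" assume "\<alpha> \<in> {\<alpha>. \<alpha> j \<noteq> 0}"
  then have "\<alpha> = (\<lambda>\<beta>. \<beta>(j := Suc (\<beta> j))) (\<alpha>(j := \<alpha> j - 1))" by auto
  then show "\<alpha> \<in> range (\<lambda>\<beta>. \<beta>(j := Suc (\<beta> j)))" by blast
qed auto

lemma inj_bump: "inj (\<lambda>\<beta>::'d \<Rightarrow> nat. \<beta>(j := Suc (\<beta> j)))"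
proof (rule injI, rule ext)
  fix \<alpha> \<beta> :: "'d \<Rightarrow> nat" and k
  assume "\<alpha>(j := Suc (\<alpha> j)) = \<beta>(j := Suc (\<beta> j))"
  from fun_cong[OF this, of k] show "\<alpha> k = \<beta> k" by (auto split: if_splits)
qed

text \<open>The shift is injective with range the multi-indices that are nonzero at
  \<open>j\<close>, and outside this range \<open>g\<close> contributes nothing. This one reindexing
  serves differentiation, multiplication by a coordinate and the Hardy norm of a product.\<close>

lemma has_sum_bump:
  fixes g :: "('d \<Rightarrow> nat) \<Rightarrow> 'b::{comm_monoid_add, topological_space}"
  assumes "\<And>\<alpha>. \<alpha> j = 0 \<Longrightarrow> g \<alpha> = 0"
  shows "(g has_sum s) UNIV \<longleftrightarrow> ((\<lambda>\<beta>. g (\<beta>(j := Suc (\<beta> j)))) has_sum s) UNIV"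
proof -
  have "(g has_sum s) UNIV \<longleftrightarrow> (g has_sum s) (range (\<lambda>\<beta>. \<beta>(j := Suc (\<beta> j))))"
    by (rule has_sum_cong_neutral) (auto simp: bump_image assms)
  also have "\<dots> \<longleftrightarrow> ((g \<circ> (\<lambda>\<beta>. \<beta>(j := Suc (\<beta> j)))) has_sum s) UNIV"
    by (rule has_sum_reindex[OF inj_bump])
  finally show ?thesis by (simp add: o_def)
qed

text \<open>Since a partial derivative is again a power series on the ball, it is itself holomorphic
  and continuous there, which is how the second derivatives in Green's formula are obtained.\<close>

lemma power_series_partial_deriv_series:
  assumes "power_series_on_ball f a"
  shows "power_series_on_ball (partial_deriv j f)
    (\<lambda>\<beta>. of_nat (Suc (\<beta> j)) * a (\<beta>(j := Suc (\<beta> j))))"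
  unfolding power_series_on_ball_def
proof
  fix z :: "complex ^ 'a" assume z: "z \<in> ball 0 1"
  have "((\<lambda>\<beta>. a (\<beta>(j := Suc (\<beta> j))) * monomial_partial j (\<beta>(j := Suc (\<beta> j))) z) has_sum partial_deriv j f z) UNIV"
    using power_series_partial_deriv[OF assms z, of j]
    by (subst (asm) has_sum_bump[of j]) (auto simp: monomial_partial_def)
  then show "((\<lambda>\<beta>. of_nat (Suc (\<beta> j)) * a (\<beta>(j := Suc (\<beta> j))) * monomial_eval \<beta> z) has_sum partial_deriv j f z) UNIV"
    by (simp add: monomial_partial_def mult_ac del: of_nat_Suc)
qed

section \<open>Uniqueness of the coefficients and operations on power series\<close>

lemma monomial_eval_0: "monomial_eval \<alpha> 0 = (if \<alpha> = (\<lambda>_. 0) then 1 else 0)"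
proof (cases "\<alpha> = (\<lambda>_. 0)")
  case False
  then obtain j where "\<alpha> j \<noteq> 0" by auto
  then show ?thesis using False by (simp add: monomial_eval_remove[of \<alpha> 0 j] power_0_left)
qed (simp add: monomial_eval_def)

text \<open>The coefficient of order \<open>n + 1\<close> is read off, up to a nonzero factor, from a coefficient of order
  \<open>n\<close> of a partial derivative.\<close>
lemma power_series_zero_coeffs:
  assumes "power_series_on_ball f a" "\<And>z. z \<in> ball 0 1 \<Longrightarrow> f z = 0"
  shows "a \<alpha> = 0"
  using assms
proof (induction "\<Sum>j\<in>UNIV. \<alpha> j" arbitrary: f a \<alpha>)
  case 0
  have \<alpha>: "\<alpha> = (\<lambda>_. 0)" using 0(1) by auto
  have "((\<lambda>\<alpha>. a \<alpha> * monomial_eval \<alpha> 0) has_sum f 0) UNIV"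
    using 0(2) by (auto simp: power_series_on_ball_def)
  then have "((\<lambda>\<alpha>. a \<alpha> * monomial_eval \<alpha> 0) has_sum f 0) {\<lambda>_. 0}"
    by (rule has_sum_cong_neutral[THEN iffD1, rotated -1]) (auto simp: monomial_eval_0)
  then have "f 0 = a (\<lambda>_. 0)"
    using has_sum_finite[of "{\<lambda>_. 0}" "\<lambda>\<alpha>. a \<alpha> * monomial_eval \<alpha> 0"] has_sum_unique
    by (fastforce simp: monomial_eval_0)
  then show ?case using 0(3)[of 0] \<alpha> by simp
next
  case (Suc n)
  obtain j where j: "\<alpha> j \<noteq> 0"
  proof (rule ccontr)
    assume "\<not> thesis"
    then have "\<And>j. \<alpha> j = 0" using that by blast
    then show False using Suc(2) by simp
  qed
  define \<beta> where "\<beta> = \<alpha>(j := \<alpha> j - 1)"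
  have \<alpha>: "\<alpha> = \<beta>(j := Suc (\<beta> j))" using j by (auto simp: \<beta>_def)
  have "(\<Sum>i\<in>UNIV. \<alpha> i) = Suc (\<Sum>i\<in>UNIV. \<beta> i)"
    unfolding \<alpha> by (subst (1 2) sum.remove[of UNIV j]) (auto intro!: sum.cong)
  then have n: "n = (\<Sum>i\<in>UNIV. \<beta> i)" using Suc(2) by simp
  have "of_nat (Suc (\<beta> j)) * a (\<beta>(j := Suc (\<beta> j))) = 0"
  proof (rule Suc(1)[OF n power_series_partial_deriv_series[OF Suc(3)]])
    fix z :: "complex ^ 'a" assume z: "z \<in> ball 0 1"
    have "(f has_derivative (\<lambda>_. 0)) (at z)"
      by (rule has_derivative_transform_within_open[of "\<lambda>_. 0" _ _ _ "ball 0 1"]) (use z Suc(4) in auto)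
    from has_derivative_imp_partial_deriv(2)[OF this] show "partial_deriv j f z = 0" by simp
  qed
  then show ?case by (simp add: \<alpha>[symmetric] del: of_nat_Suc)
qed

lemma power_series_add:
  "power_series_on_ball f a \<Longrightarrow> power_series_on_ball g b \<Longrightarrow>
    power_series_on_ball (\<lambda>z. f z + g z) (\<lambda>\<alpha>. a \<alpha> + b \<alpha>)"
  by (auto simp: power_series_on_ball_def distrib_right intro: has_sum_add)

lemma power_series_cmult:
  "power_series_on_ball f a \<Longrightarrow> power_series_on_ball (\<lambda>z. c * f z) (\<lambda>\<alpha>. c * a \<alpha>)"
  by (auto simp: power_series_on_ball_def mult.assoc intro: has_sum_cmult_right)

lemma power_series_diff:
  "power_series_on_ball f a \<Longrightarrow> power_series_on_ball g b \<Longrightarrow>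
    power_series_on_ball (\<lambda>z. f z - g z) (\<lambda>\<alpha>. a \<alpha> - b \<alpha>)"
  using power_series_add[of f a "\<lambda>z. -1 * g z" "\<lambda>\<alpha>. -1 * b \<alpha>"] power_series_cmult[of g b "-1"] by simp

text \<open>\<open>power_coeff\<close> is a definite description; two expansions of \<open>f\<close>
  differ by an expansion of the zero function.\<close>

lemma power_coeff_eq:
  assumes "power_series_on_ball f a"
  shows "power_coeff f = a"
  unfolding power_coeff_def
proof (rule the_equality)
  show "power_series_on_ball f a" by fact
  fix b assume "power_series_on_ball f b"
  from power_series_diff[OF this assms] have "b \<alpha> - a \<alpha> = 0" for \<alpha>
    by (rule power_series_zero_coeffs) simp
  then show "b = a" by auto
qed

lemma power_series_coord_mult:
  assumes "power_series_on_ball f a"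
  shows "power_series_on_ball (coord_mult j f) (\<lambda>\<alpha>. if \<alpha> j = 0 then 0 else a (\<alpha>(j := \<alpha> j - 1)))"
  unfolding power_series_on_ball_def
proof
  fix z :: "complex ^ 'a" assume "z \<in> ball 0 1"
  then have "((\<lambda>\<alpha>. z $ j * (a \<alpha> * monomial_eval \<alpha> z)) has_sum z $ j * f z) UNIV"
    using assms by (auto simp: power_series_on_ball_def intro: has_sum_cmult_right)
  then show "((\<lambda>\<alpha>. (if \<alpha> j = 0 then 0 else a (\<alpha>(j := \<alpha> j - 1))) * monomial_eval \<alpha> z) has_sum coord_mult j f z) UNIV"
    by (subst has_sum_bump[of j]) (auto simp: monomial_eval_Suc coord_mult_def mult_ac)
qed

section \<open>Weights of neighbouring monomials\<close>

lemma hardy_weight_pos: "0 < hardy_weight \<alpha>"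
  by (auto simp: hardy_weight_def intro!: divide_pos_pos mult_pos_pos prod_pos)

lemma sum_bump: "(\<Sum>i\<in>UNIV. (\<alpha>(j := Suc (\<alpha> j))) i) = Suc (\<Sum>i\<in>(UNIV::'d::finite set). \<alpha> i)"
  by (subst (1 2) sum.remove[of UNIV j]) (auto intro!: sum.cong)

lemma hardy_weight_bump:
  fixes \<alpha> :: "'d::finite \<Rightarrow> nat"
  shows "hardy_weight (\<alpha>(j := Suc (\<alpha> j))) * (real (\<Sum>i\<in>UNIV. \<alpha> i) + CARD('d)) = hardy_weight \<alpha> * (real (\<alpha> j) + 1)"
proof -
  have "(\<Prod>i\<in>UNIV. fact ((\<alpha>(j := Suc (\<alpha> j))) i)) = (real (\<alpha> j) + 1) * (\<Prod>i\<in>UNIV. fact (\<alpha> i) :: real)"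
    by (subst (1 2) prod.remove[of UNIV j]) (auto intro!: prod.cong)
  moreover have "fact (Suc (\<Sum>i\<in>UNIV. \<alpha> i) + CARD('d) - 1) =
      (real (\<Sum>i\<in>UNIV. \<alpha> i) + CARD('d)) * fact ((\<Sum>i\<in>UNIV. \<alpha> i) + CARD('d) - 1)"
    using fact_Suc[of "(\<Sum>i\<in>UNIV. \<alpha> i) + CARD('d) - 1", where 'a=real] by (simp del: of_nat_sum fact_Suc)
  moreover have "real (\<Sum>i\<in>UNIV. \<alpha> i) + CARD('d) \<noteq> 0"
    by (simp add: add_nonneg_pos[THEN less_imp_neq, symmetric] del: of_nat_sum)
  ultimately show ?thesis
    unfolding hardy_weight_def sum_bump by (simp del: fun_upd_apply of_nat_sum)
qed

text \<open>Raising \<alpha> in direction j multiplies the weight by (\<alpha> j + 1) / (|\<alpha>|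
  + d), and the numerators add up to the common denominator.\<close>

lemma sum_hardy_weight_bump: "(\<Sum>j\<in>UNIV. hardy_weight (\<alpha>(j := Suc (\<alpha> j)))) = hardy_weight (\<alpha> :: 'd::finite \<Rightarrow> nat)"
proof -
  have "(\<Sum>j\<in>UNIV. hardy_weight (\<alpha>(j := Suc (\<alpha> j)))) * (real (\<Sum>i\<in>UNIV. \<alpha> i) + CARD('d)) = 
     hardy_weight \<alpha> * (real (\<Sum>i\<in>UNIV. \<alpha> i) + CARD('d))"
    unfolding sum_distrib_right hardy_weight_bump sum_distrib_left[symmetric] by (simp add: sum.distrib)
  moreover have "real (\<Sum>i\<in>UNIV. \<alpha> i) + CARD('d) > 0"
    by (simp add: add_nonneg_pos del: of_nat_sum)
  ultimately show ?thesis by simp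
qed

section \<open>The Hardy space\<close>

definition degree_set :: "nat \<Rightarrow> ('d::finite \<Rightarrow> nat) set" where
  "degree_set n = {\<alpha>. (\<Sum>j\<in>UNIV. \<alpha> j) = n}"

lemma finite_degree_set: "finite (degree_set n :: ('d::finite \<Rightarrow> nat) set)"
proof (rule finite_subset)
  show "degree_set n \<subseteq> PiE UNIV (\<lambda>_::'d. {..n})"
    by (auto simp: degree_set_def intro: member_le_sum)
qed (intro finite_PiE; simp)

text \<open>The monomials are orthogonal with squared norms \<open>hardy_weight \<alpha>\<close>, so
  these are the terms of the reproducing kernel of the Hardy space on the diagonal.\<close>

definition kernel_term :: "complex ^ 'd::finite \<Rightarrow> ('d \<Rightarrow> nat) \<Rightarrow> real" where
  "kernel_term z \<alpha> = (cmod (monomial_eval \<alpha> z))\<^sup>2 / hardy_weight \<alpha>"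

lemma kernel_term_nonneg: "0 \<le> kernel_term z \<alpha>"
  by (simp add: kernel_term_def hardy_weight_nonneg)

lemma norm_sq_vec: "(norm (z :: complex ^ 'd::finite))\<^sup>2 = (\<Sum>j\<in>UNIV. (cmod (z $ j))\<^sup>2)"
  by (simp add: norm_vec_def L2_set_def sum_nonneg)

lemma kernel_term_bump:
  fixes \<alpha> :: "'d::finite \<Rightarrow> nat"
  shows "(cmod (z $ j))\<^sup>2 * kernel_term z \<alpha> * (real (\<Sum>i\<in>UNIV. \<alpha> i) + CARD('d)) =
    (real (\<alpha> j) + 1) * kernel_term z (\<alpha>(j := Suc (\<alpha> j)))"
proof -
  have "hardy_weight (\<alpha>(j := Suc (\<alpha> j))) * (real (\<Sum>i\<in>UNIV. \<alpha> i) + CARD('d)) = hardy_weight \<alpha> * (real (\<alpha> j) + 1)"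
    by (rule hardy_weight_bump)
  with hardy_weight_pos[of \<alpha>] hardy_weight_pos[of "\<alpha>(j := Suc (\<alpha> j))"] show ?thesis
    by (simp add: kernel_term_def monomial_eval_Suc norm_mult power_mult_distrib divide_simps
        del: of_nat_sum fun_upd_apply) (simp add: mult.commute del: of_nat_sum fun_upd_apply)
qed

text \<open>On degree \<open>Suc n\<close> the factor \<open>Suc n\<close> is the sum of the entries
  of \<alpha>. For fixed \<open>j\<close> only the \<alpha> with
  \<open>\<alpha> j \<noteq> 0\<close> survive, these are the shifts of multi-indices of degree
  \<open>n\<close>, and \<open>kernel_term_bump\<close> compares the terms. Summing over
  \<open>j\<close> produces the squared norm of \<open>z\<close>.\<close>

lemma sum_kernel_term_degree_Suc:
  fixes z :: "complex ^ 'd::finite"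
  shows "(\<Sum>\<alpha>\<in>degree_set (Suc n). kernel_term z \<alpha>) * real (Suc n) =
    (norm z)\<^sup>2 * (real n + CARD('d)) * (\<Sum>\<alpha>\<in>degree_set n. kernel_term z \<alpha>)"
proof -
  have "(\<Sum>\<alpha>\<in>degree_set (Suc n). kernel_term z \<alpha>) * real (Suc n) =
      (\<Sum>\<alpha>\<in>degree_set (Suc n). kernel_term z \<alpha> * real (\<Sum>j\<in>UNIV. \<alpha> j))"
    unfolding sum_distrib_right by (intro sum.cong) (auto simp: degree_set_def)
  also have "\<dots> = (\<Sum>j\<in>UNIV. \<Sum>\<alpha>\<in>degree_set (Suc n). kernel_term z \<alpha> * real (\<alpha> j))"
    by (subst sum.swap) (simp add: sum_distrib_left)
  also have "\<dots> = (\<Sum>j\<in>(UNIV::'d set). \<Sum>\<beta>\<in>degree_set n. (cmod (z $ j))\<^sup>2 * kernel_term z \<beta> * (real n + CARD('d)))"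
  proof (rule sum.cong[OF refl])
    fix j :: 'd
    have "(\<Sum>\<alpha>\<in>degree_set (Suc n). kernel_term z \<alpha> * real (\<alpha> j)) =
        (\<Sum>\<alpha>\<in>(\<lambda>\<beta>. \<beta>(j := Suc (\<beta> j))) ` degree_set n. kernel_term z \<alpha> * real (\<alpha> j))"
    proof (rule sum.mono_neutral_right[OF finite_degree_set])
      show "(\<lambda>\<beta>. \<beta>(j := Suc (\<beta> j))) ` degree_set n \<subseteq> degree_set (Suc n)"
        by (auto simp: degree_set_def sum_bump simp del: fun_upd_apply)
      have "\<alpha> \<in> (\<lambda>\<beta>. \<beta>(j := Suc (\<beta> j))) ` degree_set n" if "\<alpha> \<in> degree_set (Suc n)" "\<alpha> j \<noteq> 0" for \<alpha>
      proof -
        have "\<alpha> \<in> range (\<lambda>\<beta>. \<beta>(j := Suc (\<beta> j)))" unfolding bump_image using that(2) by simp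
        then obtain \<beta> where \<beta>: "\<alpha> = \<beta>(j := Suc (\<beta> j))" by (rule rangeE)
        have "\<beta>(j := Suc (\<beta> j)) \<in> degree_set (Suc n)" using that(1) unfolding \<beta>[symmetric] .
        then have "\<beta> \<in> degree_set n"
          by (simp add: degree_set_def sum_bump del: fun_upd_apply)
        then show ?thesis using \<beta> by blast
      qed
      then show "\<forall>\<alpha>\<in>degree_set (Suc n) - (\<lambda>\<beta>. \<beta>(j := Suc (\<beta> j))) ` degree_set n. kernel_term z \<alpha> * real (\<alpha> j) = 0"
        by auto
    qed
    also have "\<dots> = (\<Sum>\<beta>\<in>degree_set n. kernel_term z (\<beta>(j := Suc (\<beta> j))) * (real (\<beta> j) + 1))"
      by (subst sum.reindex) (auto intro: inj_on_subset[OF inj_bump] simp: add.commute)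
    also have "\<dots> = (\<Sum>\<beta>\<in>degree_set n. (cmod (z $ j))\<^sup>2 * kernel_term z \<beta> * (real n + CARD('d)))"
      by (intro sum.cong refl) (auto simp: mult.commute[of "kernel_term _ _"] degree_set_def
          simp flip: kernel_term_bump simp del: of_nat_sum)
    finally show "(\<Sum>\<alpha>\<in>degree_set (Suc n). kernel_term z \<alpha> * real (\<alpha> j)) = \<dots>" .
  qed
  also have "\<dots> = (norm z)\<^sup>2 * (real n + CARD('d)) * (\<Sum>\<alpha>\<in>degree_set n. kernel_term z \<alpha>)"
    by (simp add: norm_sq_vec sum_distrib_left sum_distrib_right mult_ac)
  finally show ?thesis .
qed

text \<open>The binomial coefficient (n + d - 1 choose n), that is, the n-th Taylor coefficient of
  (1 - x)^(-d). The recursion is the one that \<open>sum_kernel_term_degree_Suc\<close>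
  delivers.\<close>

fun kernel_coeff :: "nat \<Rightarrow> nat \<Rightarrow> real" where
  "kernel_coeff d 0 = 1"
| "kernel_coeff d (Suc n) = kernel_coeff d n * (real n + real d) / real (Suc n)"

lemma kernel_coeff_nonneg: "0 \<le> kernel_coeff d n"
  by (induction n) auto

lemma sum_kernel_term_degree:
  "(\<Sum>\<alpha>\<in>degree_set n. kernel_term (z :: complex ^ 'd::finite) \<alpha>) = kernel_coeff CARD('d) n * (norm z)\<^sup>2 ^ n"
proof (induction n)
  case 0
  have "(degree_set 0 :: ('d \<Rightarrow> nat) set) = {\<lambda>_. 0}" by (auto simp: degree_set_def fun_eq_iff)
  then show ?case by (simp add: kernel_term_def monomial_eval_def hardy_weight_def)
next
  case (Suc n)
  have "(\<Sum>\<alpha>\<in>degree_set (Suc n). kernel_term z \<alpha>) =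
    (norm z)\<^sup>2 * (real n + CARD('d)) * (\<Sum>\<alpha>\<in>degree_set n. kernel_term z \<alpha>) / real (Suc n)"
    using sum_kernel_term_degree_Suc[where z=z and n=n] by (simp add: divide_simps del: of_nat_Suc)
  then show ?case by (simp add: Suc mult_ac del: of_nat_Suc)
qed

lemma summable_kernel_coeff:
  assumes "0 \<le> \<rho>" "\<rho> < 1"
  shows "summable (\<lambda>n. kernel_coeff d n * \<rho> ^ n)"
proof -
  \<comment> \<open>The ratios of consecutive terms tend to \<rho>, so the midpoint between \<rho>
    and 1 bounds them eventually; \<open>N\<close> is found by solving
    \<open>\<rho> * (n + d) \<le> c * n\<close> for \<open>n\<close>.\<close>
  define c where "c = (1 + \<rho>) / 2"
  obtain N :: nat where N: "real d * \<rho> / (c - \<rho>) \<le> real N" using real_arch_simple by blast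
  have c: "c < 1" "\<rho> < c" using assms by (auto simp: c_def)
  show ?thesis
  proof (rule summable_ratio_test[OF c(1), of N])
    fix n assume "n \<ge> N"
    then have "real d * \<rho> / (c - \<rho>) \<le> real n" using N by linarith
    then have "real d * \<rho> \<le> real n * (c - \<rho>)" using c by (simp add: divide_simps)
    then have "\<rho> * (real n + real d) \<le> c * real n" by (simp add: algebra_simps)
    also have "\<dots> \<le> c * real (Suc n)" using c assms by (intro mult_left_mono) auto
    finally have "\<rho> * (real n + real d) / real (Suc n) \<le> c" by (simp add: divide_simps del: of_nat_Suc)
    then have "(kernel_coeff d n * \<rho> ^ n) * (\<rho> * (real n + real d) / real (Suc n)) \<le> (kernel_coeff d n * \<rho> ^ n) * c"
      using assms kernel_coeff_nonneg by (intro mult_left_mono) auto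
    then show "norm (kernel_coeff d (Suc n) * \<rho> ^ Suc n) \<le> c * norm (kernel_coeff d n * \<rho> ^ n)"
      using assms kernel_coeff_nonneg[of d n] by (simp add: abs_mult mult_ac del: of_nat_Suc)
  qed
qed

text \<open>\<open>C\<close> is the value of the kernel at squared radius \<rho>: grouped by degree,
  the terms depend on \<open>z\<close> only through its norm and grow with it.\<close>

lemma kernel_bound:
  assumes "0 \<le> \<rho>" "\<rho> < 1"
  obtains C where "C \<ge> 0" "\<And>z F. (norm (z :: complex ^ 'd::finite))\<^sup>2 \<le> \<rho> \<Longrightarrow> finite F \<Longrightarrow> (\<Sum>\<alpha>\<in>F. kernel_term z \<alpha>) \<le> C"
proof
  define C where "C = (\<Sum>n. kernel_coeff CARD('d) n * \<rho> ^ n)"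
  have nn: "0 \<le> kernel_coeff CARD('d) n * \<rho> ^ n" for n using assms kernel_coeff_nonneg by simp
  show "C \<ge> 0" unfolding C_def by (intro suminf_nonneg summable_kernel_coeff assms nn)
  fix z :: "complex ^ 'd" and F :: "('d \<Rightarrow> nat) set" assume z: "(norm z)\<^sup>2 \<le> \<rho>" and F: "finite F"
  \<comment> \<open>\<open>N\<close> exceeds every degree occurring in \<open>F\<close>, so the
    degrees below \<open>N\<close> cover \<open>F\<close>.\<close>
  define N where "N = Suc (\<Sum>\<alpha>\<in>F. \<Sum>j\<in>UNIV. \<alpha> j)"
  have sub: "F \<subseteq> (\<Union>n<N. degree_set n)"
    using F member_le_sum[OF _ _ F, of _ "\<lambda>\<alpha>. \<Sum>j\<in>UNIV. \<alpha> j"] by (auto simp: degree_set_def N_def less_Suc_eq_le)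
  have "(\<Sum>\<alpha>\<in>F. kernel_term z \<alpha>) \<le> (\<Sum>\<alpha>\<in>(\<Union>n<N. degree_set n). kernel_term z \<alpha>)"
    using sub by (intro sum_mono2) (auto simp: finite_degree_set kernel_term_nonneg)
  also have "\<dots> = (\<Sum>n<N. \<Sum>\<alpha>\<in>degree_set n. kernel_term z \<alpha>)"
    proof (rule sum.UNION_disjoint)
    show "\<forall>i\<in>{..<N}. \<forall>j\<in>{..<N}. i \<noteq> j \<longrightarrow> degree_set i \<inter> degree_set j = {}"
      by (auto simp: degree_set_def)
  qed (auto simp: finite_degree_set)
  also have "\<dots> \<le> (\<Sum>n<N. kernel_coeff CARD('d) n * \<rho> ^ n)"
    unfolding sum_kernel_term_degree using z
    by (intro sum_mono mult_left_mono power_mono kernel_coeff_nonneg) auto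
  also have "\<dots> \<le> C"
    unfolding C_def by (intro sum_le_suminf summable_kernel_coeff assms) (auto simp: nn[simplified])
  finally show "(\<Sum>\<alpha>\<in>F. kernel_term z \<alpha>) \<le> C" .
qed

text \<open>The statement that the squared Hardy norm is at most \<open>B\<close>, put in terms of
  coefficients and finite sums. It makes sense for a family that is not yet known to belong to a
  function, and passes easily to limits.\<close>

definition coeff_bounded :: "real \<Rightarrow> (('d::finite \<Rightarrow> nat) \<Rightarrow> complex) \<Rightarrow> bool" where
  "coeff_bounded B a \<longleftrightarrow> (\<forall>F. finite F \<longrightarrow> (\<Sum>\<alpha>\<in>F. (cmod (a \<alpha>))\<^sup>2 * hardy_weight \<alpha>) \<le> B)"

lemma coeff_bounded_nonneg: "coeff_bounded B a \<Longrightarrow> 0 \<le> B"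
  unfolding coeff_bounded_def by (drule spec[of _ "{}"]) simp

text \<open>The reproducing kernel estimate: Cauchy-Schwarz after moving the square root of the
  weight from one factor to the other.\<close>

lemma coeff_bounded_summable:
  fixes a :: "('d::finite \<Rightarrow> nat) \<Rightarrow> complex"
  assumes a: "coeff_bounded B a"
    and C: "\<And>F. finite F \<Longrightarrow> (\<Sum>\<alpha>\<in>F. kernel_term z \<alpha>) \<le> C"
  shows "(\<lambda>\<alpha>. cmod (a \<alpha>) * cmod (monomial_eval \<alpha> z)) summable_on UNIV"
    and "(\<Sum>\<^sub>\<infinity>\<alpha>. cmod (a \<alpha>) * cmod (monomial_eval \<alpha> z)) \<le> sqrt (B * C)"
proof -
  have *: "(\<Sum>\<alpha>\<in>F. cmod (a \<alpha>) * cmod (monomial_eval \<alpha> z)) \<le> sqrt (B * C)" if F: "finite F" for F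
  proof (rule real_le_rsqrt)
    have "(\<Sum>\<alpha>\<in>F. cmod (a \<alpha>) * cmod (monomial_eval \<alpha> z))\<^sup>2 =
      (\<Sum>\<alpha>\<in>F. (cmod (a \<alpha>) * sqrt (hardy_weight \<alpha>)) * (cmod (monomial_eval \<alpha> z) / sqrt (hardy_weight \<alpha>)))\<^sup>2"
    proof -
      have "hardy_weight \<alpha> \<noteq> 0" for \<alpha> :: "'d \<Rightarrow> nat" using hardy_weight_pos[of \<alpha>] by simp
      then show ?thesis by simp
    qed
    also have "\<dots> \<le> (\<Sum>\<alpha>\<in>F. (cmod (a \<alpha>) * sqrt (hardy_weight \<alpha>))\<^sup>2) *
        (\<Sum>\<alpha>\<in>F. (cmod (monomial_eval \<alpha> z) / sqrt (hardy_weight \<alpha>))\<^sup>2)"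
      by (rule Cauchy_Schwarz_ineq_sum)
    also have "\<dots> = (\<Sum>\<alpha>\<in>F. (cmod (a \<alpha>))\<^sup>2 * hardy_weight \<alpha>) * (\<Sum>\<alpha>\<in>F. kernel_term z \<alpha>)"
      by (simp add: power_mult_distrib power_divide kernel_term_def hardy_weight_nonneg)
    also have "\<dots> \<le> B * C"
      using a C[OF F] F coeff_bounded_nonneg[OF a]
      by (intro mult_mono) (auto simp: coeff_bounded_def intro!: sum_nonneg kernel_term_nonneg)
    finally show "(\<Sum>\<alpha>\<in>F. cmod (a \<alpha>) * cmod (monomial_eval \<alpha> z))\<^sup>2 \<le> B * C" .
  qed
  show s: "(\<lambda>\<alpha>. cmod (a \<alpha>) * cmod (monomial_eval \<alpha> z)) summable_on UNIV"
    by (rule nonneg_bdd_above_summable_on) (auto intro!: bdd_aboveI2[where M="sqrt (B * C)"] *)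
  show "(\<Sum>\<^sub>\<infinity>\<alpha>. cmod (a \<alpha>) * cmod (monomial_eval \<alpha> z)) \<le> sqrt (B * C)"
    by (rule infsum_le_finite_sums[OF s]) (rule *)
qed

lemma norm_has_sum_le_infsum:
  fixes g :: "'a \<Rightarrow> complex"
  assumes "(g has_sum s) UNIV" "h summable_on UNIV" "\<And>x. cmod (g x) \<le> h x"
  shows "cmod s \<le> infsum h UNIV"
proof -
  have "(\<lambda>x. cmod (g x)) summable_on UNIV"
    using summable_on_iff_abs_summable_on_complex has_sum_imp_summable[OF assms(1)] by blast
  then have "cmod s \<le> (\<Sum>\<^sub>\<infinity>x. cmod (g x))" using norm_infsum_bound infsumI[OF assms(1)] by metis
  also have "\<dots> \<le> infsum h UNIV" by (rule infsum_mono) (use assms \<open>(\<lambda>x. cmod (g x)) summable_on UNIV\<close> in auto)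
  finally show ?thesis .
qed

text \<open>Point evaluations are bounded by the Hardy norm, uniformly on a smaller ball and with a
  constant independent of \<open>f\<close>. This controls the mass away from the sphere in
  \<open>weighted_bergman_bound\<close>.\<close>

lemma power_series_bound:
  assumes "0 \<le> \<rho>" "\<rho> < 1"
  obtains C where "C \<ge> 0"
    "\<And>f a B z. power_series_on_ball f a \<Longrightarrow> coeff_bounded B a \<Longrightarrow> (norm (z :: complex ^ 'd::finite))\<^sup>2 \<le> \<rho>
      \<Longrightarrow> (cmod (f z))\<^sup>2 \<le> B * C"
proof -
  obtain C where C: "C \<ge> 0" "\<And>z F. (norm (z :: complex ^ 'd))\<^sup>2 \<le> \<rho> \<Longrightarrow> finite F \<Longrightarrow> (\<Sum>\<alpha>\<in>F. kernel_term z \<alpha>) \<le> C"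
    using kernel_bound[OF assms] by blast
  show ?thesis
  proof (rule that[OF C(1)])
    fix f :: "complex ^ 'd \<Rightarrow> complex" and a B and z :: "complex ^ 'd"
    assume f: "power_series_on_ball f a" and B: "coeff_bounded B a" and z: "(norm z)\<^sup>2 \<le> \<rho>"
    have "(norm z)\<^sup>2 < 1" using z assms by simp
    then have zb: "z \<in> ball 0 1" by (simp add: power_less_one_iff abs_square_less_1)
    have "((\<lambda>\<alpha>. a \<alpha> * monomial_eval \<alpha> z) has_sum f z) UNIV" using f zb by (auto simp: power_series_on_ball_def)
    then have "cmod (f z) \<le> (\<Sum>\<^sub>\<infinity>\<alpha>. cmod (a \<alpha>) * cmod (monomial_eval \<alpha> z))"
      by (rule norm_has_sum_le_infsum) (auto simp: norm_mult intro: coeff_bounded_summable(1)[OF B C(2)[OF z]])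
    also have "\<dots> \<le> sqrt (B * C)" by (rule coeff_bounded_summable(2)[OF B C(2)[OF z]])
    finally show "(cmod (f z))\<^sup>2 \<le> B * C"
      using real_sqrt_le_iff by (metis norm_ge_zero real_sqrt_abs abs_norm_cancel)
  qed
qed

text \<open>The same principle for derivatives, through the majorant at
  \<open>enlarged z \<delta>\<close>. In the completeness proof it turns Hardy convergence into
  pointwise convergence of the gradients.\<close>

lemma partial_deriv_bound:
  fixes z :: "complex ^ 'd::finite"
  assumes z: "z \<in> ball 0 1"
  obtains C where "C \<ge> 0"
    "\<And>f a B. power_series_on_ball f a \<Longrightarrow> coeff_bounded B a \<Longrightarrow> (cmod (partial_deriv j f z))\<^sup>2 \<le> B * C"
proof -
  obtain \<delta> where \<delta>: "\<delta> > 0" "enlarged z \<delta> \<in> ball 0 1" using enlarged_in_ball[OF z] by blast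
  have \<rho>: "0 \<le> (norm (enlarged z \<delta>))\<^sup>2" "(norm (enlarged z \<delta>))\<^sup>2 < 1" using \<delta>
    by (auto simp: abs_square_less_1)
  obtain C where C: "C \<ge> 0" "\<And>F. finite F \<Longrightarrow> (\<Sum>\<alpha>\<in>F. kernel_term (enlarged z \<delta>) \<alpha>) \<le> C"
    using kernel_bound[OF \<rho>] by (metis order_refl)
  show ?thesis
  proof (rule that[of "C / \<delta>\<^sup>2"])
    fix f :: "complex ^ 'd \<Rightarrow> complex" and a B
    assume f: "power_series_on_ball f a" and B: "coeff_bounded B a"
    have "cmod (partial_deriv j f z) \<le> (\<Sum>\<^sub>\<infinity>\<alpha>. inverse \<delta> * (cmod (a \<alpha>) * cmod (monomial_eval \<alpha> (enlarged z \<delta>))))"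
    proof (rule norm_has_sum_le_infsum[OF power_series_partial_deriv[OF f z]])
      show "cmod (a \<alpha> * monomial_partial j \<alpha> z) \<le> inverse \<delta> * (cmod (a \<alpha>) * cmod (monomial_eval \<alpha> (enlarged z \<delta>)))" for \<alpha>
        using mult_left_mono[OF norm_monomial_partial_le[OF \<delta>(1), of z z j \<alpha>], of "cmod (a \<alpha>)"] \<delta>
        by (simp add: norm_mult divide_inverse mult_ac)
    qed (intro summable_on_cmult_right coeff_bounded_summable(1)[OF B C(2)])
    also have "\<dots> = inverse \<delta> * (\<Sum>\<^sub>\<infinity>\<alpha>. cmod (a \<alpha>) * cmod (monomial_eval \<alpha> (enlarged z \<delta>)))"
      by (rule infsum_cmult_right) (intro coeff_bounded_summable(1)[OF B C(2)])
    also have "\<dots> \<le> inverse \<delta> * sqrt (B * C)"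
      using \<delta> by (intro mult_left_mono coeff_bounded_summable(2)[OF B C(2)]) auto
    finally have "(cmod (partial_deriv j f z))\<^sup>2 \<le> (inverse \<delta> * sqrt (B * C))\<^sup>2"
      by (rule power_mono) simp
    also have "\<dots> = B * (C / \<delta>\<^sup>2)"
      using coeff_bounded_nonneg[OF B] C(1) by (simp add: power_mult_distrib divide_inverse power_inverse)
    finally show "(cmod (partial_deriv j f z))\<^sup>2 \<le> B * (C / \<delta>\<^sup>2)" .
  qed (use C in auto)
qed

text \<open>Used when only limits of coefficients are at hand. The value 0 outside the ball is the
  normalization demanded by \<open>dirichlet_space\<close>.\<close>

lemma power_series_of_coeff_bounded:
  fixes a :: "('d::finite \<Rightarrow> nat) \<Rightarrow> complex"
  assumes B: "coeff_bounded B a"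
  obtains f where "power_series_on_ball f a" "\<And>z. z \<notin> ball 0 1 \<Longrightarrow> f z = 0"
proof
  define f where "f z = (if z \<in> ball 0 1 then \<Sum>\<^sub>\<infinity>\<alpha>. a \<alpha> * monomial_eval \<alpha> z else 0)" for z
  show "f z = 0" if "z \<notin> ball 0 1" for z using that by (auto simp: f_def)
  show "power_series_on_ball f a"
    unfolding power_series_on_ball_def
  proof
    fix z :: "complex ^ 'd" assume z: "z \<in> ball 0 1"
    then have \<rho>: "0 \<le> (norm z)\<^sup>2" "(norm z)\<^sup>2 < 1" by (auto simp: abs_square_less_1)
    obtain C where C: "\<And>F. finite F \<Longrightarrow> (\<Sum>\<alpha>\<in>F. kernel_term z \<alpha>) \<le> C"
      using kernel_bound[OF \<rho>] by (metis order_refl)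
    have "(\<lambda>\<alpha>. a \<alpha> * monomial_eval \<alpha> z) summable_on UNIV"
      unfolding summable_on_iff_abs_summable_on_complex norm_mult
      by (rule coeff_bounded_summable(1)[OF B C])
    then show "((\<lambda>\<alpha>. a \<alpha> * monomial_eval \<alpha> z) has_sum f z) UNIV"
      using z unfolding f_def by simp
  qed
qed

lemma hardy_norm_sq_eq:
  assumes "power_series_on_ball f a"
  shows "hardy_norm_sq f = (\<Sum>\<^sub>\<infinity>\<alpha>. ennreal ((cmod (a \<alpha>))\<^sup>2 * hardy_weight \<alpha>))"
  unfolding hardy_norm_sq_def power_coeff_eq[OF assms] ..

lemma coeff_bounded_iff_hardy_norm_sq:
  assumes "power_series_on_ball f a" "0 \<le> B"
  shows "hardy_norm_sq f \<le> ennreal B \<longleftrightarrow> coeff_bounded B a"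
proof -
  have nn: "0 \<le> (cmod (a \<alpha>))\<^sup>2 * hardy_weight \<alpha>" for \<alpha> by (simp add: hardy_weight_nonneg)
  have "hardy_norm_sq f = (SUP F\<in>{F. finite F \<and> F \<subseteq> UNIV}. (\<Sum>\<alpha>\<in>F. ennreal ((cmod (a \<alpha>))\<^sup>2 * hardy_weight \<alpha>)))"
    unfolding hardy_norm_sq_eq[OF assms(1)] by (subst nonneg_infsum_complete) auto
  also have "\<dots> \<le> ennreal B \<longleftrightarrow> coeff_bounded B a"
    unfolding SUP_le_iff coeff_bounded_def using nn assms(2)
    by (auto simp: sum_ennreal sum_nonneg ennreal_le_iff)
  finally show ?thesis .
qed

lemma has_sum_sum:
  fixes g :: "'i \<Rightarrow> 'a \<Rightarrow> 'b::topological_comm_monoid_add"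
  assumes "\<And>i. i \<in> I \<Longrightarrow> (g i has_sum s i) A"
  shows "((\<lambda>x. \<Sum>i\<in>I. g i x) has_sum (\<Sum>i\<in>I. s i)) A"
  using assms by (induction I rule: infinite_finite_induct) (auto intro: has_sum_add)

text \<open>After the shift, each coefficient of \<open>f\<close> carries the raised weight, and the
  raised weights sum to the old one. Working in \<open>ennreal\<close>, the identity also bounds the
  Hardy norm of every single product.\<close>

lemma sum_hardy_norm_sq_coord_mult:
  assumes "power_series_on_ball (f :: complex ^ 'd::finite \<Rightarrow> complex) a"
  shows "(\<Sum>j\<in>UNIV. hardy_norm_sq (coord_mult j f)) = hardy_norm_sq f"
proof -
  have "((\<lambda>\<alpha>. ennreal ((cmod (a \<alpha>))\<^sup>2 * hardy_weight (\<alpha>(j := Suc (\<alpha> j))))) has_sum hardy_norm_sq (coord_mult j f)) UNIV" for j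
  proof -
    let ?b = "\<lambda>\<alpha>. if \<alpha> j = 0 then 0 else a (\<alpha>(j := \<alpha> j - 1))"
    have "((\<lambda>\<alpha>. ennreal ((cmod (?b \<alpha>))\<^sup>2 * hardy_weight \<alpha>)) has_sum hardy_norm_sq (coord_mult j f)) UNIV"
      unfolding hardy_norm_sq_eq[OF power_series_coord_mult[OF assms]]
      by (intro has_sum_infsum nonneg_summable_on_complete) auto
    then show ?thesis by (subst (asm) has_sum_bump[of j]) auto
  qed
  then have "((\<lambda>\<alpha>. \<Sum>j\<in>UNIV. ennreal ((cmod (a \<alpha>))\<^sup>2 * hardy_weight (\<alpha>(j := Suc (\<alpha> j)))))
      has_sum (\<Sum>j\<in>UNIV. hardy_norm_sq (coord_mult j f))) UNIV"
    by (rule has_sum_sum)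
  also have "(\<lambda>\<alpha>. \<Sum>j\<in>UNIV. ennreal ((cmod (a \<alpha>))\<^sup>2 * hardy_weight (\<alpha>(j := Suc (\<alpha> j))))) =
      (\<lambda>\<alpha>. ennreal ((cmod (a \<alpha>))\<^sup>2 * hardy_weight \<alpha>))"
    by (subst sum_ennreal) (auto simp: hardy_weight_nonneg sum_distrib_left[symmetric] sum_hardy_weight_bump)
  finally show ?thesis unfolding hardy_norm_sq_eq[OF assms] by (rule infsumI[symmetric])
qed

section \<open>Green's formula for the Poisson kernel\<close>

text \<open>By translation invariance the difference quotients have integral zero.\<close>
lemma integral_directional_derivative_eq_0:
  fixes F :: "'a::euclidean_space \<Rightarrow> complex"
  assumes deriv: "\<And>x. ((\<lambda>t. F (x + t *\<^sub>R e)) has_vector_derivative G x) (at 0)"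
    and bound: "\<And>x. norm (G x) \<le> B"
    and supp: "\<And>x. R \<le> norm x \<Longrightarrow> F x = 0"
    and int: "integrable lborel F"
  shows "integrable lborel G" "integral\<^sup>L lborel G = 0"
proof -
  define D where "D n x = real (Suc n) *\<^sub>R (F (x + (1 / real (Suc n)) *\<^sub>R e) - F x)" for n x
  have [measurable]: "F \<in> borel_measurable borel" using int by auto
  have Dm: "D n \<in> borel_measurable lborel" for n unfolding D_def[abs_def] by measurable
  have transl: "integrable lborel (\<lambda>x. F (x + v))" "(\<integral>x. F (x + v) \<partial>lborel) = integral\<^sup>L lborel F" for v
  proof -
    have d: "distr lborel borel (\<lambda>x. x + v) = lborel" using lborel_distr_plus[of v] by (simp add: add.commute[of v, abs_def])
    have "integrable (distr lborel borel (\<lambda>x. x + v)) F" unfolding d by (rule int)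
    then show "integrable lborel (\<lambda>x. F (x + v))" by (subst (asm) integrable_distr_eq) auto
    have "integral\<^sup>L (distr lborel borel (\<lambda>x. x + v)) F = (\<integral>x. F (x + v) \<partial>lborel)"
      by (rule integral_distr) auto
    then show "(\<integral>x. F (x + v) \<partial>lborel) = integral\<^sup>L lborel F" unfolding d by simp
  qed
  have D0: "integral\<^sup>L lborel (D n) = 0" for n
    unfolding D_def by (simp add: transl int)
  have lim: "(\<lambda>n. D n x) \<longlonglongrightarrow> G x" for x
  proof -
    have "((\<lambda>h. (F (x + h *\<^sub>R e) - F x) /\<^sub>R h) \<longlongrightarrow> G x) (at 0)"
    proof (subst LIM_zero_iff[symmetric], subst tendsto_norm_zero_iff[symmetric])
      have "((\<lambda>h. norm (F (x + h *\<^sub>R e) - F x - h *\<^sub>R G x) / norm h) \<longlongrightarrow> 0) (at 0)"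
        using deriv[of x] by (simp add: has_vector_derivative_def has_derivative_at)
      then show "((\<lambda>h. norm ((F (x + h *\<^sub>R e) - F x) /\<^sub>R h - G x)) \<longlongrightarrow> 0) (at 0)"
      proof (rule Lim_transform_eventually)
        have "norm (F (x + h *\<^sub>R e) - F x - h *\<^sub>R G x) / norm h = norm ((F (x + h *\<^sub>R e) - F x) /\<^sub>R h - G x)"
          if "h \<noteq> 0" for h
        proof -
          have "(F (x + h *\<^sub>R e) - F x) /\<^sub>R h - G x = (F (x + h *\<^sub>R e) - F x - h *\<^sub>R G x) /\<^sub>R h"
            using that by (simp add: scaleR_diff_right)
          then show ?thesis by (simp add: divide_inverse)
        qed
        then show "\<forall>\<^sub>F h in at 0. norm (F (x + h *\<^sub>R e) - F x - h *\<^sub>R G x) / norm h = norm ((F (x + h *\<^sub>R e) - F x) /\<^sub>R h - G x)"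
          by (auto simp: eventually_at_filter)
      qed
    qed
    moreover have "filterlim (\<lambda>n. 1 / real (Suc n)) (at 0) sequentially"
      using LIMSEQ_inverse_real_of_nat by (auto simp: filterlim_at inverse_eq_divide)
    ultimately have "(\<lambda>n. (F (x + (1 / real (Suc n)) *\<^sub>R e) - F x) /\<^sub>R (1 / real (Suc n))) \<longlonglongrightarrow> G x"
      by (rule filterlim_compose)
    then show ?thesis by (simp add: D_def)
  qed
  \<comment> \<open>Inside the large ball this is the mean value inequality. Outside it both points
    of the difference quotient have norm at least \<open>R\<close>, as the step is no longer than
    \<open>e\<close>, and \<open>F\<close> vanishes at them.\<close>
  have Dle: "norm (D n x) \<le> B * indicator (cball 0 (\<bar>R\<bar> + norm e)) x" for n x
  proof (cases "x \<in> cball 0 (\<bar>R\<bar> + norm e)")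
    case True
    have d: "((\<lambda>t. F (x + t *\<^sub>R e)) has_vector_derivative G (x + t *\<^sub>R e)) (at t)" for t
    proof -
      have "((\<lambda>s. F ((x + t *\<^sub>R e) + s *\<^sub>R e)) has_vector_derivative G (x + t *\<^sub>R e)) (at (t - t))"
        using deriv[of "x + t *\<^sub>R e"] by simp
      then have "((\<lambda>s. F ((x + t *\<^sub>R e) + s *\<^sub>R e)) \<circ> (\<lambda>s. s - t) has_vector_derivative 1 *\<^sub>R G (x + t *\<^sub>R e)) (at t)"
        by (intro vector_diff_chain_at) (auto intro!: derivative_eq_intros)
      then show ?thesis by (simp add: o_def algebra_simps)
    qed
    have "norm (F (x + (1 / real (Suc n)) *\<^sub>R e) - F (x + 0 *\<^sub>R e)) \<le> B * norm (1 / real (Suc n) - 0)"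
    proof (rule differentiable_bound[where S = UNIV and f' = "\<lambda>t h. h *\<^sub>R G (x + t *\<^sub>R e)"])
      show "((\<lambda>t. F (x + t *\<^sub>R e)) has_derivative (\<lambda>h. h *\<^sub>R G (x + t *\<^sub>R e))) (at t within UNIV)" for t
        using d[of t] by (simp add: has_vector_derivative_def)
      show "onorm (\<lambda>h. h *\<^sub>R G (x + t *\<^sub>R e)) \<le> B" for t
        by (rule onorm_le) (use bound in \<open>auto simp: mult.commute[of B] intro!: mult_left_mono\<close>)
    qed auto
    then have "real (Suc n) * norm (F (x + (1 / real (Suc n)) *\<^sub>R e) - F x) \<le> real (Suc n) * (B * (1 / real (Suc n)))"
      by (intro mult_left_mono) auto
    then show ?thesis using True by (simp add: D_def)
  next
    case False
    have "norm x \<le> norm (x + (1 / real (Suc n)) *\<^sub>R e) + norm ((1 / real (Suc n)) *\<^sub>R e)"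
      using norm_triangle_ineq4[of "x + (1 / real (Suc n)) *\<^sub>R e" "(1 / real (Suc n)) *\<^sub>R e"] by simp
    moreover have "norm ((1 / real (Suc n)) *\<^sub>R e) \<le> norm e" by (simp add: divide_simps) (simp add: algebra_simps)
    ultimately have "R \<le> norm (x + (1 / real (Suc n)) *\<^sub>R e)" "R \<le> norm x"
      using False abs_ge_self[of R] norm_ge_zero[of e] unfolding mem_cball dist_0_norm by linarith+
    then show ?thesis using False by (simp add: D_def supp)
  qed
  have dom: "integrable lborel (\<lambda>x. B * indicator (cball (0::'a) (\<bar>R\<bar> + norm e)) x)"
    using emeasure_lborel_cball_finite[of "0::'a" "\<bar>R\<bar> + norm e"]
    by (intro integrable_mult_right integrable_real_indicator) auto
  have Gm: "G \<in> borel_measurable lborel"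
    by (rule borel_measurable_LIMSEQ_metric[OF Dm lim])
  show "integrable lborel G"
    by (rule integrable_dominated_convergence[where s = D, OF Gm Dm dom]) (auto simp: lim Dle)
  have "(\<lambda>n. integral\<^sup>L lborel (D n)) \<longlonglongrightarrow> integral\<^sup>L lborel G"
    by (rule integral_dominated_convergence[OF Gm Dm dom]) (auto simp: lim Dle)
  then show "integral\<^sup>L lborel G = 0" by (simp add: D0 LIMSEQ_const_iff)
qed

section \<open>Wirtinger derivatives in one coordinate\<close>

text \<open>\<open>p\<close> and \<open>q\<close> are the Wirtinger derivatives of \<open>F\<close> with respect to \<open>z\<^sub>j\<close> and its conjugate.\<close>
definition wirtinger ::
  "'d::finite \<Rightarrow> (complex ^ 'd \<Rightarrow> complex) \<Rightarrow> complex ^ 'd \<Rightarrow> complex \<Rightarrow> complex \<Rightarrow> bool" where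
  "wirtinger j F z p q \<longleftrightarrow> ((\<lambda>t. F (z + axis j t)) has_derivative (\<lambda>h. p * h + q * cnj h)) (at 0)"

lemma plus_axis_0 [simp]: "(z :: complex ^ 'd::finite) + axis j 0 = z"
  by (simp add: vec_eq_iff axis_def)

lemma wirtinger_transform:
  assumes "wirtinger j F z p q" "open S" "z \<in> S" "\<And>w. w \<in> S \<Longrightarrow> F w = G w"
  shows "wirtinger j G z p q"
  unfolding wirtinger_def
proof (rule has_derivative_transform_within_open[OF assms(1)[unfolded wirtinger_def]])
  have "continuous_on UNIV (\<lambda>t. z + axis j t)"
    using axis_has_derivative[of z j] by (meson continuous_at_imp_continuous_on has_derivative_continuous)
  then show "open ((\<lambda>t. z + axis j t) -` S)" using assms(2) by (simp add: open_vimage)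
qed (use assms in auto)

lemma wirtinger_zero: "wirtinger j (\<lambda>_. 0) z 0 0"
  by (simp add: wirtinger_def)

text \<open>With both derivatives as explicit arguments, the closure lemmas below act as
  differentiation rules that can be chained with \<open>OF\<close>. One coordinate at a time
  suffices, because the Laplacian is a sum over the coordinates.\<close>

definition C1_ball ::
  "'d::finite \<Rightarrow> (complex ^ 'd \<Rightarrow> complex) \<Rightarrow> (complex ^ 'd \<Rightarrow> complex) \<Rightarrow> (complex ^ 'd \<Rightarrow> complex) \<Rightarrow> bool" where
  "C1_ball j F p q \<longleftrightarrow> (\<forall>z\<in>ball 0 1. wirtinger j F z (p z) (q z)) \<and>
     continuous_on (ball 0 1) F \<and> continuous_on (ball 0 1) p \<and> continuous_on (ball 0 1) q"

lemma C1_ball_const: "C1_ball j (\<lambda>_. c) (\<lambda>_. 0) (\<lambda>_. 0)"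
  by (auto simp: C1_ball_def wirtinger_def)

lemma C1_ball_coord: "C1_ball j (\<lambda>z. z $ k) (\<lambda>_. if k = j then 1 else 0) (\<lambda>_. 0)"
proof -
  have "wirtinger j (\<lambda>z. z $ k) z (if k = j then 1 else 0) 0" for z :: "complex ^ 'a"
    unfolding wirtinger_def by (auto simp: axis_def intro!: derivative_eq_intros)
  then show ?thesis by (auto simp: C1_ball_def intro!: continuous_intros)
qed

lemma C1_ball_add:
  "C1_ball j F p q \<Longrightarrow> C1_ball j G p' q' \<Longrightarrow>
    C1_ball j (\<lambda>z. F z + G z) (\<lambda>z. p z + p' z) (\<lambda>z. q z + q' z)"
  unfolding C1_ball_def wirtinger_def
  by (auto intro!: continuous_intros derivative_eq_intros simp: algebra_simps fun_eq_iff)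

lemma C1_ball_mult:
  "C1_ball j F p q \<Longrightarrow> C1_ball j G p' q' \<Longrightarrow>
    C1_ball j (\<lambda>z. F z * G z) (\<lambda>z. p z * G z + F z * p' z) (\<lambda>z. q z * G z + F z * q' z)"
  unfolding C1_ball_def
proof (intro conjI ballI; (elim conjE)?)
  fix z :: "complex ^ 'a" assume z: "z \<in> ball 0 1" and
    "\<forall>z\<in>ball 0 1. wirtinger j F z (p z) (q z)" "\<forall>z\<in>ball 0 1. wirtinger j G z (p' z) (q' z)"
  then have "wirtinger j F z (p z) (q z)" "wirtinger j G z (p' z) (q' z)" by auto
  from has_derivative_mult[OF this[unfolded wirtinger_def]]
  show "wirtinger j (\<lambda>z. F z * G z) z (p z * G z + F z * p' z) (q z * G z + F z * q' z)"
    unfolding wirtinger_def by (simp add: algebra_simps)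
qed (auto intro!: continuous_intros)

lemma C1_ball_cnj:
  "C1_ball j F p q \<Longrightarrow> C1_ball j (\<lambda>z. cnj (F z)) (\<lambda>z. cnj (q z)) (\<lambda>z. cnj (p z))"
  unfolding C1_ball_def
proof (intro conjI ballI; (elim conjE)?)
  fix z :: "complex ^ 'a" assume z: "z \<in> ball 0 1" and "\<forall>z\<in>ball 0 1. wirtinger j F z (p z) (q z)"
  then have "wirtinger j F z (p z) (q z)" by auto
  from has_derivative_cnj[OF this[unfolded wirtinger_def]]
  show "wirtinger j (\<lambda>z. cnj (F z)) z (cnj (q z)) (cnj (p z))"
    unfolding wirtinger_def by (simp add: algebra_simps)
qed (auto intro!: continuous_intros)

lemma C1_ball_sum:
  assumes "\<And>k. k \<in> I \<Longrightarrow> C1_ball j (F k) (p k) (q k)"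
  shows "C1_ball j (\<lambda>z. \<Sum>k\<in>I. F k z) (\<lambda>z. \<Sum>k\<in>I. p k z) (\<lambda>z. \<Sum>k\<in>I. q k z)"
  using assms
  by (induction I rule: infinite_finite_induct) (auto intro: C1_ball_const C1_ball_add)

text \<open>For real \<open>s\<close> the two Wirtinger derivatives are conjugate to each other, so
  \<open>p\<close> determines both. The chain rule is applied to the real function and the result is
  embedded again.\<close>

lemma C1_ball_real_compose:
  assumes "C1_ball j (\<lambda>z. of_real (s z)) p (\<lambda>z. cnj (p z))"
    and "\<And>z. z \<in> ball 0 1 \<Longrightarrow> (\<phi> has_real_derivative \<phi>' (s z)) (at (s z))"
    and "continuous_on (s ` ball 0 1) \<phi>'"
  shows "C1_ball j (\<lambda>z. of_real (\<phi> (s z))) (\<lambda>z. of_real (\<phi>' (s z)) * p z) (\<lambda>z. of_real (\<phi>' (s z)) * cnj (p z))"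
  unfolding C1_ball_def
proof (intro conjI ballI)
  have s: "continuous_on (ball 0 1) s"
    using continuous_on_Re[of "ball 0 1" "\<lambda>z. complex_of_real (s z)"] assms(1) by (simp add: C1_ball_def)
  have p: "continuous_on (ball 0 1) p" using assms(1) by (simp add: C1_ball_def)
  have \<phi>: "continuous_on (s ` ball 0 1) \<phi>"
    using assms(2) by (auto intro!: continuous_at_imp_continuous_on DERIV_isCont)
  note \<phi>s = continuous_on_compose2[OF \<phi> s order_refl] continuous_on_compose2[OF assms(3) s order_refl]
  show "continuous_on (ball 0 1) (\<lambda>z. complex_of_real (\<phi> (s z)))"
    "continuous_on (ball 0 1) (\<lambda>z. complex_of_real (\<phi>' (s z)) * p z)"
    "continuous_on (ball 0 1) (\<lambda>z. complex_of_real (\<phi>' (s z)) * cnj (p z))"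
    by (intro continuous_intros p \<phi>s)+
  fix z :: "complex ^ 'a" assume z: "z \<in> ball 0 1"
  have "((\<lambda>t. complex_of_real (s (z + axis j t))) has_derivative (\<lambda>h. p z * h + cnj (p z) * cnj h)) (at 0)"
    using assms(1) z by (auto simp: C1_ball_def wirtinger_def)
  from has_derivative_Re[OF this]
  have "((\<lambda>t. s (z + axis j t)) has_derivative (\<lambda>h. Re (p z * h + cnj (p z) * cnj h))) (at 0)" by simp
  from has_derivative_compose[OF this, of \<phi> "(*) (\<phi>' (s z))"] assms(2)[OF z]
  have "((\<lambda>t. \<phi> (s (z + axis j t))) has_derivative (\<lambda>h. \<phi>' (s z) * Re (p z * h + cnj (p z) * cnj h))) (at 0)"
    by (simp add: has_field_derivative_def)
  from has_derivative_of_real[OF this]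
  have "((\<lambda>t. complex_of_real (\<phi> (s (z + axis j t)))) has_derivative
    (\<lambda>h. complex_of_real (\<phi>' (s z) * Re (p z * h + cnj (p z) * cnj h)))) (at 0)" .
  moreover have "(\<lambda>h. complex_of_real (\<phi>' (s z) * Re (p z * h + cnj (p z) * cnj h))) =
     (\<lambda>h. of_real (\<phi>' (s z)) * p z * h + of_real (\<phi>' (s z)) * cnj (p z) * cnj h)"
    by (auto simp: fun_eq_iff complex_eq_iff algebra_simps)
  ultimately show "wirtinger j (\<lambda>z. complex_of_real (\<phi> (s z))) z (complex_of_real (\<phi>' (s z)) * p z)
           (complex_of_real (\<phi>' (s z)) * cnj (p z))"
    unfolding wirtinger_def by simp
qed

text \<open>The double conjugate keeps the shape \<open>cnj (p z)\<close> with which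
  \<open>C1_ball_real_compose\<close> has to unify.\<close>

lemma C1_ball_norm_sq:
  "C1_ball j (\<lambda>z. of_real ((norm (z - \<zeta>))\<^sup>2)) (\<lambda>z. cnj ((z - \<zeta>) $ j)) (\<lambda>z. cnj (cnj ((z - \<zeta>) $ j)))"
proof -
  have "C1_ball j (\<lambda>z. \<Sum>k\<in>UNIV. (z $ k + - (\<zeta> $ k)) * cnj (z $ k + - (\<zeta> $ k)))
    (\<lambda>z. \<Sum>k\<in>UNIV. ((if k = j then 1 else 0) + 0) * cnj (z $ k + - (\<zeta> $ k)) + (z $ k + - (\<zeta> $ k)) * cnj (0 + 0))
    (\<lambda>z. \<Sum>k\<in>UNIV. (0 + 0) * cnj (z $ k + - (\<zeta> $ k)) + (z $ k + - (\<zeta> $ k)) * cnj ((if k = j then 1 else 0) + 0))"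
    by (intro C1_ball_sum C1_ball_mult C1_ball_add C1_ball_cnj C1_ball_coord C1_ball_const)
  moreover have "(\<lambda>z. complex_of_real ((norm (z - \<zeta>))\<^sup>2)) = (\<lambda>z. \<Sum>k\<in>UNIV. (z $ k + - (\<zeta> $ k)) * cnj (z $ k + - (\<zeta> $ k)))"
    unfolding norm_sq_vec by (simp add: complex_norm_square flip: of_real_power)
  ultimately show ?thesis
    by (simp add: if_distrib[where f="\<lambda>x. x * _"] if_distrib[where f="\<lambda>x. _ * x"] if_distrib[where f=cnj] cong: if_cong)
qed

lemma C1_ball_power_series:
  assumes "power_series_on_ball f a"
  shows "C1_ball j f (partial_deriv j f) (\<lambda>_. 0)"
proof -
  note h = power_series_holomorphic[OF assms]
  have "wirtinger j f z (partial_deriv j f z) 0" if "z \<in> ball 0 1" for z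
    using holomorphic_on_ball_DERIV[OF h that, of j] by (simp add: wirtinger_def has_field_derivative_def)
  then show ?thesis
    using holomorphic_on_ball_continuous_on[OF h]
      holomorphic_on_ball_continuous_on[OF power_series_holomorphic[OF power_series_partial_deriv_series[OF assms, of j]]]
    by (auto simp: C1_ball_def)
qed

lemma supported_in_ball_bounded:
  fixes g :: "'a::euclidean_space \<Rightarrow> 'b::real_normed_vector"
  assumes "continuous_on (ball 0 1) g" "0 \<le> b" "b < 1" "\<And>z. b \<le> (norm z)\<^sup>2 \<Longrightarrow> g z = 0"
  obtains B where "0 \<le> B" "\<And>z. norm (g z) \<le> B"
proof -
  have sub: "cball 0 (sqrt b) \<subseteq> ball (0::'a) 1"
    using assms(3) real_sqrt_lt_1_iff[of b] by (auto simp del: real_sqrt_lt_1_iff)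
  have out: "b \<le> (norm z)\<^sup>2" if "z \<notin> cball 0 (sqrt b)" for z :: 'a
    using that assms(2) power_mono[of "sqrt b" "norm z" 2] by simp
  have "compact (g ` cball 0 (sqrt b))"
    using continuous_on_subset[OF assms(1) sub] by (intro compact_continuous_image) auto
  then obtain B where B: "\<forall>y\<in>g ` cball 0 (sqrt b). norm y \<le> B" using compact_imp_bounded bounded_iff by metis
  have "norm (g z) \<le> max B 0" for z
    using B assms(4)[OF out, of z] by (cases "z \<in> cball 0 (sqrt b)") (auto intro: max.coboundedI1)
  then show ?thesis by (intro that[of "max B 0"]) auto
qed

text \<open>The directional derivative along \<open>axis j c\<close> is
  \<open>p z * c + q z * cnj c\<close>. Taking \<open>c = 1\<close> and \<open>c = \<i>\<close>
  shows that \<open>p + q\<close> and \<open>p - q\<close> both have integral zero.\<close>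

lemma integral_wirtinger_eq_0:
  fixes F :: "complex ^ 'd::finite \<Rightarrow> complex"
  assumes F: "C1_ball j F p q" and b: "0 \<le> b" "b < 1"
    and supp: "\<And>z. b \<le> (norm z)\<^sup>2 \<Longrightarrow> F z = 0 \<and> p z = 0 \<and> q z = 0"
  shows "integrable lborel p" "integral\<^sup>L lborel p = 0" "integrable lborel q" "integral\<^sup>L lborel q = 0"
proof -
  have cont: "continuous_on (ball 0 1) F" "continuous_on (ball 0 1) p" "continuous_on (ball 0 1) q"
    using F by (auto simp: C1_ball_def)
  obtain BF where BF: "\<And>z. cmod (F z) \<le> BF" using supported_in_ball_bounded[OF cont(1) b] supp by metis
  obtain Bp where Bp: "\<And>z. cmod (p z) \<le> Bp" using supported_in_ball_bounded[OF cont(2) b] supp by metis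
  obtain Bq where Bq: "\<And>z. cmod (q z) \<le> Bq" using supported_in_ball_bounded[OF cont(3) b] supp by metis
  note B = BF Bp Bq
  have supp1: "F z = 0" if "1 \<le> norm z" for z
    using supp[of z] that b one_le_power[of "norm z" 2] by linarith
  have "(\<lambda>z. indicator (ball 0 1) z *\<^sub>R F z) \<in> borel_measurable borel"
    using cont(1) by (intro borel_measurable_continuous_on_indicator) auto
  also have "(\<lambda>z. indicator (ball 0 1) z *\<^sub>R F z) = F"
    using supp1 by (auto simp: indicator_def fun_eq_iff)
  finally have Fm: "F \<in> borel_measurable borel" .
  have Fi: "integrable lborel F"
  proof (rule Bochner_Integration.integrable_bound)
    show "integrable lborel (\<lambda>z. BF * indicator (ball (0::complex ^ 'd) 1) z)"
      using emeasure_unit_ball_pos(2)[where 'd='d]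
      by (intro integrable_mult_right integrable_real_indicator) auto
    show "AE z in lborel. norm (F z) \<le> norm (BF * indicator (ball 0 1) z)"
      using B(1) supp1 by (intro AE_I2) (auto simp: indicator_def intro: order_trans[OF _ abs_ge_self])
  qed (use Fm in auto)
  have w: "wirtinger j F z (p z) (q z)" for z
  proof (cases "z \<in> ball 0 1")
    case True
    then show ?thesis using F by (auto simp: C1_ball_def)
  next
    case False
    \<comment> \<open>Off the unit ball \<open>F\<close> vanishes on a whole neighbourhood of
      \<open>z\<close>, because \<open>b < 1\<close>; so \<open>F\<close> is differentiable
      everywhere, although \<open>C1_ball\<close> speaks only of the ball.\<close>
    have S: "open {z :: complex ^ 'd. b < (norm z)\<^sup>2}" by (intro open_Collect_less continuous_intros)
    have z: "b < (norm z)\<^sup>2" using False b one_le_power[of "norm z" 2]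
      unfolding mem_ball dist_0_norm not_less by linarith
    have "wirtinger j F z 0 0"
      by (rule wirtinger_transform[OF wirtinger_zero S]) (use z supp in \<open>auto simp: less_imp_le\<close>)
    then show ?thesis using supp z by (simp add: less_imp_le)
  qed
  have vd: "((\<lambda>t. F (z + t *\<^sub>R axis j c)) has_vector_derivative (p z * c + q z * cnj c)) (at 0)" for z c
  proof -
    have 1: "((\<lambda>t::real. t *\<^sub>R c) has_derivative (\<lambda>h. h *\<^sub>R c)) (at 0)"
      by (intro derivative_eq_intros) auto
    have "z + t *\<^sub>R axis j c = z + axis j (t *\<^sub>R c)" for t :: real by (simp add: vec_eq_iff axis_def)
    with has_derivative_compose[OF 1, of "\<lambda>t. F (z + axis j t)" "\<lambda>h. p z * h + q z * cnj h"] w[of z]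
    show ?thesis
      by (simp add: wirtinger_def has_vector_derivative_def scaleR_conv_of_real algebra_simps)
  qed
  have bnd: "cmod (p z * c + q z * cnj c) \<le> (Bp + Bq) * cmod c" for z c
    by (rule order_trans[OF norm_triangle_ineq])
       (use B in \<open>auto simp: norm_mult distrib_right intro!: add_mono mult_right_mono\<close>)
  have *: "integrable lborel (\<lambda>z. p z * c + q z * cnj c)" "(\<integral>z. p z * c + q z * cnj c \<partial>lborel) = 0" for c
    using integral_directional_derivative_eq_0[OF vd[of _ c] bnd[of _ c] supp1 Fi] by blast+
  from *[of 1] have 1: "integrable lborel (\<lambda>z. p z + q z)" "(\<integral>z. p z + q z \<partial>lborel) = 0" by auto
  from *[of \<i>] have 2: "integrable lborel (\<lambda>z. \<i> * (p z - q z))" "(\<integral>z. \<i> * (p z - q z) \<partial>lborel) = 0"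
    by (auto simp: algebra_simps)
  \<comment> \<open>Solving for \<open>p\<close> and \<open>q\<close>; integrability of each is
    inherited from the two combinations.\<close>
  have 3: "p = (\<lambda>z. (1/2) * ((p z + q z) - \<i> * (\<i> * (p z - q z))))" "q = (\<lambda>z. (1/2) * ((p z + q z) + \<i> * (\<i> * (p z - q z))))"
    by (auto simp: fun_eq_iff)
  show pi: "integrable lborel p" by (subst 3(1)) (intro integrable_mult_right Bochner_Integration.integrable_diff 1 2)
  show qi: "integrable lborel q" by (subst 3(2)) (intro integrable_mult_right Bochner_Integration.integrable_add 1 2)
  have "integral\<^sup>L lborel p + integral\<^sup>L lborel q = 0" "integral\<^sup>L lborel p - integral\<^sup>L lborel q = 0"
    using 1(2) 2(2) pi qi by auto
  then show "integral\<^sup>L lborel p = 0" "integral\<^sup>L lborel q = 0"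
    by auto
qed

section \<open>The terms of Green's formula and compactly supported factors\<close>

definition grad_sq :: "(complex ^ 'd::finite \<Rightarrow> complex) \<Rightarrow> complex ^ 'd \<Rightarrow> real" where
  "grad_sq f z = (\<Sum>j\<in>UNIV. (cmod (partial_deriv j f z))\<^sup>2)"

definition euler_deriv :: "(complex ^ 'd::finite \<Rightarrow> complex) \<Rightarrow> complex ^ 'd \<Rightarrow> complex" where
  "euler_deriv f z = (\<Sum>j\<in>UNIV. z $ j * partial_deriv j f z)"

text \<open>The factor of the first derivative of \<phi> in a quarter of the Laplacian of
  \<phi>(||z||^2) |f|^2. The dimension comes from differentiating z_j by z_j in each coordinate, the
  real part from the two mixed terms.\<close>

definition radial_term :: "(complex ^ 'd::finite \<Rightarrow> complex) \<Rightarrow> complex ^ 'd \<Rightarrow> real" where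
  "radial_term f z = CARD('d) * (cmod (f z))\<^sup>2 + 2 * Re (cnj (f z) * euler_deriv f z)"

text \<open>A quarter of the Laplacian of \<open>\<phi> (\<parallel>z\<parallel>\<^sup>2) \<bar>f z\<bar>\<^sup>2\<close>, where \<open>\<phi>\<^sub>1\<close> and \<open>\<phi>\<^sub>2\<close> stand for the first two derivatives of \<open>\<phi>\<close>.\<close>
definition green_density ::
  "(real \<Rightarrow> real) \<Rightarrow> (real \<Rightarrow> real) \<Rightarrow> (real \<Rightarrow> real) \<Rightarrow> (complex ^ 'd::finite \<Rightarrow> complex) \<Rightarrow> complex ^ 'd \<Rightarrow> real" where
  "green_density \<phi> \<phi>1 \<phi>2 f z = \<phi> ((norm z)\<^sup>2) * grad_sq f z + \<phi>1 ((norm z)\<^sup>2) * radial_term f z +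
     \<phi>2 ((norm z)\<^sup>2) * (norm z)\<^sup>2 * (cmod (f z))\<^sup>2"

definition C1_cpt ::
  "real \<Rightarrow> 'd::finite \<Rightarrow> (complex ^ 'd \<Rightarrow> complex) \<Rightarrow> (complex ^ 'd \<Rightarrow> complex) \<Rightarrow> (complex ^ 'd \<Rightarrow> complex) \<Rightarrow> bool" where
  "C1_cpt b j F p q \<longleftrightarrow> C1_ball j F p q \<and> (\<forall>z. b \<le> (norm z)\<^sup>2 \<longrightarrow> F z = 0 \<and> p z = 0 \<and> q z = 0)"

text \<open>The second factor may be singular on the sphere, as the Poisson kernel is: the first one
  and its derivatives vanish near there.\<close>

lemma C1_cpt_mult:
  "C1_cpt b j F p q \<Longrightarrow> C1_ball j G p' q' \<Longrightarrow>
    C1_cpt b j (\<lambda>z. F z * G z) (\<lambda>z. p z * G z + F z * p' z) (\<lambda>z. q z * G z + F z * q' z)"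
  by (auto simp: C1_cpt_def intro: C1_ball_mult)

lemma C1_cpt_add:
  "C1_cpt b j F p q \<Longrightarrow> C1_cpt b j G p' q' \<Longrightarrow>
    C1_cpt b j (\<lambda>z. F z + G z) (\<lambda>z. p z + p' z) (\<lambda>z. q z + q' z)"
  by (auto simp: C1_cpt_def intro: C1_ball_add)

text \<open>The derivatives produced by chaining the rules are unwieldy; the additional equation
  exchanges them for a readable form.\<close>

lemma C1_cpt_integral:
  assumes "C1_cpt b j F p q" "0 \<le> b" "b < 1"
  shows "(\<And>z. p z = p' z) \<Longrightarrow> integrable lborel p' \<and> integral\<^sup>L lborel p' = 0"
    and "(\<And>z. q z = q' z) \<Longrightarrow> integrable lborel q' \<and> integral\<^sup>L lborel q' = 0"
proof -
  note * = integral_wirtinger_eq_0[of j F p q b]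
  show "integrable lborel p' \<and> integral\<^sup>L lborel p' = 0" if "\<And>z. p z = p' z"
  proof -
    have "p = p'" using that by auto
    then show ?thesis using * assms by (auto simp: C1_cpt_def)
  qed
  show "integrable lborel q' \<and> integral\<^sup>L lborel q' = 0" if "\<And>z. q z = q' z"
  proof -
    have "q = q'" using that by auto
    then show ?thesis using * assms by (auto simp: C1_cpt_def)
  qed
qed

lemma C1_ball_cong:
  assumes "C1_ball j F p q" "\<And>z. F z = F' z" "\<And>z. p z = p' z" "\<And>z. q z = q' z"
  shows "C1_ball j F' p' q'"
proof -
  have "F = F'" "p = p'" "q = q'" using assms by auto
  then show ?thesis using assms(1) by simp
qed

lemma C1_ball_norm_sq_0:
  "C1_ball j (\<lambda>z. of_real ((norm z)\<^sup>2)) (\<lambda>z. cnj (z $ j)) (\<lambda>z. cnj (cnj (z $ j)))"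
  by (rule C1_ball_cong[OF C1_ball_norm_sq[of j 0]]) auto

section \<open>Harmonicity of the Poisson kernel\<close>

definition poisson_partial :: "'d \<Rightarrow> complex ^ 'd::finite \<Rightarrow> complex ^ 'd \<Rightarrow> complex" where
  "poisson_partial j \<zeta> z = of_real (- 1) * cnj (z $ j) * of_real (1 / ((norm (z - \<zeta>))\<^sup>2) ^ CARD('d)) +
     of_real (1 - (norm z)\<^sup>2) *
       (of_real (- real CARD('d) / ((norm (z - \<zeta>))\<^sup>2) ^ (CARD('d) + 1)) * cnj (z $ j + - (\<zeta> $ j)))"

text \<open>The derivative of \<open>poisson_partial j \<zeta>\<close> with respect to the conjugate
  of z_j; summed over \<open>j\<close> it is a quarter of the Laplacian of the kernel.\<close>

definition poisson_partial2 :: "'d \<Rightarrow> complex ^ 'd::finite \<Rightarrow> complex ^ 'd \<Rightarrow> complex" where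
  "poisson_partial2 j \<zeta> z = - of_real (1 / ((norm (z - \<zeta>))\<^sup>2) ^ CARD('d))
     - of_real (- real CARD('d) / ((norm (z - \<zeta>))\<^sup>2) ^ (CARD('d) + 1)) *
         (cnj (z $ j) * (z $ j - \<zeta> $ j) + z $ j * cnj (z $ j - \<zeta> $ j))
     + of_real (1 - (norm z)\<^sup>2) *
         (of_real (real CARD('d) * (real CARD('d) + 1) / ((norm (z - \<zeta>))\<^sup>2) ^ (CARD('d) + 2)) *
            ((z $ j - \<zeta> $ j) * cnj (z $ j - \<zeta> $ j)) +
          of_real (- real CARD('d) / ((norm (z - \<zeta>))\<^sup>2) ^ (CARD('d) + 1)))"

lemma DERIV_inverse_power:
  fixes c x :: real
  assumes "x \<noteq> 0"
  shows "((\<lambda>x. c / x ^ n) has_real_derivative (- c * real n / x ^ (n + 1))) (at x)"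
proof -
  have "((\<lambda>x. c / x ^ n) has_real_derivative (0 * x ^ n - c * (real n * x ^ (n - 1))) / (x ^ n * x ^ n)) (at x)"
    by (rule DERIV_divide) (use assms in \<open>auto intro!: derivative_eq_intros\<close>)
  also have "(0 * x ^ n - c * (real n * x ^ (n - 1))) / (x ^ n * x ^ n) = - c * real n / x ^ (n + 1)"
    using assms by (cases n) (auto simp: divide_simps)
  finally show ?thesis .
qed

context
  fixes \<zeta> :: "complex ^ 'd::finite"
  assumes \<zeta>: "\<zeta> \<in> sphere 0 1"
begin

lemma ball_neq_sphere: "z \<in> ball 0 1 \<Longrightarrow> z \<noteq> \<zeta>"
  using \<zeta> by auto

lemma C1_ball_inverse_power:
  "C1_ball j (\<lambda>z. of_real (c / ((norm (z - \<zeta>))\<^sup>2) ^ n))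
     (\<lambda>z. of_real (- c * real n / ((norm (z - \<zeta>))\<^sup>2) ^ (n + 1)) * cnj ((z - \<zeta>) $ j))
     (\<lambda>z. of_real (- c * real n / ((norm (z - \<zeta>))\<^sup>2) ^ (n + 1)) * cnj (cnj ((z - \<zeta>) $ j)))"
proof (rule C1_ball_real_compose[OF C1_ball_norm_sq, of "\<lambda>x. c / x ^ n" "\<lambda>x. - c * real n / x ^ (n + 1)"])
  show "((\<lambda>x. c / x ^ n) has_real_derivative - c * real n / ((norm (z - \<zeta>))\<^sup>2) ^ (n + 1)) (at ((norm (z - \<zeta>))\<^sup>2))"
    if "z \<in> ball 0 1" for z
    by (rule DERIV_inverse_power) (use ball_neq_sphere[OF that] in auto)
  show "continuous_on ((\<lambda>z. (norm (z - \<zeta>))\<^sup>2) ` ball 0 1) (\<lambda>x. - c * real n / x ^ (n + 1))"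
    by (intro continuous_intros) (use ball_neq_sphere in auto)
qed

lemma C1_ball_one_minus_norm_sq:
  "C1_ball j (\<lambda>z :: complex ^ 'd. of_real (1 - (norm z)\<^sup>2)) (\<lambda>z. of_real (- 1) * cnj (z $ j)) (\<lambda>z. of_real (- 1) * cnj (cnj (z $ j)))"
  by (rule C1_ball_real_compose[OF C1_ball_norm_sq_0, of "\<lambda>x. 1 - x" "\<lambda>x. - 1"])
     (auto intro!: derivative_eq_intros continuous_intros)

lemma C1_ball_poisson_kernel:
  "\<exists>q. C1_ball j (\<lambda>z. of_real (poisson_kernel z \<zeta>)) (poisson_partial j \<zeta>) q"
  by (rule exI, rule C1_ball_cong[OF C1_ball_mult[OF C1_ball_one_minus_norm_sq C1_ball_inverse_power[of _ 1 "CARD('d)"]]])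
     (auto simp: poisson_kernel_def poisson_partial_def power_mult)

lemma C1_ball_poisson_partial:
  "\<exists>p. C1_ball j (poisson_partial j \<zeta>) p (poisson_partial2 j \<zeta>)"
proof -
  \<comment> \<open>\<open>R\<close>, \<Psi> and \<Psi>' are x^(-d) and its first two derivatives,
    taken at the squared distance from \<zeta>.\<close>
  define R where "R z = complex_of_real (1 / ((norm (z - \<zeta>))\<^sup>2) ^ CARD('d))" for z
  define \<Psi> where "\<Psi> z = complex_of_real (- real CARD('d) / ((norm (z - \<zeta>))\<^sup>2) ^ (CARD('d) + 1))" for z
  define \<Psi>' where "\<Psi>' z = complex_of_real (real CARD('d) * (real CARD('d) + 1) / ((norm (z - \<zeta>))\<^sup>2) ^ (CARD('d) + 2))" for z
  have R: "C1_ball j R (\<lambda>z. \<Psi> z * cnj ((z - \<zeta>) $ j)) (\<lambda>z. \<Psi> z * cnj (cnj ((z - \<zeta>) $ j)))"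
    by (rule C1_ball_cong[OF C1_ball_inverse_power[of j 1 "CARD('d)"]]) (simp_all add: R_def \<Psi>_def)
  have \<Psi>: "C1_ball j \<Psi> (\<lambda>z. \<Psi>' z * cnj ((z - \<zeta>) $ j)) (\<lambda>z. \<Psi>' z * cnj (cnj ((z - \<zeta>) $ j)))"
    by (rule C1_ball_cong[OF C1_ball_inverse_power[of j "- real CARD('d)" "CARD('d) + 1"]])
       (simp_all add: \<Psi>_def \<Psi>'_def add.commute)
  note a = C1_ball_mult[OF C1_ball_mult[OF C1_ball_const[of _ "of_real (- 1)"] C1_ball_cnj[OF C1_ball_coord[of _ j]]] R]
  note b = C1_ball_mult[OF C1_ball_one_minus_norm_sq[of j] C1_ball_mult[OF \<Psi>
      C1_ball_cnj[OF C1_ball_add[OF C1_ball_coord[of _ j] C1_ball_const[of _ "- (\<zeta> $ j)"]]]]]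
  show ?thesis
  proof (rule exI, rule C1_ball_cong[OF C1_ball_add[OF a b] _ refl], goal_cases)
    case (1 z)
    show ?case unfolding poisson_partial_def R_def[symmetric] \<Psi>_def[symmetric] ..
  next
    case (2 z)
    show ?case unfolding poisson_partial2_def R_def[symmetric] \<Psi>_def[symmetric] \<Psi>'_def[symmetric]
      by (simp add: algebra_simps)
  qed
qed

text \<open>All sums reduce to \<open>s\<close> and \<open>N\<close>. Since \<zeta> is a unit
  vector, the cross term sums to \<open>s + N - 1\<close>, and what remains is n / N^(d + 1) times -
  N + (s + N - 1) + (1 - s), which is 0.\<close>

lemma poisson_harmonic:
  assumes z: "z \<in> ball 0 1"
  shows "(\<Sum>j\<in>UNIV. poisson_partial2 j \<zeta> z) = 0"
proof -
  define n where "n = real CARD('d)"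
  define N where "N = (norm (z - \<zeta>))\<^sup>2"
  define s where "s = (norm z)\<^sup>2"
  have N: "N > 0" using ball_neq_sphere[OF z] by (simp add: N_def)
  have ww: "(\<Sum>j\<in>UNIV. (z $ j - \<zeta> $ j) * cnj (z $ j - \<zeta> $ j)) = of_real N"
    unfolding N_def norm_sq_vec by (simp add: complex_norm_square flip: of_real_power)
  have "1 = (norm \<zeta>)\<^sup>2" using \<zeta> by simp
  then have "1 = (\<Sum>j\<in>UNIV. \<zeta> $ j * cnj (\<zeta> $ j))"
    unfolding norm_sq_vec complex_norm_square[symmetric] of_real_power[symmetric] of_real_sum[symmetric] by simp
  moreover have "of_real s = (\<Sum>j\<in>UNIV. z $ j * cnj (z $ j))"
    unfolding s_def norm_sq_vec by (simp add: complex_norm_square flip: of_real_power)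
  moreover have "(\<Sum>j\<in>UNIV. cnj (z $ j) * (z $ j - \<zeta> $ j) + z $ j * cnj (z $ j - \<zeta> $ j)) =
      (\<Sum>j\<in>UNIV. z $ j * cnj (z $ j) + (z $ j - \<zeta> $ j) * cnj (z $ j - \<zeta> $ j) - \<zeta> $ j * cnj (\<zeta> $ j))"
    by (intro sum.cong refl) (simp add: algebra_simps)
  ultimately have zw: "(\<Sum>j\<in>UNIV. cnj (z $ j) * (z $ j - \<zeta> $ j) + z $ j * cnj (z $ j - \<zeta> $ j)) = of_real (s + N - 1)"
    unfolding sum.distrib sum_subtractf ww by simp
  have "(\<Sum>j\<in>UNIV. poisson_partial2 j \<zeta> z) =
      of_real n * (- of_real (1 / N ^ CARD('d))) - of_real (- n / N ^ (CARD('d) + 1)) * of_real (s + N - 1)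
      + of_real (1 - s) * (of_real (n * (n + 1) / N ^ (CARD('d) + 2)) * of_real N + of_real n * of_real (- n / N ^ (CARD('d) + 1)))"
    unfolding poisson_partial2_def N_def[symmetric] s_def[symmetric] n_def[symmetric] zw[symmetric] ww[symmetric]
    by (simp add: sum.distrib sum_subtractf sum_distrib_left[symmetric] n_def del: of_real_diff of_real_divide of_real_mult of_real_power)
  also have "\<dots> = of_real (- n / N ^ CARD('d) + n / N ^ (CARD('d) + 1) * (s + N - 1) +
      (1 - s) * (n * (n + 1) / N ^ (CARD('d) + 2) * N - n * n / N ^ (CARD('d) + 1)))"
    by simp
  also have "- n / N ^ CARD('d) + n / N ^ (CARD('d) + 1) * (s + N - 1) +
      (1 - s) * (n * (n + 1) / N ^ (CARD('d) + 2) * N - n * n / N ^ (CARD('d) + 1)) = 0"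
    using N by (simp add: field_simps)
  finally show ?thesis by simp
qed

end

text \<open>Green's formula for the harmonic function \<open>P(\<cdot>,\<zeta>)\<close> and the compactly supported function
  \<open>\<phi> (\<parallel>z\<parallel>\<^sup>2) \<bar>f z\<bar>\<^sup>2\<close>.\<close>
lemma integral_poisson_green_density:
  fixes f :: "complex ^ 'd::finite \<Rightarrow> complex"
  assumes f: "power_series_on_ball f a" and \<zeta>: "\<zeta> \<in> sphere 0 1"
    and b: "0 \<le> b" "b < 1"
    and \<phi>: "\<And>x. (\<phi> has_real_derivative \<phi>1 x) (at x)" "\<And>x. (\<phi>1 has_real_derivative \<phi>2 x) (at x)" "continuous_on UNIV \<phi>2"
    and supp: "\<And>x. b \<le> x \<Longrightarrow> \<phi> x = 0 \<and> \<phi>1 x = 0 \<and> \<phi>2 x = 0"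
  shows "(\<integral>z. poisson_kernel z \<zeta> * green_density \<phi> \<phi>1 \<phi>2 f z \<partial>lborel) = 0"
proof -
  define \<Phi> where "\<Phi> z = complex_of_real (\<phi> ((norm z)\<^sup>2))" for z :: "complex ^ 'd"
  define \<Phi>1 where "\<Phi>1 z = complex_of_real (\<phi>1 ((norm z)\<^sup>2))" for z :: "complex ^ 'd"
  define \<Phi>2 where "\<Phi>2 z = complex_of_real (\<phi>2 ((norm z)\<^sup>2))" for z :: "complex ^ 'd"
  define P where "P z = complex_of_real (poisson_kernel z \<zeta>)" for z
  define A where "A j = poisson_partial j \<zeta>" for j
  define B where "B j = poisson_partial2 j \<zeta>" for j
  define g where "g j = partial_deriv j f" for j
  have cont1: "continuous_on UNIV \<phi>1" using \<phi>(2) by (auto intro!: continuous_at_imp_continuous_on DERIV_isCont)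
  have C\<Phi>: "C1_cpt b j \<Phi> (\<lambda>z. \<Phi>1 z * cnj (z $ j)) (\<lambda>z. \<Phi>1 z * cnj (cnj (z $ j)))" for j
    unfolding C1_cpt_def \<Phi>_def[abs_def] \<Phi>1_def[abs_def] using supp
    by (intro conjI C1_ball_real_compose[OF C1_ball_norm_sq_0]) (auto intro: \<phi> continuous_on_subset[OF cont1])
  have C\<Phi>1: "C1_cpt b j \<Phi>1 (\<lambda>z. \<Phi>2 z * cnj (z $ j)) (\<lambda>z. \<Phi>2 z * cnj (cnj (z $ j)))" for j
    unfolding C1_cpt_def \<Phi>2_def[abs_def] \<Phi>1_def[abs_def] using supp
    by (intro conjI C1_ball_real_compose[OF C1_ball_norm_sq_0]) (auto intro: \<phi> continuous_on_subset[OF \<phi>(3)])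
  \<comment> \<open>Write U for \<open>\<Phi>\<close> times |f|^2. Then \<open>p j\<close> is the
    z_j-derivative of \<open>P\<close> times the conjugate derivative of U, and \<open>q j\<close>
    is the conjugate derivative of U times \<open>A j\<close>. The products of two first derivatives
    agree, so they cancel in the difference and Green's integrand remains.\<close>
  define p where "p j z = P z * (\<Phi>2 z * (cnj (z $ j) * z $ j) * (f z * cnj (f z)) + \<Phi>1 z * (f z * cnj (f z)) +
      \<Phi>1 z * (z $ j * g j z * cnj (f z)) + \<Phi>1 z * (cnj (z $ j) * cnj (g j z) * f z) + \<Phi> z * (g j z * cnj (g j z)))
    + (\<Phi>1 z * z $ j * (f z * cnj (f z)) + \<Phi> z * (f z * cnj (g j z))) * A j z" for j z
  define q where "q j z = (\<Phi>1 z * z $ j * (f z * cnj (f z)) + \<Phi> z * (f z * cnj (g j z))) * A j z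
    + \<Phi> z * (f z * cnj (f z)) * B j z" for j z
  have pq: "(integrable lborel (p j) \<and> integral\<^sup>L lborel (p j) = 0) \<and> (integrable lborel (q j) \<and> integral\<^sup>L lborel (q j) = 0)" for j
  proof -
    have Cf: "C1_ball j f (g j) (\<lambda>_. 0)" unfolding g_def by (rule C1_ball_power_series[OF f])
    obtain g' where Cg: "C1_ball j (g j) g' (\<lambda>_. 0)"
      unfolding g_def using C1_ball_power_series[OF power_series_partial_deriv_series[OF f]] by blast
    obtain qP where CP: "C1_ball j P (A j) qP"
      unfolding P_def[abs_def] A_def using C1_ball_poisson_kernel[OF \<zeta>] by blast
    obtain pA where CA: "C1_ball j (A j) pA (B j)"
      unfolding A_def B_def using C1_ball_poisson_partial[OF \<zeta>] by blast
    note Cff = C1_ball_mult[OF Cf C1_ball_cnj[OF Cf]]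
    note F1 = C1_cpt_mult[OF C1_cpt_add[OF C1_cpt_mult[OF C\<Phi>1 C1_ball_mult[OF C1_ball_coord[of _ j] Cff]]
          C1_cpt_mult[OF C\<Phi> C1_ball_mult[OF Cf C1_ball_cnj[OF Cg]]]] CP]
    note F2 = C1_cpt_mult[OF C1_cpt_mult[OF C\<Phi> Cff] CA]
    show ?thesis
    proof
      show "integrable lborel (p j) \<and> integral\<^sup>L lborel (p j) = 0"
        by (rule C1_cpt_integral(1)[OF F1 b]) (simp add: p_def algebra_simps)
      show "integrable lborel (q j) \<and> integral\<^sup>L lborel (q j) = 0"
        by (rule C1_cpt_integral(2)[OF F2 b]) (simp add: q_def algebra_simps)
    qed
  qed
  have "(\<Sum>j\<in>UNIV. p j z - q j z) = complex_of_real (poisson_kernel z \<zeta> * green_density \<phi> \<phi>1 \<phi>2 f z)" for z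
  proof -
    \<comment> \<open>Harmonicity is available only inside the ball; elsewhere the factor \<Phi> is
      0.\<close>
    have B0: "\<Phi> z * (\<Sum>j\<in>UNIV. B j z) = 0"
    proof (cases "z \<in> ball 0 1")
      case True
      then show ?thesis unfolding B_def by (simp add: poisson_harmonic[OF \<zeta>])
    next
      case False
      then have "b \<le> (norm z)\<^sup>2" using b one_le_power[of "norm z" 2] unfolding mem_ball dist_0_norm not_less by linarith
      then show ?thesis using supp by (simp add: \<Phi>_def)
    qed
    have zz: "(\<Sum>j\<in>UNIV. cnj (z $ j) * z $ j) = of_real ((norm z)\<^sup>2)"
      unfolding norm_sq_vec by (simp add: complex_norm_square mult.commute flip: of_real_power)
    have gg: "(\<Sum>j\<in>UNIV. g j z * cnj (g j z)) = of_real (grad_sq f z)"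
      unfolding grad_sq_def g_def by (simp add: complex_norm_square flip: of_real_power)
    have e: "(\<Sum>j\<in>UNIV. z $ j * g j z) = euler_deriv f z" unfolding euler_deriv_def g_def ..
    have "(\<Sum>j\<in>UNIV. p j z - q j z) =
      P z * (\<Phi>2 z * (\<Sum>j\<in>UNIV. cnj (z $ j) * z $ j) * (f z * cnj (f z)) + of_nat CARD('d) * (\<Phi>1 z * (f z * cnj (f z))) +
      \<Phi>1 z * ((\<Sum>j\<in>UNIV. z $ j * g j z) * cnj (f z)) + \<Phi>1 z * (cnj (\<Sum>j\<in>UNIV. z $ j * g j z) * f z) + \<Phi> z * (\<Sum>j\<in>UNIV. g j z * cnj (g j z)))
      - (\<Phi> z * (\<Sum>j\<in>UNIV. B j z)) * (f z * cnj (f z))"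
      unfolding p_def q_def
      by (simp add: sum.distrib sum_subtractf sum_distrib_left sum_distrib_right algebra_simps)
    also have "\<dots> = P z * (\<Phi>2 z * of_real ((norm z)\<^sup>2) * (f z * cnj (f z)) + of_nat CARD('d) * (\<Phi>1 z * (f z * cnj (f z))) +
      \<Phi>1 z * (cnj (f z) * euler_deriv f z + cnj (cnj (f z) * euler_deriv f z)) + \<Phi> z * of_real (grad_sq f z))"
      unfolding B0 zz gg e by (simp add: algebra_simps)
    also have "cnj (f z) * euler_deriv f z + cnj (cnj (f z) * euler_deriv f z) = of_real (2 * Re (cnj (f z) * euler_deriv f z))"
      by (rule complex_add_cnj)
    finally show ?thesis
      unfolding green_density_def radial_term_def P_def \<Phi>_def \<Phi>1_def \<Phi>2_def complex_norm_square[symmetric]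
      by (simp add: algebra_simps)
  qed
  then have "complex_of_real (\<integral>z. poisson_kernel z \<zeta> * green_density \<phi> \<phi>1 \<phi>2 f z \<partial>lborel) = (\<integral>z. (\<Sum>j\<in>UNIV. p j z - q j z) \<partial>lborel)"
    by (simp flip: integral_complex_of_real)
  also have "\<dots> = 0" using pq by (simp add: Bochner_Integration.integral_sum Bochner_Integration.integral_diff)
  finally show ?thesis by simp
qed

section \<open>Cutoff functions\<close>

lemma emeasure_unit_ball: "emeasure lborel (ball (0::complex ^ 'd::finite) 1) = ennreal (measure lborel (ball (0::complex ^ 'd) 1))"
  using emeasure_unit_ball_pos(3)[where 'd='d] by (simp add: emeasure_eq_ennreal_measure)

lemma finite_measure_ball_volume: "finite_measure (ball_volume :: (complex ^ 'd::finite) measure)"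
  by (rule finite_measureI) (simp add: emeasure_ball_volume_space del: space_ball_volume)

lemma measurable_ball_volume_id [measurable]: "(\<lambda>x. x) \<in> (ball_volume :: (complex ^ 'd::finite) measure) \<rightarrow>\<^sub>M borel"
  by (simp add: measurable_cong_sets[OF sets_ball_volume refl] measurable_restrict_space1)

lemma continuous_on_ball_measurable:
  "continuous_on (ball 0 1) g \<Longrightarrow> g \<in> borel_measurable (ball_volume :: (complex ^ 'd::finite) measure)"
  by (subst measurable_cong_sets[OF sets_ball_volume refl]) (rule borel_measurable_continuous_on_restrict)

lemma integral_ball_volume_eq_0:
  fixes h :: "complex ^ 'd::finite \<Rightarrow> real"
  assumes h: "h \<in> borel_measurable borel" and 0: "\<And>z. z \<notin> ball 0 1 \<Longrightarrow> h z = 0" and "integral\<^sup>L lborel h = 0"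
  shows "integral\<^sup>L ball_volume h = 0"
proof -
  define c where "c = measure lborel (ball (0::complex ^ 'd) 1)"
  have c: "c > 0" unfolding c_def by (rule content_ball_pos) simp
  have ind: "indicator (ball 0 1) z *\<^sub>R h z = h z" for z using 0[of z] by (auto simp: indicator_def)
  have "integral\<^sup>L ball_volume h = (\<integral>z. indicator (ball 0 1) z *\<^sub>R h z \<partial>uniform_measure lborel (ball 0 1))"
    unfolding ball_volume_def by (rule integral_restrict_space) simp
  also have "\<dots> = integral\<^sup>L (density lborel (\<lambda>z. ennreal (indicator (ball 0 1) z / c))) h"
  proof -
    have "uniform_measure lborel (ball (0 :: complex ^ 'd) 1) = density lborel (\<lambda>z. ennreal (indicator (ball 0 1) z / c))"
      unfolding uniform_measure_def emeasure_unit_ball c_def[symmetric] using c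
      by (intro density_cong) (auto simp: indicator_def divide_ennreal[symmetric])
    then show ?thesis by (simp only: ind)
  qed
  also have "\<dots> = (\<integral>z. (indicator (ball 0 1) z / c) *\<^sub>R h z \<partial>lborel)"
    by (rule integral_density) (use h c in \<open>auto intro!: borel_measurable_divide borel_measurable_indicator\<close>)
  also have "\<dots> = (\<integral>z. (1 / c) * h z \<partial>lborel)"
    by (rule Bochner_Integration.integral_cong[OF refl]) (use ind in \<open>auto simp: divide_simps\<close>)
  finally show ?thesis using assms(3) by simp
qed

lemma euler_deriv_bound:
  fixes f :: "complex ^ 'd::finite \<Rightarrow> complex"
  shows "(cmod (euler_deriv f z))\<^sup>2 \<le> (norm z)\<^sup>2 * grad_sq f z"
proof -
  have "cmod (euler_deriv f z) \<le> (\<Sum>j\<in>UNIV. cmod (z $ j) * cmod (partial_deriv j f z))"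
    unfolding euler_deriv_def by (rule order_trans[OF norm_sum]) (simp add: norm_mult)
  then have "(cmod (euler_deriv f z))\<^sup>2 \<le> (\<Sum>j\<in>UNIV. cmod (z $ j) * cmod (partial_deriv j f z))\<^sup>2"
    by (intro power_mono) auto
  also have "\<dots> \<le> (\<Sum>j\<in>UNIV. (cmod (z $ j))\<^sup>2) * (\<Sum>j\<in>UNIV. (cmod (partial_deriv j f z))\<^sup>2)"
    by (rule Cauchy_Schwarz_ineq_sum)
  finally show ?thesis by (simp add: norm_sq_vec grad_sq_def)
qed

lemma grad_sq_nonneg: "0 \<le> grad_sq f z"
  by (auto simp: grad_sq_def intro: sum_nonneg)

text \<open>Young's inequality for the mixed term, balanced so that only a quarter of |f|^2 is
  spent, little enough to be absorbed in \<open>green_density_lower_bound\<close>, while the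
  gradient keeps the factor \<open>r\<^sup>2\<close>.\<close>

lemma radial_term_bound:
  fixes f :: "complex ^ 'd::finite \<Rightarrow> complex"
  assumes z: "z \<in> ball 0 1" and r: "0 \<le> r"
  shows "r * \<bar>radial_term f z\<bar> \<le> r * CARD('d) * (cmod (f z))\<^sup>2 + (cmod (f z))\<^sup>2 / 4 + 4 * r\<^sup>2 * grad_sq f z"
proof -
  have "(norm z)\<^sup>2 \<le> 1" using z by (simp add: power_le_one)
  then have "(norm z)\<^sup>2 * grad_sq f z \<le> 1 * grad_sq f z" by (intro mult_right_mono grad_sq_nonneg) auto
  with euler_deriv_bound[of f z] have e: "(cmod (euler_deriv f z))\<^sup>2 \<le> grad_sq f z" by linarith
  have "\<bar>Re (cnj (f z) * euler_deriv f z)\<bar> \<le> cmod (f z) * cmod (euler_deriv f z)"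
    using abs_Re_le_cmod[of "cnj (f z) * euler_deriv f z"] by (simp add: norm_mult)
  then have "\<bar>radial_term f z\<bar> \<le> CARD('d) * (cmod (f z))\<^sup>2 + 2 * (cmod (f z) * cmod (euler_deriv f z))"
    unfolding radial_term_def by (intro order_trans[OF abs_triangle_ineq] add_mono) (auto simp: abs_mult)
  then have "r * \<bar>radial_term f z\<bar> \<le> r * (CARD('d) * (cmod (f z))\<^sup>2 + 2 * (cmod (f z) * cmod (euler_deriv f z)))"
    by (intro mult_left_mono r)
  moreover have "0 \<le> (cmod (f z) / 2 - 2 * r * cmod (euler_deriv f z))\<^sup>2" by simp
  then have "2 * r * (cmod (f z) * cmod (euler_deriv f z)) \<le> (cmod (f z))\<^sup>2 / 4 + 4 * r\<^sup>2 * (cmod (euler_deriv f z))\<^sup>2"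
    by (simp add: power2_diff power_mult_distrib power_divide algebra_simps)
  moreover have "4 * r\<^sup>2 * (cmod (euler_deriv f z))\<^sup>2 \<le> 4 * r\<^sup>2 * grad_sq f z"
    using e by (intro mult_left_mono) auto
  ultimately show ?thesis by (simp add: algebra_simps)
qed

text \<open>Truncated powers: the cube is the first one that is twice continuously differentiable,
  as Green's formula requires of its test function.\<close>

definition pos_pow :: "nat \<Rightarrow> real \<Rightarrow> real" where
  "pos_pow n x = (max 0 x) ^ n"

lemma pos_pow_simps: "0 \<le> x \<Longrightarrow> pos_pow n x = x ^ n" "x \<le> 0 \<Longrightarrow> 0 < n \<Longrightarrow> pos_pow n x = 0"
  by (simp_all add: pos_pow_def max_def power_0_left)

lemma pos_pow_has_derivative:
  assumes "n \<ge> 1"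
  shows "(pos_pow (Suc n) has_real_derivative real (Suc n) * pos_pow n x) (at x)"
proof (cases "x = 0")
  case True
  have "((\<lambda>h. pos_pow n h) \<longlongrightarrow> pos_pow n 0) (at 0)"
    unfolding pos_pow_def by (intro tendsto_intros)
  moreover have "pos_pow n 0 = 0" using assms by (simp add: pos_pow_simps)
  \<comment> \<open>At 0 the difference quotient of \<open>pos_pow (Suc n)\<close> is
    \<open>pos_pow n h\<close> itself, on either side.\<close>
  moreover have "\<forall>\<^sub>F h in at 0. pos_pow n h = (pos_pow (Suc n) (x + h) - pos_pow (Suc n) x) / h"
    using assms True by (auto simp: eventually_at_filter pos_pow_def max_def)
  ultimately have "((\<lambda>h. (pos_pow (Suc n) (x + h) - pos_pow (Suc n) x) / h) \<longlongrightarrow> 0) (at 0)"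
    using Lim_transform_eventually by fastforce
  then show ?thesis using True \<open>pos_pow n 0 = 0\<close> by (simp add: DERIV_def)
next
  case False
  show ?thesis
  proof (cases "x > 0")
    case True
    have "((\<lambda>x. x ^ Suc n) has_real_derivative real (Suc n) * x ^ n) (at x)"
      by (rule derivative_eq_intros refl | simp)+
    then have "(pos_pow (Suc n) has_real_derivative real (Suc n) * x ^ n) (at x)"
      by (rule has_field_derivative_transform_within_open[of _ _ _ "{0<..}"]) (use True in \<open>auto simp: pos_pow_simps\<close>)
    then show ?thesis using True by (simp add: pos_pow_simps)
  next
    case False
    have "(pos_pow (Suc n) has_real_derivative 0) (at x)"
      by (rule has_field_derivative_transform_within_open[of "\<lambda>_. 0" _ _ "{..<0}"])
         (use False \<open>x \<noteq> 0\<close> in \<open>auto simp: pos_pow_simps\<close>)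
    then show ?thesis using False assms by (simp add: pos_pow_simps)
  qed
qed

text \<open>Primitives, vanishing for \<open>x \<ge> b\<close>, of twice the cutoff function that is 1 below \<open>a\<close> and linear
  between \<open>a\<close> and \<open>b\<close>.\<close>
definition cutoff :: "real \<Rightarrow> real \<Rightarrow> real \<Rightarrow> real" where
  "cutoff a b x = (pos_pow 1 (b - x) - pos_pow 1 (a - x)) / (b - a)"

definition cutoff1 :: "real \<Rightarrow> real \<Rightarrow> real \<Rightarrow> real" where
  "cutoff1 a b x = - (pos_pow 2 (b - x) - pos_pow 2 (a - x)) / (b - a)"

definition cutoff2 :: "real \<Rightarrow> real \<Rightarrow> real \<Rightarrow> real" where
  "cutoff2 a b x = (pos_pow 3 (b - x) - pos_pow 3 (a - x)) / (3 * (b - a))"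

lemma pos_pow_minus_has_derivative:
  "n \<ge> 1 \<Longrightarrow> ((\<lambda>x. pos_pow (Suc n) (c - x)) has_real_derivative - (real (Suc n) * pos_pow n (c - x))) (at x)"
proof -
  assume "n \<ge> 1"
  moreover have "((\<lambda>x. c - x) has_real_derivative - 1) (at x)" by (auto intro!: derivative_eq_intros)
  ultimately have "((\<lambda>x. pos_pow (Suc n) (c - x)) has_real_derivative real (Suc n) * pos_pow n (c - x) * - 1) (at x)"
    by (intro DERIV_chain2[where f = "pos_pow (Suc n)"] pos_pow_has_derivative)
  then show ?thesis by simp
qed

lemma cutoff_derivs:
  assumes "a < b"
  shows "(cutoff2 a b has_real_derivative cutoff1 a b x) (at x)"
    "(cutoff1 a b has_real_derivative 2 * cutoff a b x) (at x)"
    "continuous_on UNIV (\<lambda>x. 2 * cutoff a b x)"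
    "b \<le> x \<Longrightarrow> cutoff2 a b x = 0 \<and> cutoff1 a b x = 0 \<and> 2 * cutoff a b x = 0"
proof -
  have d3: "((\<lambda>x. pos_pow 3 (c - x)) has_real_derivative - (3 * pos_pow 2 (c - x))) (at x)" for c
    using pos_pow_minus_has_derivative[of 2 c x] by simp
  have d2: "((\<lambda>x. pos_pow 2 (c - x)) has_real_derivative - (2 * pos_pow 1 (c - x))) (at x)" for c
    using pos_pow_minus_has_derivative[of 1 c x] by (simp add: numeral_2_eq_2)
  have "(- (3 * pos_pow 2 (b - x)) - - (3 * pos_pow 2 (a - x))) / (3 * (b - a)) = cutoff1 a b x"
    using assms by (simp add: cutoff1_def divide_simps) (simp add: algebra_simps)
  with DERIV_cdivide[OF DERIV_diff[OF d3[of b] d3[of a]], of "3 * (b - a)"]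
  show "(cutoff2 a b has_real_derivative cutoff1 a b x) (at x)"
    unfolding cutoff2_def[abs_def] by (simp only:)
  show "(cutoff1 a b has_real_derivative 2 * cutoff a b x) (at x)"
    using DERIV_cdivide[OF DERIV_minus[OF DERIV_diff[OF d2[of b] d2[of a]]], of "b - a"]
    unfolding cutoff1_def[abs_def] cutoff_def by (simp add: right_diff_distrib)
  show "continuous_on UNIV (\<lambda>x. 2 * cutoff a b x)"
    unfolding cutoff_def pos_pow_def using assms by (intro continuous_intros) auto
qed (use assms in \<open>auto simp: cutoff2_def cutoff1_def cutoff_def pos_pow_simps\<close>)

text \<open>With the positive parts \<open>u\<close> and \<open>v\<close>, the differences of
  squares and of cubes both contain the factor \<open>(u - v) / (b - a)\<close>, which is the cutoff
  itself; \<open>u\<close> and \<open>v\<close> are at most \<open>1 - x\<close>. Bounds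
  proportional to the cutoff are what allows the first-order term to be absorbed by the second-order
  one.\<close>

lemma cutoff_bounds:
  assumes "a < b" "b \<le> 1" "x \<le> 1"
  shows "0 \<le> cutoff a b x" "cutoff a b x \<le> 1"
    "0 \<le> - cutoff1 a b x" "- cutoff1 a b x \<le> 2 * (1 - x) * cutoff a b x"
    "0 \<le> cutoff2 a b x" "cutoff2 a b x \<le> (1 - x)\<^sup>2 * cutoff a b x"
proof -
  define u v where "u = max 0 (b - x)" and "v = max 0 (a - x)"
  have uv: "0 \<le> v" "v \<le> u" "u - v \<le> b - a" "u \<le> 1 - x" "v \<le> 1 - x" using assms by (auto simp: u_def v_def)
  define D where "D = b - a"
  have e: "cutoff a b x = (u - v) / (b - a)" "- cutoff1 a b x = (u + v) * ((u - v) / (b - a))"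
    "cutoff2 a b x = (u\<^sup>2 + u * v + v\<^sup>2) / 3 * ((u - v) / (b - a))"
    unfolding cutoff_def cutoff1_def cutoff2_def pos_pow_def u_def[symmetric] v_def[symmetric] D_def[symmetric]
    by (simp_all add: power2_eq_square power3_eq_cube algebra_simps add_divide_distrib diff_divide_distrib)
  show t: "0 \<le> cutoff a b x" "cutoff a b x \<le> 1" using uv assms unfolding e by auto
  show "0 \<le> - cutoff1 a b x" using uv assms unfolding e by auto
  show "0 \<le> cutoff2 a b x" using uv assms unfolding e by (intro mult_nonneg_nonneg) auto
  show "- cutoff1 a b x \<le> 2 * (1 - x) * cutoff a b x"
    unfolding e(2) e(1)[symmetric] using uv t by (intro mult_right_mono) auto
  have "u\<^sup>2 \<le> (1 - x)\<^sup>2" "v\<^sup>2 \<le> (1 - x)\<^sup>2" "u * v \<le> (1 - x)\<^sup>2"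
    using uv by (auto simp: power2_eq_square intro!: mult_mono)
  then show "cutoff2 a b x \<le> (1 - x)\<^sup>2 * cutoff a b x"
    unfolding e(3) e(1)[symmetric] using t by (intro mult_right_mono) auto
qed

lemma cutoff_below:
  assumes "a < b" "x \<le> a"
  shows "cutoff a b x = 1" "cutoff1 a b x = - (a + b - 2 * x)" "cutoff2 a b x = ((a - x)\<^sup>2 + (a - x) * (b - x) + (b - x)\<^sup>2) / 3"
proof -
  have *: "0 \<le> a - x" "0 \<le> b - x" "b - a \<noteq> 0" using assms by auto
  show "cutoff a b x = 1" "cutoff1 a b x = - (a + b - 2 * x)" "cutoff2 a b x = ((a - x)\<^sup>2 + (a - x) * (b - x) + (b - x)\<^sup>2) / 3"
    using * by (simp_all add: cutoff_def cutoff1_def cutoff2_def pos_pow_simps divide_simps)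
      (simp_all add: power2_eq_square power3_eq_cube algebra_simps)
qed

lemma surface_space_measurable:
  assumes "sets \<mu> = sets (surface_measure :: (complex ^ 'd::finite) measure)"
  shows "space \<mu> = sphere 0 1" "(\<lambda>x. x) \<in> \<mu> \<rightarrow>\<^sub>M borel"
proof -
  have ss: "sets \<mu> = sets (restrict_space borel (sphere 0 1))"
    using assms by (simp add: surface_measure_def sets_restrict_space)
  show "space \<mu> = sphere 0 1" using sets_eq_imp_space_eq[OF ss] by (simp add: space_restrict_space)
  show "(\<lambda>x. x) \<in> \<mu> \<rightarrow>\<^sub>M borel" by (simp add: measurable_cong_sets[OF ss refl] measurable_restrict_space1)
qed

text \<open>The pole stays at distance at least \<open>1 - sqrt b\<close>.\<close>

lemma poisson_kernel_bound:
  fixes z \<zeta> :: "complex ^ 'd::finite"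
  assumes "\<zeta> \<in> sphere 0 1" "(norm z)\<^sup>2 \<le> b" "0 \<le> b" "b < 1"
  shows "\<bar>poisson_kernel z \<zeta>\<bar> \<le> 1 / (1 - sqrt b) ^ (2 * CARD('d))"
proof -
  have b: "sqrt b < 1" using assms by simp
  have z: "norm z \<le> sqrt b" using assms(2) real_le_rsqrt by blast
  have "norm \<zeta> \<le> norm (z - \<zeta>) + norm z" using norm_triangle_ineq4[of z "z - \<zeta>"] by simp
  then have d: "1 - sqrt b \<le> norm (z - \<zeta>)" using assms(1) z by simp
  have "\<bar>poisson_kernel z \<zeta>\<bar> = \<bar>1 - (norm z)\<^sup>2\<bar> / norm (z - \<zeta>) ^ (2 * CARD('d))"
    by (simp add: poisson_kernel_def)
  also have "\<dots> \<le> 1 / (1 - sqrt b) ^ (2 * CARD('d))"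
    using b d assms by (intro frac_le power_mono) (auto simp: abs_if)
  finally show ?thesis .
qed

section \<open>Cutoffs tending to 1\<close>

definition cut_a :: "nat \<Rightarrow> real" where "cut_a n = 1 - 2 / (real n + 2)"
definition cut_b :: "nat \<Rightarrow> real" where "cut_b n = 1 - 1 / (real n + 2)"

lemma cut_ab: "cut_a n < cut_b n" "0 \<le> cut_b n" "cut_b n < 1"
  by (auto simp: cut_a_def cut_b_def divide_simps)

lemma cut_lim: "cut_a \<longlonglongrightarrow> 1" "cut_b \<longlonglongrightarrow> 1"
proof -
  have "(\<lambda>n. 1 / (real n + 2)) \<longlonglongrightarrow> 0"
    by (rule tendsto_divide_0[OF tendsto_const])
       (intro filterlim_at_top_imp_at_infinity filterlim_tendsto_add_at_top[OF tendsto_const filterlim_real_sequentially, of 2, unfolded add.commute[of 2]])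
  then have *: "(\<lambda>n. c * (1 / (real n + 2))) \<longlonglongrightarrow> 0" for c using tendsto_mult_right_zero by blast
  show "cut_a \<longlonglongrightarrow> 1" "cut_b \<longlonglongrightarrow> 1"
    unfolding cut_a_def[abs_def] cut_b_def[abs_def]
    using tendsto_diff[OF tendsto_const *[of 2], of 1] tendsto_diff[OF tendsto_const *[of 1], of 1] by simp_all
qed

text \<open>Eventually \<open>x \<le> cut_a n\<close>, where the polynomials of
  \<open>cutoff_below\<close> apply. The limits are (1 - x)^2, its first derivative and, after
  doubling the cutoff, its second derivative.\<close>

lemma cutoff_limits:
  assumes "x < 1"
  shows "(\<lambda>n. cutoff (cut_a n) (cut_b n) x) \<longlonglongrightarrow> 1"
    "(\<lambda>n. cutoff1 (cut_a n) (cut_b n) x) \<longlonglongrightarrow> - (2 * (1 - x))"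
    "(\<lambda>n. cutoff2 (cut_a n) (cut_b n) x) \<longlonglongrightarrow> (1 - x)\<^sup>2"
proof -
  have ev: "\<forall>\<^sub>F n in sequentially. x \<le> cut_a n"
    using order_tendstoD(1)[OF cut_lim(1) assms] by eventually_elim simp
  show "(\<lambda>n. cutoff (cut_a n) (cut_b n) x) \<longlonglongrightarrow> 1"
    by (rule tendsto_eventually) (use ev in \<open>eventually_elim, simp add: cutoff_below cut_ab\<close>)
  have "(\<lambda>n. - (cut_a n + cut_b n - 2 * x)) \<longlonglongrightarrow> - (1 + 1 - 2 * x)"
    by (intro tendsto_intros cut_lim)
  then show "(\<lambda>n. cutoff1 (cut_a n) (cut_b n) x) \<longlonglongrightarrow> - (2 * (1 - x))"
    by (rule Lim_transform_eventually[THEN tendsto_eq_rhs]) (use ev in \<open>eventually_elim, simp add: cutoff_below cut_ab\<close>, simp)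
  have "(\<lambda>n. ((cut_a n - x)\<^sup>2 + (cut_a n - x) * (cut_b n - x) + (cut_b n - x)\<^sup>2) / 3) \<longlonglongrightarrow> ((1 - x)\<^sup>2 + (1 - x) * (1 - x) + (1 - x)\<^sup>2) / 3"
    by (intro tendsto_intros cut_lim) simp
  then show "(\<lambda>n. cutoff2 (cut_a n) (cut_b n) x) \<longlonglongrightarrow> (1 - x)\<^sup>2"
    by (rule Lim_transform_eventually[THEN tendsto_eq_rhs]) (use ev in \<open>eventually_elim, simp add: cutoff_below cut_ab\<close>, simp add: power2_eq_square)
qed

text \<open>Chosen so that \<open>(d + 1) * (1 - x) \<le> 1 / 4\<close> for \<open>x\<close> above it.\<close>
definition inner_radius :: "nat \<Rightarrow> real" where
  "inner_radius d = 1 - 1 / (4 * (real d + 1))"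

lemma inner_radius_bounds: "0 \<le> inner_radius d" "inner_radius d < 1"
  by (auto simp: inner_radius_def divide_simps)

text \<open>With \<open>t\<close> the cutoff, the second-order term contributes
  \<open>2 * t * s * u\<close>, and the radial term costs at most
  \<open>2 * t * ((1 - s) * d * u + u / 4 + 4 * G)\<close>. Near the sphere
  \<open>(d + 1) * (1 - s) \<le> 1 / 4\<close>, so a surplus of at least \<open>t * u\<close>
  remains. Farther in, \<open>M\<close> pays the deficit, and \<open>8 * G\<close> pays for the
  gradient everywhere.\<close>

lemma green_density_lower_bound:
  fixes f :: "complex ^ 'd::finite \<Rightarrow> complex"
  assumes z: "z \<in> ball 0 1" and ab: "a < b" "b < 1"
    and M: "(norm z)\<^sup>2 \<le> inner_radius CARD('d) \<Longrightarrow> (cmod (f z))\<^sup>2 \<le> M"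
  shows "cutoff a b ((norm z)\<^sup>2) * (cmod (f z))\<^sup>2 \<le> green_density (cutoff2 a b) (cutoff1 a b) (\<lambda>x. 2 * cutoff a b x) f z
     + 8 * grad_sq f z + 2 * (real CARD('d) + 1) * (if (norm z)\<^sup>2 \<le> inner_radius CARD('d) then M else 0)"
proof -
  define s where "s = (norm z)\<^sup>2"
  define u where "u = (cmod (f z))\<^sup>2"
  define G where "G = grad_sq f z"
  define t where "t = cutoff a b s"
  define d where "d = real CARD('d)"
  define M' where "M' = (if s \<le> inner_radius CARD('d) then M else 0)"
  have s: "0 \<le> s" "s \<le> 1" using z by (auto simp: s_def power_le_one)
  note c = cutoff_bounds[OF ab(1) less_imp_le[OF ab(2)] s(2)]
  have u: "0 \<le> u" and G: "0 \<le> G" and d: "1 \<le> d"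
    by (simp_all add: u_def G_def grad_sq_nonneg d_def Suc_le_eq)
  have t: "0 \<le> t" "t \<le> 1" using c unfolding t_def by auto
  have uM: "M' \<ge> (if s \<le> inner_radius CARD('d) then u else 0)" using M unfolding M'_def s_def u_def by auto
  have "- cutoff1 a b s * \<bar>radial_term f z\<bar> \<le> 2 * (1 - s) * t * \<bar>radial_term f z\<bar>"
    using c(4) unfolding t_def by (intro mult_right_mono) auto
  also have "\<dots> = 2 * t * ((1 - s) * \<bar>radial_term f z\<bar>)" by simp
  also have "\<dots> \<le> 2 * t * ((1 - s) * d * u + u / 4 + 4 * (1 - s)\<^sup>2 * G)"
    using radial_term_bound[OF z, of "1 - s" f] s t unfolding d_def u_def G_def by (intro mult_left_mono) auto
  also have "\<dots> \<le> 2 * t * ((1 - s) * d * u + u / 4 + 4 * 1 * G)"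
    using s t G by (intro mult_left_mono add_left_mono mult_right_mono) (auto simp: power_le_one)
  finally have 1: "cutoff1 a b s * radial_term f z \<ge> - (2 * t * ((1 - s) * d * u + u / 4 + 4 * G))"
    using c(3) abs_ge_self[of "- cutoff1 a b s * radial_term f z"] abs_ge_minus_self[of "- cutoff1 a b s * radial_term f z"]
    by (simp add: abs_mult)
  have 2: "2 * t * (s * u - ((1 - s) * d * u + u / 4)) \<ge> 2 * t * (u / 2 - (d + 1) * M')"
  proof (intro mult_left_mono)
    show "u / 2 - (d + 1) * M' \<le> s * u - ((1 - s) * d * u + u / 4)"
    proof (cases "s \<le> inner_radius CARD('d)")
      case True
      have "(d + 1) * (1 - s) \<le> (d + 1) * 1" using d s by (intro mult_left_mono) auto
      then have "- (d + 1) * u \<le> (- ((d + 1) * (1 - s))) * u" using u by (intro mult_right_mono) auto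
      moreover have "(d + 1) * u \<le> (d + 1) * M'" using uM True d by (intro mult_left_mono) auto
      ultimately show ?thesis using u by (simp add: algebra_simps)
    next
      case False
      then have "1 - s \<le> 1 / (4 * (d + 1))" by (simp add: d_def inner_radius_def)
      then have "(d + 1) * (1 - s) \<le> 1 / 4" using d by (simp add: field_simps)
      then have "(d + 1) * (1 - s) * u \<le> 1 / 4 * u" using u by (intro mult_right_mono) auto
      then show ?thesis using False by (simp add: M'_def algebra_simps)
    qed
  qed (use t in auto)
  have "t * (8 * G) \<le> 1 * (8 * G)" using t G by (intro mult_right_mono) auto
  moreover have "2 * t * ((d + 1) * M') \<le> 2 * ((d + 1) * M')"
  proof -
    have "0 \<le> M'" using uM u by (auto split: if_splits)
    then have "t * ((d + 1) * M') \<le> 1 * ((d + 1) * M')" using t d by (intro mult_right_mono) auto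
    then show ?thesis by simp
  qed
  moreover have "0 \<le> cutoff2 a b s * G" using c G by auto
  ultimately show ?thesis
    using 1 2 unfolding green_density_def s_def[symmetric] u_def[symmetric] G_def[symmetric] t_def[symmetric] d_def[symmetric] M'_def[symmetric]
    by (simp add: algebra_simps d_def)
qed

lemma power_series_continuous_on:
  assumes "power_series_on_ball f a"
  shows "continuous_on (ball 0 1) f" "continuous_on (ball 0 1) (partial_deriv j f)"
    "continuous_on (ball 0 1) (grad_sq f)" "continuous_on (ball 0 1) (radial_term f)"
proof -
  show f: "continuous_on (ball 0 1) f"
    by (rule holomorphic_on_ball_continuous_on[OF power_series_holomorphic[OF assms]])
  show g: "continuous_on (ball 0 1) (partial_deriv j f)" for j
    by (rule holomorphic_on_ball_continuous_on[OF power_series_holomorphic[OF power_series_partial_deriv_series[OF assms]]])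
  show "continuous_on (ball 0 1) (grad_sq f)" unfolding grad_sq_def[abs_def] by (intro continuous_intros g)
  show "continuous_on (ball 0 1) (radial_term f)"
    unfolding radial_term_def[abs_def] euler_deriv_def by (intro continuous_intros f g)
qed

lemma power_series_measurable:
  assumes "power_series_on_ball f a"
  shows "f \<in> borel_measurable ball_volume" "partial_deriv j f \<in> borel_measurable ball_volume"
    "grad_sq f \<in> borel_measurable ball_volume" "radial_term f \<in> borel_measurable ball_volume"
  by (intro continuous_on_ball_measurable power_series_continuous_on[OF assms])+

section \<open>Multiplication by the coordinates\<close>

lemma partial_deriv_add:
  assumes "holomorphic_on_ball f" "holomorphic_on_ball g" "z \<in> ball 0 1"
  shows "partial_deriv j (\<lambda>z. f z + g z) z = partial_deriv j f z + partial_deriv j g z"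
  unfolding partial_deriv_def[of _ "\<lambda>z. f z + g z"]
  by (rule DERIV_imp_deriv[OF DERIV_add[OF holomorphic_on_ball_DERIV[OF assms(1,3)] holomorphic_on_ball_DERIV[OF assms(2,3)]]])

lemma partial_deriv_diff:
  assumes "holomorphic_on_ball f" "holomorphic_on_ball g" "z \<in> ball 0 1"
  shows "partial_deriv j (\<lambda>z. f z - g z) z = partial_deriv j f z - partial_deriv j g z"
  unfolding partial_deriv_def[of _ "\<lambda>z. f z - g z"]
  by (rule DERIV_imp_deriv[OF DERIV_diff[OF holomorphic_on_ball_DERIV[OF assms(1,3)] holomorphic_on_ball_DERIV[OF assms(2,3)]]])

lemma partial_deriv_cmult:
  assumes "holomorphic_on_ball f" "z \<in> ball 0 1"
  shows "partial_deriv j (\<lambda>z. c * f z) z = c * partial_deriv j f z"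
  unfolding partial_deriv_def[of _ "\<lambda>z. c * f z"]
  by (rule DERIV_imp_deriv[OF DERIV_cmult[OF holomorphic_on_ball_DERIV[OF assms]]])

lemma partial_deriv_coord_mult:
  assumes "holomorphic_on_ball f" "z \<in> ball 0 1"
  shows "partial_deriv k (coord_mult j f) z = (if k = j then f z else 0) + z $ j * partial_deriv k f z"
proof -
  have "((\<lambda>t. (z + axis k t) $ j) has_field_derivative (if k = j then 1 else 0)) (at 0)"
    by (auto simp: axis_def intro!: derivative_eq_intros)
  note D = DERIV_mult[OF this holomorphic_on_ball_DERIV[OF assms, of k]]
  have "(if k = j then 1 else 0) * f (z + axis k 0) + partial_deriv k f z * (z + axis k 0) $ j =
      (if k = j then f z else 0) + z $ j * partial_deriv k f z" by simp
  with D show ?thesis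
    unfolding coord_mult_def partial_deriv_def[of _ "\<lambda>z. z $ j * f z"]
    by (intro DERIV_imp_deriv) (simp only:)
qed

lemma cmod_add_sq: "(cmod (x + y))\<^sup>2 = (cmod x)\<^sup>2 + (cmod y)\<^sup>2 + 2 * Re (cnj x * y)"
  unfolding cmod_power2 by (simp add: power2_eq_square algebra_simps)

lemma cmod_add_sq_le: "(cmod (x + y))\<^sup>2 \<le> 2 * (cmod x)\<^sup>2 + 2 * (cmod y)\<^sup>2"
proof -
  have "0 \<le> (cmod (x - y))\<^sup>2" by simp
  then show ?thesis unfolding cmod_power2 by (simp add: power2_eq_square algebra_simps)
qed

lemma cmod_diff_sq_le: "(cmod (x - y))\<^sup>2 \<le> 2 * (cmod x)\<^sup>2 + 2 * (cmod y)\<^sup>2"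
  using cmod_add_sq_le[of x "- y"] by simp

lemma grad_sq_cmult:
  assumes "holomorphic_on_ball f" "z \<in> ball 0 1"
  shows "grad_sq (\<lambda>z. c * f z) z = (cmod c)\<^sup>2 * grad_sq f z"
  unfolding grad_sq_def partial_deriv_cmult[OF assms] by (simp add: norm_mult power_mult_distrib sum_distrib_left)

text \<open>Reduces the energy of the product to the energy of \<open>f\<close> and its weighted
  mass.\<close>

lemma grad_sq_coord_mult_le:
  assumes "holomorphic_on_ball f" "z \<in> ball 0 1"
  shows "grad_sq (coord_mult j f) z \<le> 2 * (cmod (f z))\<^sup>2 + 2 * grad_sq f z"
proof -
  have "cmod (z $ j) \<le> 1" using assms(2) Finite_Cartesian_Product.norm_nth_le[of z j] by simp
  then have zj: "(cmod (z $ j))\<^sup>2 \<le> 1" by (simp add: power_le_one)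
  have "grad_sq (coord_mult j f) z \<le> (\<Sum>k\<in>UNIV. 2 * (if k = j then (cmod (f z))\<^sup>2 else 0) + 2 * (cmod (partial_deriv k f z))\<^sup>2)"
    unfolding grad_sq_def partial_deriv_coord_mult[OF assms]
  proof (rule sum_mono)
    fix k
    have "(cmod (z $ j))\<^sup>2 * (cmod (partial_deriv k f z))\<^sup>2 \<le> 1 * (cmod (partial_deriv k f z))\<^sup>2"
      using zj by (rule mult_right_mono) simp
    then have "(cmod (z $ j * partial_deriv k f z))\<^sup>2 \<le> (cmod (partial_deriv k f z))\<^sup>2"
      by (simp add: norm_mult power_mult_distrib)
    moreover have "(cmod (if k = j then f z else 0))\<^sup>2 = (if k = j then (cmod (f z))\<^sup>2 else 0)" by simp
    ultimately show "(cmod ((if k = j then f z else 0) + z $ j * partial_deriv k f z))\<^sup>2 \<le>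
        2 * (if k = j then (cmod (f z))\<^sup>2 else 0) + 2 * (cmod (partial_deriv k f z))\<^sup>2"
      using cmod_add_sq_le[of "if k = j then f z else 0" "z $ j * partial_deriv k f z"] by linarith
  qed
  also have "\<dots> = 2 * (cmod (f z))\<^sup>2 + 2 * grad_sq f z"
    by (simp add: sum.distrib sum_distrib_left[symmetric] grad_sq_def)
  finally show ?thesis .
qed

text \<open>A quarter of the Laplacian of ||z||^2 |f|^2, that is, the \<open>green_density\<close>
  for the identity in place of \<phi>.\<close>

lemma sum_grad_sq_coord_mult:
  fixes f :: "complex ^ 'd::finite \<Rightarrow> complex"
  assumes "holomorphic_on_ball f" "z \<in> ball 0 1"
  shows "(\<Sum>j\<in>UNIV. grad_sq (coord_mult j f) z) = radial_term f z + (norm z)\<^sup>2 * grad_sq f z"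
proof -
  have "(\<Sum>j\<in>UNIV. grad_sq (coord_mult j f) z) =
     (\<Sum>j\<in>(UNIV::'d set). \<Sum>k\<in>UNIV. (if k = j then (cmod (f z))\<^sup>2 + 2 * Re (cnj (f z) * (z $ j * partial_deriv k f z)) else 0)
        + (cmod (z $ j))\<^sup>2 * (cmod (partial_deriv k f z))\<^sup>2)"
    unfolding grad_sq_def partial_deriv_coord_mult[OF assms] cmod_add_sq
    by (intro sum.cong refl) (auto simp: norm_mult power_mult_distrib)
  also have "\<dots> = (\<Sum>j\<in>(UNIV::'d set). (cmod (f z))\<^sup>2 + 2 * Re (cnj (f z) * (z $ j * partial_deriv j f z)) + (cmod (z $ j))\<^sup>2 * grad_sq f z)"
    by (simp add: sum.distrib grad_sq_def sum_distrib_left)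
  also have "\<dots> = CARD('d) * (cmod (f z))\<^sup>2 + 2 * (\<Sum>j\<in>(UNIV::'d set). Re (cnj (f z) * (z $ j * partial_deriv j f z)))
      + (norm z)\<^sup>2 * grad_sq f z"
    unfolding sum.distrib norm_sq_vec sum_distrib_left sum_distrib_right by simp
  also have "(\<Sum>j\<in>(UNIV::'d set). Re (cnj (f z) * (z $ j * partial_deriv j f z))) = Re (cnj (f z) * euler_deriv f z)"
    unfolding euler_deriv_def sum_distrib_left Re_sum ..
  also have "CARD('d) * (cmod (f z))\<^sup>2 + 2 * Re (cnj (f z) * euler_deriv f z) + (norm z)\<^sup>2 * grad_sq f z =
      radial_term f z + (norm z)\<^sup>2 * grad_sq f z"
    by (simp add: radial_term_def)
  finally show ?thesis .
qed

lemma euler_deriv_coord_mult: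
  assumes "holomorphic_on_ball f" "z \<in> ball 0 1"
  shows "euler_deriv (coord_mult j f) z = z $ j * f z + z $ j * euler_deriv f z"
  unfolding euler_deriv_def partial_deriv_coord_mult[OF assms]
  by (simp add: distrib_left sum.distrib if_distrib[where f="\<lambda>x. _ * x"] sum_distrib_left mult_ac cong: if_cong)

text \<open>The Euler operator sends z_j f to z_j times the sum of f and its Euler derivative; this
  gives the additional 2 |f|^2.\<close>

lemma sum_radial_term_coord_mult:
  fixes f :: "complex ^ 'd::finite \<Rightarrow> complex"
  assumes "holomorphic_on_ball f" "z \<in> ball 0 1"
  shows "(\<Sum>j\<in>UNIV. radial_term (coord_mult j f) z) = (norm z)\<^sup>2 * radial_term f z + 2 * (norm z)\<^sup>2 * (cmod (f z))\<^sup>2"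
proof -
  have 1: "radial_term (coord_mult j f) z = (cmod (z $ j))\<^sup>2 * (radial_term f z + 2 * (cmod (f z))\<^sup>2)" for j
  proof -
    have "cnj (coord_mult j f z) * euler_deriv (coord_mult j f) z =
        (z $ j * cnj (z $ j)) * (f z * cnj (f z) + cnj (f z) * euler_deriv f z)"
      unfolding euler_deriv_coord_mult[OF assms] by (simp add: coord_mult_def algebra_simps)
    also have "\<dots> = of_real ((cmod (z $ j))\<^sup>2) * (of_real ((cmod (f z))\<^sup>2) + cnj (f z) * euler_deriv f z)"
      by (simp only: complex_norm_square)
    finally have "Re (cnj (coord_mult j f z) * euler_deriv (coord_mult j f) z) =
        (cmod (z $ j))\<^sup>2 * ((cmod (f z))\<^sup>2 + Re (cnj (f z) * euler_deriv f z))"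
      by (simp add: Re_complex_of_real del: of_real_power)
    then show ?thesis
      unfolding radial_term_def by (simp add: coord_mult_def norm_mult power_mult_distrib algebra_simps)
  qed
  show ?thesis unfolding 1 sum_distrib_right[symmetric] norm_sq_vec[symmetric] by (simp add: algebra_simps)
qed

text \<open>The right side is the \<open>green_density\<close> of (1 - x)^2, in the form in which
  the cutoffs approach it.\<close>

lemma grad_sq_second_difference:
  fixes f :: "complex ^ 'd::finite \<Rightarrow> complex"
  assumes f: "power_series_on_ball f a" and z: "z \<in> ball 0 1"
  shows "grad_sq f z - 2 * (\<Sum>j\<in>UNIV. grad_sq (coord_mult j f) z)
      + (\<Sum>j\<in>UNIV. \<Sum>i\<in>UNIV. grad_sq (coord_mult i (coord_mult j f)) z) =
    (1 - (norm z)\<^sup>2)\<^sup>2 * grad_sq f z - 2 * (1 - (norm z)\<^sup>2) * radial_term f z + 2 * (norm z)\<^sup>2 * (cmod (f z))\<^sup>2"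
proof -
  have h: "holomorphic_on_ball f" "holomorphic_on_ball (coord_mult j f)" for j
    by (rule power_series_holomorphic[OF f], rule power_series_holomorphic[OF power_series_coord_mult[OF f]])
  have "(\<Sum>j\<in>UNIV. \<Sum>i\<in>UNIV. grad_sq (coord_mult i (coord_mult j f)) z) =
      (norm z)\<^sup>2 * radial_term f z + 2 * (norm z)\<^sup>2 * (cmod (f z))\<^sup>2 + (norm z)\<^sup>2 * (radial_term f z + (norm z)\<^sup>2 * grad_sq f z)"
    unfolding sum_grad_sq_coord_mult[OF h(2) z] sum.distrib sum_radial_term_coord_mult[OF h(1) z] sum_distrib_left[symmetric]
      sum_grad_sq_coord_mult[OF h(1) z] ..
  then show ?thesis unfolding sum_grad_sq_coord_mult[OF h(1) z] by (simp add: power2_eq_square algebra_simps)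
qed

section \<open>The Dirichlet energy and square summable coefficient families\<close>

definition energy :: "(complex ^ 'd::finite) measure \<Rightarrow> (complex ^ 'd \<Rightarrow> complex) \<Rightarrow> ennreal" where
  "energy \<mu> f = (\<integral>\<^sup>+ z. ennreal (grad_sq f z * poisson_integral \<mu> z) \<partial>ball_volume)"

lemma dirichlet_norm_sq_eq: "dirichlet_norm_sq \<mu> f = hardy_norm_sq f + ennreal (1 / CARD('d)) * energy \<mu> (f :: complex ^ 'd::finite \<Rightarrow> complex)"
  by (simp add: dirichlet_norm_sq_def energy_def grad_sq_def)

lemma energy_le_dirichlet_norm_sq: "energy \<mu> f \<le> ennreal CARD('d) * dirichlet_norm_sq \<mu> (f :: complex ^ 'd::finite \<Rightarrow> complex)"
proof -
  have "energy \<mu> f = ennreal CARD('d) * (ennreal (1 / CARD('d)) * energy \<mu> f)"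
    by (simp add: mult.assoc[symmetric] ennreal_mult[symmetric])
  also have "\<dots> \<le> ennreal CARD('d) * dirichlet_norm_sq \<mu> f"
    unfolding dirichlet_norm_sq_eq by (intro mult_left_mono) auto
  finally show ?thesis .
qed

lemma dirichlet_space_iff:
  "f \<in> dirichlet_space \<mu> \<longleftrightarrow>
    (\<forall>z. z \<notin> ball 0 1 \<longrightarrow> f z = 0) \<and> (\<exists>a. power_series_on_ball f a) \<and> hardy_norm_sq f < \<infinity> \<and> energy \<mu> f < \<infinity>"
proof -
  have "dirichlet_norm_sq \<mu> f < \<infinity> \<longleftrightarrow> hardy_norm_sq f < \<infinity> \<and> energy \<mu> f < \<infinity>"
    unfolding dirichlet_norm_sq_eq by (auto simp: ennreal_mult_less_top less_top)
  then show ?thesis unfolding dirichlet_space_def using power_series_holomorphic by blast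
qed

lemma coeff_bounded_diff:
  assumes "coeff_bounded A a" "coeff_bounded B b"
  shows "coeff_bounded (2 * A + 2 * B) (\<lambda>\<alpha>. a \<alpha> - b \<alpha>)"
  unfolding coeff_bounded_def
proof (intro allI impI)
  fix F :: "('a \<Rightarrow> nat) set" assume F: "finite F"
  have "(\<Sum>\<alpha>\<in>F. (cmod (a \<alpha> - b \<alpha>))\<^sup>2 * hardy_weight \<alpha>) \<le>
      (\<Sum>\<alpha>\<in>F. (2 * (cmod (a \<alpha>))\<^sup>2 + 2 * (cmod (b \<alpha>))\<^sup>2) * hardy_weight \<alpha>)"
    by (intro sum_mono mult_right_mono cmod_diff_sq_le hardy_weight_nonneg)
  also have "\<dots> = 2 * (\<Sum>\<alpha>\<in>F. (cmod (a \<alpha>))\<^sup>2 * hardy_weight \<alpha>) + 2 * (\<Sum>\<alpha>\<in>F. (cmod (b \<alpha>))\<^sup>2 * hardy_weight \<alpha>)"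
    by (simp add: sum.distrib distrib_right sum_distrib_left mult.assoc)
  also have "\<dots> \<le> 2 * A + 2 * B" using assms F unfolding coeff_bounded_def by (intro add_mono mult_left_mono) auto
  finally show "(\<Sum>\<alpha>\<in>F. (cmod (a \<alpha> - b \<alpha>))\<^sup>2 * hardy_weight \<alpha>) \<le> 2 * A + 2 * B" .
qed

lemma coeff_bounded_cmult:
  assumes "coeff_bounded A a"
  shows "coeff_bounded ((cmod c)\<^sup>2 * A) (\<lambda>\<alpha>. c * a \<alpha>)"
  unfolding coeff_bounded_def norm_mult power_mult_distrib mult.assoc sum_distrib_left[symmetric]
  using assms unfolding coeff_bounded_def by (intro allI impI mult_left_mono) auto

lemma coeff_bounded_hardy_norm:
  assumes "power_series_on_ball f a" "hardy_norm_sq f < \<infinity>"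
  shows "coeff_bounded (enn2real (hardy_norm_sq f)) a"
  using coeff_bounded_iff_hardy_norm_sq[OF assms(1), of "enn2real (hardy_norm_sq f)"] assms(2) by simp

lemma hardy_norm_sq_finite:
  assumes "power_series_on_ball f a" "coeff_bounded B a"
  shows "hardy_norm_sq f < \<infinity>"
  using coeff_bounded_iff_hardy_norm_sq[OF assms(1) coeff_bounded_nonneg[OF assms(2)]] assms(2) le_less_trans by fastforce

lemma enn2real_le: "x \<le> ennreal y \<Longrightarrow> 0 \<le> y \<Longrightarrow> enn2real x \<le> y"
  using enn2real_mono[of x "ennreal y"] by simp

lemma coeff_bounded_point:
  assumes "coeff_bounded B a"
  shows "(cmod (a \<alpha>))\<^sup>2 * hardy_weight \<alpha> \<le> B"
  using assms[unfolded coeff_bounded_def, rule_format, of "{\<alpha>}"] by simp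

text \<open>Completeness of a weighted sequence space: each coefficient converges, and the bound
  survives the limit in every finite sum. One family \<open>l\<close> serves all \<open>e\<close>
  and \<open>N\<close>, so any Cauchy estimate carries over with the same constant.\<close>

lemma coeff_bounded_Cauchy_limit:
  fixes a :: "nat \<Rightarrow> ('d::finite \<Rightarrow> nat) \<Rightarrow> complex"
  assumes "\<And>e. e > 0 \<Longrightarrow> \<exists>N. \<forall>m\<ge>N. \<forall>n\<ge>N. coeff_bounded (e\<^sup>2) (\<lambda>\<alpha>. a m \<alpha> - a n \<alpha>)"
  obtains l where "\<And>e N n. (\<And>m n. m \<ge> N \<Longrightarrow> n \<ge> N \<Longrightarrow> coeff_bounded e (\<lambda>\<alpha>. a m \<alpha> - a n \<alpha>)) \<Longrightarrow> n \<ge> N \<Longrightarrow>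
     coeff_bounded e (\<lambda>\<alpha>. a n \<alpha> - l \<alpha>)"
proof -
  have "Cauchy (\<lambda>n. a n \<alpha>)" for \<alpha>
  proof (rule metric_CauchyI)
    fix e :: real assume e: "e > 0"
    define \<epsilon> where "\<epsilon> = e * sqrt (hardy_weight \<alpha>) / 2"
    have "\<epsilon> > 0" using e hardy_weight_pos[of \<alpha>] by (simp add: \<epsilon>_def)
    from assms[OF this] obtain N where N: "\<And>m n. m \<ge> N \<Longrightarrow> n \<ge> N \<Longrightarrow> coeff_bounded (\<epsilon>\<^sup>2) (\<lambda>\<alpha>. a m \<alpha> - a n \<alpha>)" by blast
    have "dist (a m \<alpha>) (a n \<alpha>) < e" if "m \<ge> N" "n \<ge> N" for m n
    proof -
      have "(cmod (a m \<alpha> - a n \<alpha>))\<^sup>2 * hardy_weight \<alpha> \<le> (e / 2)\<^sup>2 * hardy_weight \<alpha>"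
        using coeff_bounded_point[OF N[OF that], of \<alpha>] hardy_weight_nonneg[of \<alpha>]
        by (simp add: \<epsilon>_def power_mult_distrib power_divide)
      then have "(cmod (a m \<alpha> - a n \<alpha>))\<^sup>2 \<le> (e / 2)\<^sup>2" using hardy_weight_pos[of \<alpha>] by simp
      then have "cmod (a m \<alpha> - a n \<alpha>) \<le> e / 2" using e by (simp add: power2_le_iff_abs_le)
      then show ?thesis using e by (simp add: dist_norm)
    qed
    then show "\<exists>N. \<forall>m\<ge>N. \<forall>n\<ge>N. dist (a m \<alpha>) (a n \<alpha>) < e" by blast
  qed
  then have "\<exists>l. (\<lambda>n. a n \<alpha>) \<longlonglongrightarrow> l" for \<alpha> by (simp add: Cauchy_convergent_iff convergent_def)
  then obtain l where l: "\<And>\<alpha>. (\<lambda>n. a n \<alpha>) \<longlonglongrightarrow> l \<alpha>" by metis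
  show ?thesis
  proof (rule that)
    fix e N n
    assume *: "\<And>m n. m \<ge> N \<Longrightarrow> n \<ge> N \<Longrightarrow> coeff_bounded e (\<lambda>\<alpha>. a m \<alpha> - a n \<alpha>)" and n: "n \<ge> N"
    show "coeff_bounded e (\<lambda>\<alpha>. a n \<alpha> - l \<alpha>)"
      unfolding coeff_bounded_def
    proof (intro allI impI)
      fix F :: "('d \<Rightarrow> nat) set" assume F: "finite F"
      have "(\<lambda>m. \<Sum>\<alpha>\<in>F. (cmod (a n \<alpha> - a m \<alpha>))\<^sup>2 * hardy_weight \<alpha>) \<longlonglongrightarrow> (\<Sum>\<alpha>\<in>F. (cmod (a n \<alpha> - l \<alpha>))\<^sup>2 * hardy_weight \<alpha>)"
        by (intro tendsto_intros l)
      then show "(\<Sum>\<alpha>\<in>F. (cmod (a n \<alpha> - l \<alpha>))\<^sup>2 * hardy_weight \<alpha>) \<le> e"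
        by (rule LIMSEQ_le_const2) (use *[OF n] F in \<open>auto simp: coeff_bounded_def\<close>)
    qed
  qed
qed

section \<open>Dirichlet-type spaces of a finite measure\<close>

context
  fixes \<mu> :: "(complex ^ 'd::finite) measure"
  assumes fin: "finite_measure \<mu>" and sets_\<mu>: "sets \<mu> = sets surface_measure"
begin

lemma poisson_integral_measurable_ball_volume [measurable]: "poisson_integral \<mu> \<in> borel_measurable ball_volume"
  using measurable_compose[OF measurable_ball_volume_id measurable_poisson_integral[OF fin sets_\<mu>]] by simp

text \<open>Only pairs with \<open>(norm z)\<^sup>2 < b\<close> contribute, where the kernel is
  bounded; a bounded integrand on a finite product measure is integrable.\<close>

lemma poisson_fubini:
  assumes K[measurable]: "K \<in> borel_measurable ball_volume" and B: "\<And>z. \<bar>K z\<bar> \<le> B"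
    and b: "0 \<le> b" "b < 1" "\<And>z. b \<le> (norm z)\<^sup>2 \<Longrightarrow> K z = 0"
  shows "integrable ball_volume (\<lambda>z. K z * poisson_integral \<mu> z)"
    and "(\<integral>z. K z * poisson_integral \<mu> z \<partial>ball_volume) = (\<integral>\<zeta>. (\<integral>z. K z * poisson_kernel z \<zeta> \<partial>ball_volume) \<partial>\<mu>)"
proof -
  interpret m: finite_measure \<mu> by (rule fin)
  interpret v: finite_measure ball_volume by (rule finite_measure_ball_volume)
  interpret p: pair_sigma_finite ball_volume \<mu> ..
  interpret pf: finite_measure "ball_volume \<Otimes>\<^sub>M \<mu>" by (rule finite_measure_pair_measure[OF fin finite_measure_ball_volume])
  note [measurable] = surface_space_measurable(2)[OF sets_\<mu>]
  have B0: "0 \<le> B" using B[of 0] by linarith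
  have int: "integrable (ball_volume \<Otimes>\<^sub>M \<mu>) (\<lambda>(z, \<zeta>). K z * poisson_kernel z \<zeta>)"
  proof (rule pf.integrable_const_bound)
    show "AE x in ball_volume \<Otimes>\<^sub>M \<mu>. norm (case x of (z, \<zeta>) \<Rightarrow> K z * poisson_kernel z \<zeta>) \<le> B * (1 / (1 - sqrt b) ^ (2 * CARD('d)))"
    proof (rule AE_I2, clarsimp simp: space_pair_measure surface_space_measurable(1)[OF sets_\<mu>] abs_mult)
      fix z \<zeta> :: "complex ^ 'd" assume \<zeta>: "norm \<zeta> = 1"
      show "\<bar>K z\<bar> * \<bar>poisson_kernel z \<zeta>\<bar> \<le> B / (1 - sqrt b) ^ (2 * CARD('d))"
      proof (cases "b \<le> (norm z)\<^sup>2")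
        case True
        then show ?thesis using b B0 by simp
      next
        case False
        then have "\<bar>K z\<bar> * \<bar>poisson_kernel z \<zeta>\<bar> \<le> B * (1 / (1 - sqrt b) ^ (2 * CARD('d)))"
          using b \<zeta> B0 by (intro mult_mono B poisson_kernel_bound) auto
        then show ?thesis by simp
      qed
    qed
    show "(\<lambda>(z, \<zeta>). K z * poisson_kernel z \<zeta>) \<in> borel_measurable (ball_volume \<Otimes>\<^sub>M \<mu>)"
      unfolding poisson_kernel_def by measurable
  qed
  have e: "(\<integral>\<zeta>. K z * poisson_kernel z \<zeta> \<partial>\<mu>) = K z * poisson_integral \<mu> z" for z
    by (simp add: poisson_integral_def)
  show "integrable ball_volume (\<lambda>z. K z * poisson_integral \<mu> z)"
    using p.integrable_fst'[OF int] unfolding split_conv e .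
  show "(\<integral>z. K z * poisson_integral \<mu> z \<partial>ball_volume) = (\<integral>\<zeta>. (\<integral>z. K z * poisson_kernel z \<zeta> \<partial>ball_volume) \<partial>\<mu>)"
    using p.Fubini_integral[OF int] unfolding e ..
qed

text \<open>Green's formula holds for the kernel at each boundary point, and Fubini integrates it
  over the measure.\<close>

lemma integral_green_density_cutoff:
  assumes f: "power_series_on_ball f a" and ab: "a' < b" "0 \<le> b" "b < 1"
  defines "K \<equiv> green_density (cutoff2 a' b) (cutoff1 a' b) (\<lambda>x. 2 * cutoff a' b x) f"
  shows "integrable ball_volume (\<lambda>z. K z * poisson_integral \<mu> z)" "(\<integral>z. K z * poisson_integral \<mu> z \<partial>ball_volume) = 0"
proof -
  have c: "continuous_on UNIV (cutoff2 a' b)" "continuous_on UNIV (cutoff1 a' b)"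
    using cutoff_derivs(1,2)[OF ab(1)] by (meson DERIV_isCont continuous_at_imp_continuous_on)+
  have n: "continuous_on (ball 0 1) (\<lambda>z :: complex ^ 'd. (norm z)\<^sup>2)" by (intro continuous_intros)
  have Kc: "continuous_on (ball 0 1) K"
    unfolding K_def green_density_def[abs_def]
    by (intro continuous_on_add continuous_on_mult n continuous_on_power continuous_on_norm power_series_continuous_on[OF f]
      continuous_on_compose2[OF c(1) n] continuous_on_compose2[OF c(2) n] continuous_on_compose2[OF cutoff_derivs(3)[OF ab(1)] n])
     auto
  have K0: "K z = 0" if "b \<le> (norm z)\<^sup>2" for z
    using cutoff_derivs(4)[OF ab(1) that] by (simp add: K_def green_density_def)
  obtain B where B: "\<And>z. norm (K z) \<le> B" using supported_in_ball_bounded[OF Kc ab(2,3) K0] by metis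
  have Km: "K \<in> borel_measurable ball_volume" by (rule continuous_on_ball_measurable[OF Kc])
  note F = poisson_fubini[OF Km B[unfolded real_norm_def] ab(2,3) K0]
  show "integrable ball_volume (\<lambda>z. K z * poisson_integral \<mu> z)" by (rule F(1))
  have zero: "(\<integral>z. K z * poisson_kernel z \<zeta> \<partial>ball_volume) = 0" if "\<zeta> \<in> space \<mu>" for \<zeta>
  proof (rule integral_ball_volume_eq_0)
    have \<zeta>: "\<zeta> \<in> sphere 0 1" using that surface_space_measurable(1)[OF sets_\<mu>] by simp
    have out: "K z = 0" if "z \<notin> ball 0 1" for z
    proof (rule K0)
      show "b \<le> (norm z)\<^sup>2" using that ab one_le_power[of "norm z" 2] unfolding mem_ball dist_0_norm not_less by linarith
    qed
    have "(\<lambda>z. indicator (ball 0 1) z *\<^sub>R K z) \<in> borel_measurable borel"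
      using Kc by (intro borel_measurable_continuous_on_indicator) auto
    also have "(\<lambda>z. indicator (ball 0 1) z *\<^sub>R K z) = K"
      using out by (auto simp: indicator_def fun_eq_iff)
    finally have [measurable]: "K \<in> borel_measurable borel" .
    show "(\<lambda>z. K z * poisson_kernel z \<zeta>) \<in> borel_measurable borel"
      unfolding poisson_kernel_def by measurable
    show "K z * poisson_kernel z \<zeta> = 0" if "z \<notin> ball 0 1" for z using out[OF that] by simp
    show "(\<integral>z. K z * poisson_kernel z \<zeta> \<partial>lborel) = 0"
      using integral_poisson_green_density[OF f \<zeta> ab(2,3) cutoff_derivs(1-3)[OF ab(1)] cutoff_derivs(4)[OF ab(1)]]
      unfolding K_def by (simp add: mult.commute)
  qed
  show "(\<integral>z. K z * poisson_integral \<mu> z \<partial>ball_volume) = 0"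
    by (subst F(2), assumption) (rule trans[OF Bochner_Integration.integral_cong[OF refl zero]], auto)
qed

lemma poisson_integral_nonneg_ball_volume: "z \<in> space (ball_volume :: (complex ^ 'd) measure) \<Longrightarrow> 0 \<le> poisson_integral \<mu> z"
  by (rule poisson_integral_nonneg) simp

text \<open>\<open>C\<close> does not depend on \<open>f\<close>, so the estimate gives bounded
  operators and not only invariance of the space. In the integrated form of
  \<open>green_density_lower_bound\<close> the density contributes 0, which leaves the energy and
  the mass of the inner ball.\<close>

lemma weighted_bergman_bound:
  obtains C where "0 \<le> C"
    "\<And>f a B D. power_series_on_ball f a \<Longrightarrow> coeff_bounded B a \<Longrightarrow> 0 \<le> D \<Longrightarrow>
      (\<integral>\<^sup>+z. ennreal (grad_sq f z * poisson_integral \<mu> z) \<partial>ball_volume) \<le> ennreal D \<Longrightarrow>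
      (\<integral>\<^sup>+z. ennreal ((cmod (f z))\<^sup>2 * poisson_integral \<mu> z) \<partial>ball_volume) \<le> ennreal (C * (B + D))"
proof -
  define P where "P = poisson_integral \<mu>"
  define r where "r = inner_radius CARD('d)"
  define ch where "ch z = (if (norm z)\<^sup>2 \<le> r then 1 else 0 :: real)" for z :: "complex ^ 'd"
  have [measurable]: "P \<in> borel_measurable ball_volume" by (simp add: P_def)
  have P0: "0 \<le> P z" if "z \<in> space ball_volume" for z unfolding P_def by (rule poisson_integral_nonneg_ball_volume[OF that])
  obtain C0 where C0: "C0 \<ge> 0"
    "\<And>f a B z. power_series_on_ball f a \<Longrightarrow> coeff_bounded B a \<Longrightarrow> (norm (z :: complex ^ 'd))\<^sup>2 \<le> r \<Longrightarrow> (cmod (f z))\<^sup>2 \<le> B * C0"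
    unfolding r_def using power_series_bound[OF inner_radius_bounds] by metis
  have ch_int: "integrable ball_volume (\<lambda>z. ch z * P z)"
    unfolding P_def
  proof (rule poisson_fubini(1))
    show "ch \<in> borel_measurable ball_volume" unfolding ch_def by measurable
    show "\<bar>ch z\<bar> \<le> 1" for z by (simp add: ch_def)
    \<comment> \<open>\<open>ch\<close> is still 1 on the sphere of squared radius \<open>r\<close>,
      so its support bound has to lie strictly between \<open>r\<close> and 1.\<close>
    show "ch z = 0" if "(r + 1) / 2 \<le> (norm z)\<^sup>2" for z
      using that inner_radius_bounds(2)[of "CARD('d)"] by (simp add: ch_def r_def[symmetric])
  qed (use inner_radius_bounds[of "CARD('d)"] in \<open>auto simp: r_def\<close>)
  define Q where "Q = (\<integral>z. ch z * P z \<partial>ball_volume)"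
  have Q: "Q \<ge> 0" unfolding Q_def by (rule Bochner_Integration.integral_nonneg) (auto simp: ch_def P0)
  \<comment> \<open>The 8 is the gradient constant of \<open>green_density_lower_bound\<close>. The
    rest is its inner term, where |f|^2 is at most \<open>B * C0\<close> and \<open>Q\<close> is the
    Poisson mass of the inner ball.\<close>
  define C where "C = 8 + 2 * (real CARD('d) + 1) * C0 * Q"
  show ?thesis
  proof (rule that)
    show C: "0 \<le> C" unfolding C_def using C0(1) Q by auto
    fix f :: "complex ^ 'd \<Rightarrow> complex" and a B D
    assume f: "power_series_on_ball f a" and B: "coeff_bounded B a" and D: "0 \<le> D"
      and g: "(\<integral>\<^sup>+z. ennreal (grad_sq f z * poisson_integral \<mu> z) \<partial>ball_volume) \<le> ennreal D"
    note [measurable] = power_series_measurable[OF f]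
    have g0: "AE z in ball_volume. 0 \<le> grad_sq f z * P z" by (intro AE_I2 mult_nonneg_nonneg grad_sq_nonneg P0)
    have gi: "integrable ball_volume (\<lambda>z. grad_sq f z * P z)"
      by (rule integrableI_nonneg) (use g0 g in \<open>auto simp: P_def[symmetric] less_top[symmetric] top_unique\<close>)
    have gD: "(\<integral>z. grad_sq f z * P z \<partial>ball_volume) \<le> D"
      using g D unfolding P_def[symmetric] nn_integral_eq_integral[OF gi g0] by simp
    define \<theta> where "\<theta> n z = cutoff (cut_a n) (cut_b n) ((norm z)\<^sup>2)" for n and z :: "complex ^ 'd"
    define M where "M = B * C0"
    define E where "E = 8 * D + 2 * (real CARD('d) + 1) * M * Q"
    have step: "(\<integral>\<^sup>+z. ennreal (\<theta> n z * (cmod (f z))\<^sup>2 * P z) \<partial>ball_volume) \<le> ennreal E" for n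
    proof -
      define K where "K = green_density (cutoff2 (cut_a n) (cut_b n)) (cutoff1 (cut_a n) (cut_b n)) (\<lambda>x. 2 * cutoff (cut_a n) (cut_b n) x) f"
      note K = integral_green_density_cutoff[OF f cut_ab[of n], folded K_def P_def]
      define h where "h z = K z * P z + 8 * (grad_sq f z * P z) + 2 * (real CARD('d) + 1) * M * (ch z * P z)" for z
      have le: "\<theta> n z * (cmod (f z))\<^sup>2 * P z \<le> h z" if z: "z \<in> space ball_volume" for z :: "complex ^ 'd"
      proof -
        have "\<theta> n z * (cmod (f z))\<^sup>2 \<le> K z + 8 * grad_sq f z + 2 * (real CARD('d) + 1) * (if (norm z)\<^sup>2 \<le> inner_radius CARD('d) then M else 0)"
          unfolding \<theta>_def K_def
          by (rule green_density_lower_bound) (use z cut_ab C0(2)[OF f B] in \<open>auto simp: r_def M_def\<close>)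
        also have "(if (norm z)\<^sup>2 \<le> inner_radius CARD('d) then M else 0) = M * ch z" by (simp add: ch_def r_def)
        finally have "\<theta> n z * (cmod (f z))\<^sup>2 * P z \<le> (K z + 8 * grad_sq f z + 2 * (real CARD('d) + 1) * (M * ch z)) * P z"
          by (rule mult_right_mono) (rule P0[OF z])
        then show ?thesis by (simp add: h_def algebra_simps)
      qed
      \<comment> \<open>\<open>K\<close> has no sign of its own, but \<open>h\<close> dominates a
        nonnegative function. So its \<open>nn_integral\<close> is a Bochner integral, in which the
        contribution of \<open>K\<close> is 0.\<close>
      have h0: "AE z in ball_volume. 0 \<le> h z"
      proof (rule AE_I2)
        fix z :: "complex ^ 'd" assume z: "z \<in> space ball_volume"
        then have "0 \<le> \<theta> n z"
          unfolding \<theta>_def using cut_ab[of n] by (intro cutoff_bounds) (auto simp: power_le_one)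
        then have "0 \<le> \<theta> n z * (cmod (f z))\<^sup>2 * P z" using P0[OF z] by simp
        then show "0 \<le> h z" using le[OF z] by linarith
      qed
      have hi: "integrable ball_volume h"
        unfolding h_def using K(1) gi ch_int by (intro Bochner_Integration.integrable_add integrable_mult_right)
      have "(\<integral>\<^sup>+z. ennreal (\<theta> n z * (cmod (f z))\<^sup>2 * P z) \<partial>ball_volume) \<le> (\<integral>\<^sup>+z. ennreal (h z) \<partial>ball_volume)"
        by (intro nn_integral_mono ennreal_leI le)
      also have "\<dots> = ennreal (integral\<^sup>L ball_volume h)" by (rule nn_integral_eq_integral[OF hi h0])
      also have "integral\<^sup>L ball_volume h = 8 * (\<integral>z. grad_sq f z * P z \<partial>ball_volume) + 2 * (real CARD('d) + 1) * M * Q"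
        unfolding h_def Q_def using K gi ch_int by simp
      also have "\<dots> \<le> E" using gD by (simp add: E_def)
      finally show ?thesis by (simp add: ennreal_leI)
    qed
    have \<theta>m: "\<theta> n \<in> borel_measurable ball_volume" for n
    proof -
      have "continuous_on UNIV (\<lambda>z :: complex ^ 'd. cutoff (cut_a n) (cut_b n) ((norm z)\<^sup>2))"
        unfolding cutoff_def pos_pow_def by (intro continuous_intros) (use cut_ab[of n] in auto)
      then have "(\<lambda>z. cutoff (cut_a n) (cut_b n) ((norm z)\<^sup>2)) \<in> borel_measurable (borel :: (complex ^ 'd) measure)"
        by (rule borel_measurable_continuous_onI)
      from measurable_compose[OF measurable_ball_volume_id this] show ?thesis by (simp add: \<theta>_def[abs_def])
    qed
    \<comment> \<open>The bound \<open>E\<close> is the same for all \<open>n\<close> and the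
      cutoffs tend to 1, so Fatou's lemma removes them.\<close>
    have "(\<integral>\<^sup>+z. ennreal ((cmod (f z))\<^sup>2 * P z) \<partial>ball_volume) = (\<integral>\<^sup>+z. liminf (\<lambda>n. ennreal (\<theta> n z * (cmod (f z))\<^sup>2 * P z)) \<partial>ball_volume)"
    proof (rule nn_integral_cong)
      fix z :: "complex ^ 'd" assume z: "z \<in> space ball_volume"
      then have "norm z < 1" by simp
      then have "(norm z)\<^sup>2 < 1" by (simp add: abs_square_less_1)
      from cutoff_limits(1)[OF this] have "(\<lambda>n. ennreal (\<theta> n z * (cmod (f z))\<^sup>2 * P z)) \<longlonglongrightarrow> ennreal (1 * (cmod (f z))\<^sup>2 * P z)"
        unfolding \<theta>_def by (intro tendsto_intros)
      from lim_imp_Liminf[OF _ this]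
      show "ennreal ((cmod (f z))\<^sup>2 * P z) = liminf (\<lambda>n. ennreal (\<theta> n z * (cmod (f z))\<^sup>2 * P z))"
        by simp
    qed
    also have "\<dots> \<le> liminf (\<lambda>n. \<integral>\<^sup>+z. ennreal (\<theta> n z * (cmod (f z))\<^sup>2 * P z) \<partial>ball_volume)"
      by (rule nn_integral_liminf) (use \<theta>m in measurable)
    also have "\<dots> \<le> liminf (\<lambda>n. ennreal E)"
      by (intro Liminf_mono always_eventually allI step)
    also have "\<dots> = ennreal E" by (simp add: Liminf_const)
    also have "E \<le> C * (B + D)"
    proof -
      have "0 \<le> 8 * B" "0 \<le> 2 * (real CARD('d) + 1) * C0 * Q * D"
        using coeff_bounded_nonneg[OF B] C0(1) Q D by auto
      then show ?thesis unfolding E_def C_def M_def by (simp add: algebra_simps)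
    qed
    finally show "(\<integral>\<^sup>+z. ennreal ((cmod (f z))\<^sup>2 * poisson_integral \<mu> z) \<partial>ball_volume) \<le> ennreal (C * (B + D))"
      unfolding P_def by (simp add: ennreal_leI)
  qed
qed

text \<open>Dominated convergence along the cutoffs; hypothesis \<open>u\<close> is the one that
  \<open>weighted_bergman_bound\<close> provides.\<close>

lemma integral_second_difference_eq_0:
  assumes f: "power_series_on_ball f a"
    and g: "integrable ball_volume (\<lambda>z. grad_sq f z * poisson_integral \<mu> z)"
    and u: "integrable ball_volume (\<lambda>z. (cmod (f z))\<^sup>2 * poisson_integral \<mu> z)"
  shows "(\<integral>z. ((1 - (norm z)\<^sup>2)\<^sup>2 * grad_sq f z - 2 * (1 - (norm z)\<^sup>2) * radial_term f z + 2 * (norm z)\<^sup>2 * (cmod (f z))\<^sup>2)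
      * poisson_integral \<mu> z \<partial>ball_volume) = 0"
proof -
  define P where "P = poisson_integral \<mu>"
  have P0: "0 \<le> P z" if "z \<in> space ball_volume" for z unfolding P_def by (rule poisson_integral_nonneg_ball_volume[OF that])
  define K where "K n = green_density (cutoff2 (cut_a n) (cut_b n)) (cutoff1 (cut_a n) (cut_b n)) (\<lambda>x. 2 * cutoff (cut_a n) (cut_b n) x) f" for n
  note K = integral_green_density_cutoff[OF f cut_ab, folded K_def P_def]
  define L where "L z = ((1 - (norm z)\<^sup>2)\<^sup>2 * grad_sq f z - 2 * (1 - (norm z)\<^sup>2) * radial_term f z + 2 * (norm z)\<^sup>2 * (cmod (f z))\<^sup>2) * P z" for z
  \<comment> \<open>\<open>\<bar>K n z\<bar>\<close> is at most
    \<open>grad_sq f z + 2 * \<bar>radial_term f z\<bar>\<close> plus twice |f|^2. By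
    \<open>radial_term_bound\<close> with \<open>r = 1\<close> this gives 1 + 8 = 9 and 2 d + 1/2 +
    2, which is at most 2 d + 3.\<close>
  define W where "W z = 9 * (grad_sq f z * P z) + (2 * real CARD('d) + 3) * ((cmod (f z))\<^sup>2 * P z)" for z
  have W: "integrable ball_volume W"
    unfolding W_def using g u unfolding P_def[symmetric]
    by (intro Bochner_Integration.integrable_add integrable_mult_right)
  have lim: "(\<lambda>n. K n z * P z) \<longlonglongrightarrow> L z" if z: "z \<in> space ball_volume" for z :: "complex ^ 'd"
  proof -
    have "norm z < 1" using z by simp
    then have "(norm z)\<^sup>2 < 1" by (simp add: abs_square_less_1)
    note c = cutoff_limits[OF this]
    have "(\<lambda>n. K n z * P z) \<longlonglongrightarrow> ((1 - (norm z)\<^sup>2)\<^sup>2 * grad_sq f z + - (2 * (1 - (norm z)\<^sup>2)) * radial_term f z +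
       2 * 1 * (norm z)\<^sup>2 * (cmod (f z))\<^sup>2) * P z"
      unfolding K_def green_density_def by (intro tendsto_intros c)
    then show ?thesis unfolding L_def by (simp only: diff_conv_add_uminus minus_mult_left mult_1_right)
  qed
  have bound: "norm (K n z * P z) \<le> W z" if z: "z \<in> space ball_volume" for n and z :: "complex ^ 'd"
  proof -
    define s where "s = (norm z)\<^sup>2"
    have s: "0 \<le> s" "s \<le> 1" using z by (auto simp: s_def power_le_one)
    have c0: "cut_b n \<le> 1" using cut_ab(3)[of n] by simp
    note c = cutoff_bounds[OF cut_ab(1) c0 s(2)]
    have "\<bar>cutoff (cut_a n) (cut_b n) s\<bar> \<le> 1" using c(1,2) by simp
    moreover have "(1 - s) * cutoff (cut_a n) (cut_b n) s \<le> 1 * 1" using c(1,2) s by (intro mult_mono) auto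
    then have "\<bar>cutoff1 (cut_a n) (cut_b n) s\<bar> \<le> 2" using c(3) c(4)[unfolded mult.assoc] by linarith
    moreover have "(1 - s)\<^sup>2 * cutoff (cut_a n) (cut_b n) s \<le> 1 * 1" using c(1,2) s by (intro mult_mono) (auto simp: power_le_one)
    then have "\<bar>cutoff2 (cut_a n) (cut_b n) s\<bar> \<le> 1" using c(5,6) by simp
    moreover have "\<bar>x * grad_sq f z\<bar> \<le> 1 * grad_sq f z" if "\<bar>x\<bar> \<le> 1" for x
      unfolding abs_mult using mult_right_mono[OF that grad_sq_nonneg] by (simp add: grad_sq_nonneg)
    moreover have "\<bar>x * radial_term f z\<bar> \<le> 2 * \<bar>radial_term f z\<bar>" if "\<bar>x\<bar> \<le> 2" for x
      unfolding abs_mult using that by (rule mult_right_mono) simp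
    moreover have "\<bar>2 * x * s * (cmod (f z))\<^sup>2\<bar> \<le> 2 * 1 * (cmod (f z))\<^sup>2" if "\<bar>x\<bar> \<le> 1" for x
    proof -
      have "\<bar>x\<bar> * s * (cmod (f z))\<^sup>2 \<le> 1 * (cmod (f z))\<^sup>2"
        using that s by (intro mult_right_mono mult_le_one) auto
      then show ?thesis using s by (simp add: abs_mult)
    qed
    ultimately have "\<bar>K n z\<bar> \<le> 1 * grad_sq f z + 2 * \<bar>radial_term f z\<bar> + 2 * 1 * (cmod (f z))\<^sup>2"
      unfolding K_def green_density_def s_def[symmetric]
      by (intro order_trans[OF abs_triangle_ineq] add_mono) blast+
    also have "\<dots> \<le> 9 * grad_sq f z + (2 * real CARD('d) + 3) * (cmod (f z))\<^sup>2"
    proof -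
      have "\<bar>radial_term f z\<bar> \<le> real CARD('d) * (cmod (f z))\<^sup>2 + (cmod (f z))\<^sup>2 / 4 + 4 * grad_sq f z"
        using radial_term_bound[of z 1 f] z by simp
      moreover have "(2 * real CARD('d) + 3) * (cmod (f z))\<^sup>2 = 2 * (real CARD('d) * (cmod (f z))\<^sup>2) + 3 * (cmod (f z))\<^sup>2"
        by (simp add: distrib_right)
      ultimately show ?thesis using zero_le_power2[of "cmod (f z)"] by linarith
    qed
    finally have "\<bar>K n z\<bar> * P z \<le> (9 * grad_sq f z + (2 * real CARD('d) + 3) * (cmod (f z))\<^sup>2) * P z"
      by (rule mult_right_mono) (rule P0[OF z])
    then show ?thesis using P0[OF z] by (simp add: W_def abs_mult algebra_simps)
  qed
  have Lm: "L \<in> borel_measurable ball_volume"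
    unfolding L_def P_def using power_series_measurable[OF f] by measurable
  have "(\<lambda>n. \<integral>z. K n z * P z \<partial>ball_volume) \<longlonglongrightarrow> integral\<^sup>L ball_volume L"
    by (rule integral_dominated_convergence[OF Lm _ W]) (use K(1) lim bound in auto)
  then have "integral\<^sup>L ball_volume L = 0" by (simp add: K(2) LIMSEQ_const_iff)
  then show ?thesis unfolding L_def P_def .
qed

section \<open>Linear structure and inner product\<close>

lemma dirichlet_spaceE:
  assumes "f \<in> dirichlet_space \<mu>"
  obtains a where "power_series_on_ball f a" "power_coeff f = a" "coeff_bounded (enn2real (hardy_norm_sq f)) a"
  using assms power_coeff_eq coeff_bounded_hardy_norm unfolding dirichlet_space_iff by metis

lemma energy_integrable:
  assumes f: "power_series_on_ball f a" and e: "energy \<mu> f < \<infinity>"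
  shows "integrable ball_volume (\<lambda>z. grad_sq f z * poisson_integral \<mu> z)" "(\<integral>z. grad_sq f z * poisson_integral \<mu> z \<partial>ball_volume) = enn2real (energy \<mu> f)"
proof -
  have [measurable]: "grad_sq f \<in> borel_measurable ball_volume"
    by (rule power_series_measurable[OF f])
  have m: "(\<lambda>z. grad_sq f z * poisson_integral \<mu> z) \<in> borel_measurable ball_volume" by measurable
  have g0: "AE z in ball_volume. 0 \<le> grad_sq f z * poisson_integral \<mu> z" by (intro AE_I2 mult_nonneg_nonneg grad_sq_nonneg poisson_integral_nonneg_ball_volume)
  show i: "integrable ball_volume (\<lambda>z. grad_sq f z * poisson_integral \<mu> z)"
    by (rule integrableI_nonneg) (use m g0 e in \<open>auto simp: energy_def\<close>)
  show "(\<integral>z. grad_sq f z * poisson_integral \<mu> z \<partial>ball_volume) = enn2real (energy \<mu> f)"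
    unfolding energy_def by (rule integral_eq_nn_integral[OF m g0])
qed

lemma nn_integral_le_energy_sum:
  assumes "\<And>z. z \<in> ball 0 1 \<Longrightarrow> h z \<le> c * grad_sq f z + c * grad_sq g z" "0 \<le> c"
    and "power_series_on_ball f a" "power_series_on_ball g b"
  shows "(\<integral>\<^sup>+z. ennreal (h z * poisson_integral \<mu> z) \<partial>ball_volume) \<le> ennreal c * energy \<mu> f + ennreal c * energy \<mu> g"
proof -
  note [measurable] = power_series_measurable(3)[OF assms(3)] power_series_measurable(3)[OF assms(4)]
  have "(\<integral>\<^sup>+z. ennreal (h z * poisson_integral \<mu> z) \<partial>ball_volume) \<le>
     (\<integral>\<^sup>+z. ennreal c * ennreal (grad_sq f z * poisson_integral \<mu> z) + ennreal c * ennreal (grad_sq g z * poisson_integral \<mu> z) \<partial>ball_volume)"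
  proof (rule nn_integral_mono)
    fix z :: "complex ^ 'd" assume z: "z \<in> space ball_volume"
    have "h z * poisson_integral \<mu> z \<le> (c * grad_sq f z + c * grad_sq g z) * poisson_integral \<mu> z"
      using assms(1) z by (intro mult_right_mono poisson_integral_nonneg_ball_volume) auto
    then show "ennreal (h z * poisson_integral \<mu> z) \<le> ennreal c * ennreal (grad_sq f z * poisson_integral \<mu> z) + ennreal c * ennreal (grad_sq g z * poisson_integral \<mu> z)"
      using assms(2) z by (simp add: ennreal_mult'[symmetric] ennreal_plus[symmetric] grad_sq_nonneg poisson_integral_nonneg_ball_volume algebra_simps
         ennreal_leI del: ennreal_plus)
  qed
  also have "\<dots> = (\<integral>\<^sup>+z. ennreal c * ennreal (grad_sq f z * poisson_integral \<mu> z) \<partial>ball_volume)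
      + (\<integral>\<^sup>+z. ennreal c * ennreal (grad_sq g z * poisson_integral \<mu> z) \<partial>ball_volume)"
    by (rule nn_integral_add) measurable
  also have "\<dots> = ennreal c * energy \<mu> f + ennreal c * energy \<mu> g"
    unfolding energy_def by (intro arg_cong2[of _ _ _ _ "(+)"] nn_integral_cmult) measurable
  finally show ?thesis .
qed

lemma dirichlet_space_diff:
  assumes f: "f \<in> dirichlet_space \<mu>" and g: "g \<in> dirichlet_space \<mu>"
  shows "f - g \<in> dirichlet_space \<mu>"
proof -
  obtain a b where a: "power_series_on_ball f a" "coeff_bounded (enn2real (hardy_norm_sq f)) a"
    and b: "power_series_on_ball g b" "coeff_bounded (enn2real (hardy_norm_sq g)) b"
    using dirichlet_spaceE[OF f] dirichlet_spaceE[OF g] by metis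
  note hol = power_series_holomorphic[OF a(1)] power_series_holomorphic[OF b(1)]
  have e: "f - g = (\<lambda>z. f z - g z)" by (simp add: fun_eq_iff)
  have "grad_sq (\<lambda>z. f z - g z) z \<le> 2 * grad_sq f z + 2 * grad_sq g z" if "z \<in> ball 0 1" for z
    unfolding grad_sq_def partial_deriv_diff[OF hol that] sum_distrib_left sum.distrib[symmetric]
    by (intro sum_mono cmod_diff_sq_le)
  from nn_integral_le_energy_sum[OF this _ a(1) b(1)]
  have "energy \<mu> (\<lambda>z. f z - g z) \<le> ennreal 2 * energy \<mu> f + ennreal 2 * energy \<mu> g"
    by (simp add: energy_def)
  also have "\<dots> < \<infinity>" using f g by (auto simp: dirichlet_space_iff ennreal_mult_less_top less_top)
  finally have "energy \<mu> (\<lambda>z. f z - g z) < \<infinity>" .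
  moreover have "hardy_norm_sq (\<lambda>z. f z - g z) < \<infinity>"
    by (rule hardy_norm_sq_finite[OF power_series_diff[OF a(1) b(1)] coeff_bounded_diff[OF a(2) b(2)]])
  moreover have "\<exists>c. power_series_on_ball (\<lambda>z. f z - g z) c" using power_series_diff[OF a(1) b(1)] by blast
  moreover have "\<forall>z. z \<notin> ball 0 1 \<longrightarrow> f z - g z = 0" using f g by (auto simp: dirichlet_space_iff)
  ultimately show ?thesis unfolding e dirichlet_space_iff by blast
qed

lemma dirichlet_space_scale:
  assumes f: "f \<in> dirichlet_space \<mu>"
  shows "pointwise_scale c f \<in> dirichlet_space \<mu>"
proof -
  obtain a where a: "power_series_on_ball f a" "coeff_bounded (enn2real (hardy_norm_sq f)) a"
    using dirichlet_spaceE[OF f] by metis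
  note hol = power_series_holomorphic[OF a(1)]
  have "grad_sq (\<lambda>z. c * f z) z \<le> (cmod c)\<^sup>2 * grad_sq f z + (cmod c)\<^sup>2 * grad_sq f z" if "z \<in> ball 0 1" for z
    unfolding grad_sq_cmult[OF hol that] by (simp add: grad_sq_nonneg)
  from nn_integral_le_energy_sum[OF this _ a(1) a(1)]
  have "energy \<mu> (\<lambda>z. c * f z) \<le> ennreal ((cmod c)\<^sup>2) * energy \<mu> f + ennreal ((cmod c)\<^sup>2) * energy \<mu> f"
    by (simp add: energy_def)
  also have "\<dots> < \<infinity>" using f by (auto simp: dirichlet_space_iff ennreal_mult_less_top less_top)
  finally have "energy \<mu> (\<lambda>z. c * f z) < \<infinity>" .
  moreover have "hardy_norm_sq (\<lambda>z. c * f z) < \<infinity>"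
    by (rule hardy_norm_sq_finite[OF power_series_cmult[OF a(1)] coeff_bounded_cmult[OF a(2)]])
  moreover have "\<exists>b. power_series_on_ball (\<lambda>z. c * f z) b" using power_series_cmult[OF a(1)] by blast
  moreover have "\<forall>z. z \<notin> ball 0 1 \<longrightarrow> c * f z = 0" using f by (auto simp: dirichlet_space_iff)
  ultimately show ?thesis unfolding pointwise_scale_def dirichlet_space_iff by blast
qed

lemma dirichlet_space_0: "0 \<in> dirichlet_space \<mu>"
proof -
  have ps: "power_series_on_ball 0 (\<lambda>_. 0)" by (simp add: power_series_on_ball_def)
  have "hardy_norm_sq (0 :: complex ^ 'd \<Rightarrow> complex) < \<infinity>"
    by (rule hardy_norm_sq_finite[OF ps, of 0]) (simp add: coeff_bounded_def)
  moreover have "grad_sq (0 :: complex ^ 'd \<Rightarrow> complex) z = 0" for z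
    by (simp add: grad_sq_def partial_deriv_def zero_fun_def)
  then have "energy \<mu> (0 :: complex ^ 'd \<Rightarrow> complex) < \<infinity>" by (simp add: energy_def)
  ultimately show ?thesis using ps unfolding dirichlet_space_iff by auto
qed

lemma dirichlet_space_add:
  assumes "f \<in> dirichlet_space \<mu>" "g \<in> dirichlet_space \<mu>"
  shows "f + g \<in> dirichlet_space \<mu>"
proof -
  have "f + g = f - pointwise_scale (- 1) g" by (simp add: fun_eq_iff pointwise_scale_def)
  then show ?thesis using dirichlet_space_diff[OF assms(1) dirichlet_space_scale[OF assms(2)]] by metis
qed

lemma dirichlet_inner_summable:
  assumes f: "f \<in> dirichlet_space \<mu>" and g: "g \<in> dirichlet_space \<mu>"
  shows "(\<lambda>\<alpha>. power_coeff f \<alpha> * cnj (power_coeff g \<alpha>) * of_real (hardy_weight \<alpha>)) summable_on UNIV"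
proof -
  have h: "(\<lambda>\<alpha>. (cmod (power_coeff f \<alpha>))\<^sup>2 * hardy_weight \<alpha>) summable_on UNIV" if "f \<in> dirichlet_space \<mu>" for f
    by (rule infsum_ennreal_finite(1)) (use that in \<open>auto simp: dirichlet_space_iff hardy_norm_sq_def hardy_weight_nonneg\<close>)
  show ?thesis
    unfolding summable_on_iff_abs_summable_on_complex
  proof (rule summable_on_comparison_test[OF summable_on_add[OF h[OF f] h[OF g]]])
    fix \<alpha>
    have "0 \<le> (cmod (power_coeff f \<alpha>) - cmod (power_coeff g \<alpha>))\<^sup>2" by simp
    then have "2 * (cmod (power_coeff f \<alpha>) * cmod (power_coeff g \<alpha>)) \<le> (cmod (power_coeff f \<alpha>))\<^sup>2 + (cmod (power_coeff g \<alpha>))\<^sup>2"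
      by (simp add: power2_diff)
    moreover have "0 \<le> cmod (power_coeff f \<alpha>) * cmod (power_coeff g \<alpha>)" by simp
    ultimately have "cmod (power_coeff f \<alpha>) * cmod (power_coeff g \<alpha>) \<le> (cmod (power_coeff f \<alpha>))\<^sup>2 + (cmod (power_coeff g \<alpha>))\<^sup>2" by linarith
    from mult_right_mono[OF this hardy_weight_nonneg[of \<alpha>]]
    show "cmod (power_coeff f \<alpha> * cnj (power_coeff g \<alpha>) * complex_of_real (hardy_weight \<alpha>)) \<le>
       (cmod (power_coeff f \<alpha>))\<^sup>2 * hardy_weight \<alpha> + (cmod (power_coeff g \<alpha>))\<^sup>2 * hardy_weight \<alpha>"
      by (simp add: norm_mult hardy_weight_nonneg distrib_right)
  qed auto
qed

lemma dirichlet_inner_integrable: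
  assumes f: "f \<in> dirichlet_space \<mu>" and g: "g \<in> dirichlet_space \<mu>"
  shows "integrable ball_volume (\<lambda>z. (\<Sum>j\<in>UNIV. partial_deriv j f z * cnj (partial_deriv j g z)) * complex_of_real (poisson_integral \<mu> z))"
proof -
  obtain a b where a: "power_series_on_ball f a" and b: "power_series_on_ball g b"
    using dirichlet_spaceE[OF f] dirichlet_spaceE[OF g] by metis
  note [measurable] = power_series_measurable(2)[OF a] power_series_measurable(2)[OF b]
  have [measurable]: "cnj \<in> borel_measurable borel" "complex_of_real \<in> borel_measurable borel"
    by (intro borel_measurable_continuous_onI continuous_intros)+
  have "integrable ball_volume (\<lambda>z. grad_sq f z * poisson_integral \<mu> z + grad_sq g z * poisson_integral \<mu> z)"
    using f g by (intro Bochner_Integration.integrable_add energy_integrable(1)[OF a] energy_integrable(1)[OF b]) (auto simp: dirichlet_space_iff)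
  then show ?thesis
  proof (rule Bochner_Integration.integrable_bound)
    show "AE z in ball_volume. norm ((\<Sum>j\<in>UNIV. partial_deriv j f z * cnj (partial_deriv j g z)) * complex_of_real (poisson_integral \<mu> z))
      \<le> norm (grad_sq f z * poisson_integral \<mu> z + grad_sq g z * poisson_integral \<mu> z)"
    proof (rule AE_I2)
      fix z :: "complex ^ 'd" assume z: "z \<in> space ball_volume"
      have "cmod (\<Sum>j\<in>UNIV. partial_deriv j f z * cnj (partial_deriv j g z)) \<le>
        (\<Sum>j\<in>UNIV. (cmod (partial_deriv j f z))\<^sup>2 + (cmod (partial_deriv j g z))\<^sup>2)"
      proof (rule sum_norm_le)
        fix j
        have "0 \<le> (cmod (partial_deriv j f z) - cmod (partial_deriv j g z))\<^sup>2" by simp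
        then have "2 * (cmod (partial_deriv j f z) * cmod (partial_deriv j g z)) \<le> (cmod (partial_deriv j f z))\<^sup>2 + (cmod (partial_deriv j g z))\<^sup>2"
          by (simp add: power2_diff)
        moreover have "0 \<le> cmod (partial_deriv j f z) * cmod (partial_deriv j g z)" by simp
        ultimately show "cmod (partial_deriv j f z * cnj (partial_deriv j g z)) \<le> (cmod (partial_deriv j f z))\<^sup>2 + (cmod (partial_deriv j g z))\<^sup>2"
          unfolding norm_mult complex_mod_cnj by linarith
      qed
      also have "\<dots> = grad_sq f z + grad_sq g z" by (simp add: grad_sq_def sum.distrib)
      finally have "cmod (\<Sum>j\<in>UNIV. partial_deriv j f z * cnj (partial_deriv j g z)) * poisson_integral \<mu> z \<le> (grad_sq f z + grad_sq g z) * poisson_integral \<mu> z"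
        by (rule mult_right_mono) (rule poisson_integral_nonneg_ball_volume[OF z])
      then show "norm ((\<Sum>j\<in>UNIV. partial_deriv j f z * cnj (partial_deriv j g z)) * complex_of_real (poisson_integral \<mu> z))
          \<le> norm (grad_sq f z * poisson_integral \<mu> z + grad_sq g z * poisson_integral \<mu> z)"
        using poisson_integral_nonneg_ball_volume[OF z] by (simp add: norm_mult grad_sq_nonneg distrib_right)
    qed
  qed measurable
qed

text \<open>The Hardy part already detects \<open>f\<close>: because functions in the space vanish
  outside the ball, a nonzero one has a nonzero coefficient.\<close>

lemma dirichlet_space_nondegenerate:
  assumes f: "f \<in> dirichlet_space \<mu>" "f \<noteq> 0"
  shows "0 < Re (dirichlet_inner \<mu> f f)"
proof -
  obtain a where a: "power_series_on_ball f a" "power_coeff f = a"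
    using dirichlet_spaceE[OF f(1)] by metis
  have "\<exists>\<alpha>. a \<alpha> \<noteq> 0"
  proof (rule ccontr)
    assume "\<not> (\<exists>\<alpha>. a \<alpha> \<noteq> 0)"
    then have "a = (\<lambda>_. 0)" by auto
    then have "f z = 0" if "z \<in> ball 0 1" for z
    proof -
      have "((\<lambda>_. 0) has_sum f z) (UNIV :: ('d \<Rightarrow> nat) set)"
        using a(1) that \<open>a = (\<lambda>_. 0)\<close> by (auto simp: power_series_on_ball_def)
      from infsumI[OF this] show ?thesis by simp
    qed
    then have "f z = 0" for z using f(1) by (cases "z \<in> ball 0 1") (auto simp: dirichlet_space_iff)
    then show False using f(2) by (auto simp: fun_eq_iff)
  qed
  then obtain \<alpha> where "a \<alpha> \<noteq> 0" by blast
  then have "0 < ennreal ((cmod (a \<alpha>))\<^sup>2 * hardy_weight \<alpha>)" using hardy_weight_pos[of \<alpha>] by simp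
  also have "\<dots> = (\<Sum>\<^sub>\<infinity>\<alpha>\<in>{\<alpha>}. ennreal ((cmod (a \<alpha>))\<^sup>2 * hardy_weight \<alpha>))" by simp
  also have "\<dots> \<le> hardy_norm_sq f"
    unfolding hardy_norm_sq_eq[OF a(1)] by (rule infsum_mono_neutral) (auto intro: nonneg_summable_on_complete)
  also have "\<dots> \<le> dirichlet_norm_sq \<mu> f" unfolding dirichlet_norm_sq_eq by simp
  finally have "0 < dirichlet_norm_sq \<mu> f" .
  moreover have "dirichlet_norm_sq \<mu> f < \<infinity>" using f(1) by (simp add: dirichlet_space_def)
  ultimately show ?thesis unfolding dirichlet_inner_self[OF fin sets_\<mu> f(1)] by (simp add: enn2real_positive_iff)
qed

lemma ip_norm_dirichlet:
  assumes "f \<in> dirichlet_space \<mu>"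
  shows "ip_norm (dirichlet_inner \<mu>) f = sqrt (enn2real (dirichlet_norm_sq \<mu> f))"
  unfolding ip_norm_def dirichlet_inner_self[OF fin sets_\<mu> assms] by simp

lemma ip_norm_le_iff:
  assumes "f \<in> dirichlet_space \<mu>" "0 \<le> e"
  shows "ip_norm (dirichlet_inner \<mu>) f \<le> e \<longleftrightarrow> dirichlet_norm_sq \<mu> f \<le> ennreal (e\<^sup>2)"
proof -
  have "dirichlet_norm_sq \<mu> f < \<infinity>" using assms(1) by (simp add: dirichlet_space_def)
  then obtain r where r: "dirichlet_norm_sq \<mu> f = ennreal r" "0 \<le> r" by (cases "dirichlet_norm_sq \<mu> f") auto
  show ?thesis
    unfolding ip_norm_dirichlet[OF assms(1)] r(1) using r(2) assms(2)
    by (simp add: ennreal_le_iff sqrt_le_D real_le_lsqrt) (metis real_sqrt_le_iff real_sqrt_unique sqrt_le_D)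
qed

lemma Re_dirichlet_inner_self:
  assumes f: "f \<in> dirichlet_space \<mu>"
  shows "Re (dirichlet_inner \<mu> f f) = enn2real (hardy_norm_sq f) + 1 / CARD('d) * (\<integral>z. grad_sq f z * poisson_integral \<mu> z \<partial>ball_volume)"
proof -
  obtain a where a: "power_series_on_ball f a" using dirichlet_spaceE[OF f] by metis
  have fin': "hardy_norm_sq f < \<infinity>" "energy \<mu> f < \<infinity>" using f by (auto simp: dirichlet_space_iff)
  have "enn2real (dirichlet_norm_sq \<mu> f) = enn2real (hardy_norm_sq f) + 1 / CARD('d) * enn2real (energy \<mu> f)"
    unfolding dirichlet_norm_sq_eq using fin'
    by (subst enn2real_plus) (auto simp: enn2real_mult ennreal_mult_less_top less_top)
  then show ?thesis
    unfolding dirichlet_inner_self[OF fin sets_\<mu> f] energy_integrable(2)[OF a fin'(2)] by simp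
qed

text \<open>The Hardy part does not grow under multiplication by a coordinate; the energy of the
  product is estimated through \<open>weighted_bergman_bound\<close>, fed with the squared norm of
  \<open>f\<close> for both of its inputs up to the factor d.\<close>

lemma coord_mult_dirichlet_bound:
  obtains C where "0 \<le> C"
    "\<And>f j. f \<in> dirichlet_space \<mu> \<Longrightarrow> coord_mult j f \<in> dirichlet_space \<mu> \<and>
      dirichlet_norm_sq \<mu> (coord_mult j f) \<le> ennreal C * dirichlet_norm_sq \<mu> f"
proof -
  obtain C where C: "0 \<le> C"
    "\<And>f a B D. power_series_on_ball f a \<Longrightarrow> coeff_bounded B a \<Longrightarrow> 0 \<le> D \<Longrightarrow>
      (\<integral>\<^sup>+z. ennreal (grad_sq f z * poisson_integral \<mu> z) \<partial>ball_volume) \<le> ennreal D \<Longrightarrow>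
      (\<integral>\<^sup>+z. ennreal ((cmod (f z))\<^sup>2 * poisson_integral \<mu> z) \<partial>ball_volume) \<le> ennreal (C * (B + D))"
    using weighted_bergman_bound by blast
  define d where "d = real CARD('d)"
  have d: "1 \<le> d" by (simp add: d_def Suc_le_eq)
  \<comment> \<open>1 comes from the Hardy part. The energy of the product is at most 2 C (1 + d) +
    2 d times the squared norm, and its prefactor 1 / d is at most 1.\<close>
  define C' where "C' = 1 + 2 * C * (1 + d) + 2 * d"
  show ?thesis
  proof (rule that)
    show "0 \<le> C'" using C(1) d by (simp add: C'_def)
    fix f j assume f: "f \<in> dirichlet_space \<mu>"
    obtain a where a: "power_series_on_ball f a" "coeff_bounded (enn2real (hardy_norm_sq f)) a"
      using dirichlet_spaceE[OF f] by metis
    note [measurable] = power_series_measurable[OF a(1)]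
    have hol: "holomorphic_on_ball f" by (rule power_series_holomorphic[OF a(1)])
    define N where "N = enn2real (dirichlet_norm_sq \<mu> f)"
    have N: "dirichlet_norm_sq \<mu> f = ennreal N" "0 \<le> N"
      using f by (auto simp: N_def dirichlet_space_def ennreal_enn2real)
    have hN: "hardy_norm_sq f \<le> ennreal N" unfolding N(1)[symmetric] dirichlet_norm_sq_eq by simp
    have eN: "energy \<mu> f \<le> ennreal (d * N)"
      using energy_le_dirichlet_norm_sq[of \<mu> f] N d by (simp add: d_def ennreal_mult')
    have "coeff_bounded N a" using hN coeff_bounded_iff_hardy_norm_sq[OF a(1) N(2)] by simp
    from C(2)[OF a(1) this _ eN[unfolded energy_def]]
    have u: "(\<integral>\<^sup>+z. ennreal ((cmod (f z))\<^sup>2 * poisson_integral \<mu> z) \<partial>ball_volume) \<le> ennreal (C * (N + d * N))"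
      using d N(2) by simp
    have "energy \<mu> (coord_mult j f) \<le>
      (\<integral>\<^sup>+z. 2 * ennreal ((cmod (f z))\<^sup>2 * poisson_integral \<mu> z) + 2 * ennreal (grad_sq f z * poisson_integral \<mu> z) \<partial>ball_volume)"
      unfolding energy_def
    proof (rule nn_integral_mono)
      fix z :: "complex ^ 'd" assume z: "z \<in> space ball_volume"
      have "grad_sq (coord_mult j f) z * poisson_integral \<mu> z \<le> (2 * (cmod (f z))\<^sup>2 + 2 * grad_sq f z) * poisson_integral \<mu> z"
        using z by (intro mult_right_mono grad_sq_coord_mult_le[OF hol] poisson_integral_nonneg_ball_volume) auto
      also have "\<dots> = 2 * ((cmod (f z))\<^sup>2 * poisson_integral \<mu> z) + 2 * (grad_sq f z * poisson_integral \<mu> z)"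
        by (simp add: algebra_simps)
      finally have "ennreal (grad_sq (coord_mult j f) z * poisson_integral \<mu> z) \<le> ennreal \<dots>" by (rule ennreal_leI)
      also have "\<dots> = 2 * ennreal ((cmod (f z))\<^sup>2 * poisson_integral \<mu> z) + 2 * ennreal (grad_sq f z * poisson_integral \<mu> z)"
        using poisson_integral_nonneg_ball_volume[OF z] by (subst ennreal_plus) (auto simp: grad_sq_nonneg ennreal_mult')
      finally show "ennreal (grad_sq (coord_mult j f) z * poisson_integral \<mu> z) \<le>
        2 * ennreal ((cmod (f z))\<^sup>2 * poisson_integral \<mu> z) + 2 * ennreal (grad_sq f z * poisson_integral \<mu> z)" .
    qed
    also have "\<dots> = (\<integral>\<^sup>+z. 2 * ennreal ((cmod (f z))\<^sup>2 * poisson_integral \<mu> z) \<partial>ball_volume)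
       + (\<integral>\<^sup>+z. 2 * ennreal (grad_sq f z * poisson_integral \<mu> z) \<partial>ball_volume)"
      by (rule nn_integral_add) measurable
    also have "\<dots> = 2 * (\<integral>\<^sup>+z. ennreal ((cmod (f z))\<^sup>2 * poisson_integral \<mu> z) \<partial>ball_volume) + 2 * energy \<mu> f"
      unfolding energy_def by (intro arg_cong2[of _ _ _ _ "(+)"] nn_integral_cmult) measurable
    also have "\<dots> \<le> 2 * ennreal (C * (N + d * N)) + 2 * ennreal (d * N)"
      by (intro add_mono mult_left_mono u eN) auto
    also have "\<dots> = ennreal (2 * (C * (N + d * N)) + 2 * (d * N))"
      using C(1) d N(2) by (subst ennreal_plus) (auto simp: ennreal_mult')
    finally have e: "energy \<mu> (coord_mult j f) \<le> ennreal (2 * (C * (N + d * N)) + 2 * (d * N))" .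
    have "hardy_norm_sq (coord_mult j f) \<le> (\<Sum>j\<in>UNIV. hardy_norm_sq (coord_mult j f))"
      by (rule member_le_sum) auto
    also have "\<dots> \<le> ennreal N" unfolding sum_hardy_norm_sq_coord_mult[OF a(1)] by (rule hN)
    finally have h: "hardy_norm_sq (coord_mult j f) \<le> ennreal N" .
    have "coord_mult j f \<in> dirichlet_space \<mu>"
      unfolding dirichlet_space_iff
    proof (intro conjI)
      show "\<forall>z. z \<notin> ball 0 1 \<longrightarrow> coord_mult j f z = 0" using f by (auto simp: dirichlet_space_iff coord_mult_def)
      show "\<exists>b. power_series_on_ball (coord_mult j f) b" using power_series_coord_mult[OF a(1)] by blast
      show "hardy_norm_sq (coord_mult j f) < \<infinity>" "energy \<mu> (coord_mult j f) < \<infinity>"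
        using h e by (auto intro: le_less_trans)
    qed
    moreover have "dirichlet_norm_sq \<mu> (coord_mult j f) \<le> ennreal C' * dirichlet_norm_sq \<mu> f"
    proof -
      define E where "E = 2 * (C * (N + d * N)) + 2 * (d * N)"
      have E: "0 \<le> E" "0 \<le> 1 / d * E" using d C(1) N(2) by (simp_all add: E_def)
      have "1 / d * E \<le> 1 * E" using d E(1) by (intro mult_right_mono) auto
      then have le: "N + 1 / d * E \<le> C' * N" by (simp add: C'_def E_def algebra_simps)
      have "dirichlet_norm_sq \<mu> (coord_mult j f) \<le> ennreal N + ennreal (1 / d) * ennreal E"
        unfolding dirichlet_norm_sq_eq d_def[symmetric] E_def by (intro add_mono mult_left_mono h e) auto
      also have "\<dots> = ennreal N + ennreal (1 / d * E)" using E(1) d by (subst ennreal_mult) auto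
      also have "\<dots> = ennreal (N + 1 / d * E)" using ennreal_plus[OF N(2) E(2)] by simp
      also have "\<dots> \<le> ennreal (C' * N)" by (rule ennreal_leI[OF le])
      also have "\<dots> = ennreal C' * dirichlet_norm_sq \<mu> f" using N C(1) d by (simp add: ennreal_mult' C'_def)
      finally show ?thesis .
    qed
    ultimately show "coord_mult j f \<in> dirichlet_space \<mu> \<and>
      dirichlet_norm_sq \<mu> (coord_mult j f) \<le> ennreal C' * dirichlet_norm_sq \<mu> f" ..
  qed
qed

lemma coord_mult_dirichlet_space: "f \<in> dirichlet_space \<mu> \<Longrightarrow> coord_mult j f \<in> dirichlet_space \<mu>"
  using coord_mult_dirichlet_bound by metis

lemma hardy_second_difference:
  assumes f: "f \<in> dirichlet_space \<mu>"
  shows "(\<Sum>j\<in>UNIV. enn2real (hardy_norm_sq (coord_mult j f))) = enn2real (hardy_norm_sq f)"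
proof -
  obtain a where a: "power_series_on_ball f a" using dirichlet_spaceE[OF f] by metis
  have "hardy_norm_sq (coord_mult j f) < top" for j
    using coord_mult_dirichlet_space[OF f] by (simp add: dirichlet_space_iff)
  then show ?thesis
    unfolding sum_hardy_norm_sq_coord_mult[OF a, symmetric] by (subst enn2real_sum) auto
qed

lemma dirichlet_second_difference:
  assumes f: "f \<in> dirichlet_space \<mu>"
  shows "Re (dirichlet_inner \<mu> f f) - 2 * (\<Sum>j\<in>UNIV. Re (dirichlet_inner \<mu> (coord_mult j f) (coord_mult j f)))
    + (\<Sum>j\<in>UNIV. \<Sum>i\<in>UNIV. Re (dirichlet_inner \<mu> (coord_mult i (coord_mult j f)) (coord_mult i (coord_mult j f)))) = 0"
proof -
  note m = coord_mult_dirichlet_space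
  define I where "I f = (\<integral>z. grad_sq f z * poisson_integral \<mu> z \<partial>ball_volume)" for f :: "complex ^ 'd \<Rightarrow> complex"
  have i: "integrable ball_volume (\<lambda>z. grad_sq g z * poisson_integral \<mu> z)" if g: "g \<in> dirichlet_space \<mu>" for g
  proof -
    obtain b where "power_series_on_ball g b" using dirichlet_spaceE[OF g] by metis
    then show ?thesis using energy_integrable(1) g by (auto simp: dirichlet_space_iff)
  qed
  obtain a where a: "power_series_on_ball f a" "coeff_bounded (enn2real (hardy_norm_sq f)) a"
    using dirichlet_spaceE[OF f] by metis
  note [measurable] = power_series_measurable[OF a(1)]
  have e: "energy \<mu> f = ennreal (enn2real (energy \<mu> f))" using f by (auto simp: dirichlet_space_iff)
  obtain C where "(\<integral>\<^sup>+z. ennreal ((cmod (f z))\<^sup>2 * poisson_integral \<mu> z) \<partial>ball_volume) \<le> ennreal C"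
  proof (rule weighted_bergman_bound)
    fix C
    assume *: "\<And>f a B D. power_series_on_ball f a \<Longrightarrow> coeff_bounded B a \<Longrightarrow> 0 \<le> D \<Longrightarrow>
      (\<integral>\<^sup>+z. ennreal (grad_sq f z * poisson_integral \<mu> z) \<partial>ball_volume) \<le> ennreal D \<Longrightarrow>
      (\<integral>\<^sup>+z. ennreal ((cmod (f z))\<^sup>2 * poisson_integral \<mu> z) \<partial>ball_volume) \<le> ennreal (C * (B + D))"
    show thesis by (rule that[OF *[OF a, of "enn2real (energy \<mu> f)"]]) (use e in \<open>auto simp: energy_def\<close>)
  qed
  then have u: "integrable ball_volume (\<lambda>z. (cmod (f z))\<^sup>2 * poisson_integral \<mu> z)"
    by (intro integrableI_nonneg)
       (auto simp: poisson_integral_nonneg intro!: AE_I2 mult_nonneg_nonneg intro: le_less_trans)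
  \<comment> \<open>All functions involved lie in the space, so every integral is finite and the
    second difference may be taken under the integral sign.\<close>
  have "I f - 2 * (\<Sum>j\<in>UNIV. I (coord_mult j f)) + (\<Sum>j\<in>UNIV. \<Sum>i\<in>UNIV. I (coord_mult i (coord_mult j f))) =
    (\<integral>z. grad_sq f z * poisson_integral \<mu> z - 2 * (\<Sum>j\<in>UNIV. grad_sq (coord_mult j f) z * poisson_integral \<mu> z)
      + (\<Sum>j\<in>UNIV. \<Sum>i\<in>UNIV. grad_sq (coord_mult i (coord_mult j f)) z * poisson_integral \<mu> z) \<partial>ball_volume)"
    unfolding I_def using f m i by simp
  also have "\<dots> = (\<integral>z. ((1 - (norm z)\<^sup>2)\<^sup>2 * grad_sq f z - 2 * (1 - (norm z)\<^sup>2) * radial_term f z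
      + 2 * (norm z)\<^sup>2 * (cmod (f z))\<^sup>2) * poisson_integral \<mu> z \<partial>ball_volume)"
    by (rule Bochner_Integration.integral_cong[OF refl], subst grad_sq_second_difference[OF a(1), symmetric])
       (auto simp: distrib_right left_diff_distrib sum_distrib_right)
  also have "\<dots> = 0" by (rule integral_second_difference_eq_0[OF a(1) i[OF f] u])
  finally have "I f - 2 * (\<Sum>j\<in>UNIV. I (coord_mult j f)) + (\<Sum>j\<in>UNIV. \<Sum>i\<in>UNIV. I (coord_mult i (coord_mult j f))) = 0" .
  then have "1 / CARD('d) * I f - 2 * (\<Sum>j\<in>UNIV. 1 / CARD('d) * I (coord_mult j f))
      + (\<Sum>j\<in>UNIV. \<Sum>i\<in>UNIV. 1 / CARD('d) * I (coord_mult i (coord_mult j f))) = 0"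
    unfolding sum_distrib_left[symmetric] by (simp add: field_simps)
  moreover have "(\<Sum>j\<in>UNIV. \<Sum>i\<in>UNIV. enn2real (hardy_norm_sq (coord_mult i (coord_mult j f)))) = enn2real (hardy_norm_sq f)"
    by (simp add: hardy_second_difference m f)
  ultimately show ?thesis
    using f m by (simp add: Re_dirichlet_inner_self I_def[symmetric] sum.distrib hardy_second_difference)
qed

text \<open>The power series of the limits of the coefficients is the limit, by Fatou's lemma for the energy.\<close>
lemma dirichlet_space_complete:
  assumes X: "\<And>n. X n \<in> dirichlet_space \<mu>"
    and cauchy: "\<forall>e>0. \<exists>N::nat. \<forall>m\<ge>N. \<forall>n\<ge>N. ip_norm (dirichlet_inner \<mu>) (X m - X n) < e"
  shows "\<exists>f\<in>dirichlet_space \<mu>. (\<lambda>n. ip_norm (dirichlet_inner \<mu>) (X n - f)) \<longlonglongrightarrow> 0"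
proof -
  note diff = dirichlet_space_diff
  note iff = ip_norm_le_iff
  define a where "a n = power_coeff (X n)" for n
  have a: "power_series_on_ball (X n) (a n)" "coeff_bounded (enn2real (hardy_norm_sq (X n))) (a n)" for n
    unfolding a_def using dirichlet_spaceE[OF X] by metis+
  have d: "X m - X n = (\<lambda>z. X m z - X n z)" for m n by (simp add: fun_eq_iff)
  have ps: "power_series_on_ball (X m - X n) (\<lambda>\<alpha>. a m \<alpha> - a n \<alpha>)" for m n
    unfolding d by (rule power_series_diff[OF a(1) a(1)])
  have nsq: "dirichlet_norm_sq \<mu> (X m - X n) \<le> ennreal (e\<^sup>2)" if "ip_norm (dirichlet_inner \<mu>) (X m - X n) < e" for m n e
  proof -
    have "0 \<le> ip_norm (dirichlet_inner \<mu>) (X m - X n)"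
      using ip_norm_dirichlet[OF diff[OF X X]] by simp
    then show ?thesis using iff[OF diff[OF X[of m] X[of n]], of e] that by simp
  qed
  have cb: "coeff_bounded (e\<^sup>2) (\<lambda>\<alpha>. a m \<alpha> - a n \<alpha>)" if "ip_norm (dirichlet_inner \<mu>) (X m - X n) < e" for m n e
  proof -
    have "hardy_norm_sq (X m - X n) \<le> dirichlet_norm_sq \<mu> (X m - X n)" unfolding dirichlet_norm_sq_eq by simp
    also have "\<dots> \<le> ennreal (e\<^sup>2)" by (rule nsq[OF that])
    finally show ?thesis using coeff_bounded_iff_hardy_norm_sq[OF ps, of "e\<^sup>2"] by simp
  qed
  have "\<exists>N. \<forall>m\<ge>N. \<forall>n\<ge>N. coeff_bounded (e\<^sup>2) (\<lambda>\<alpha>. a m \<alpha> - a n \<alpha>)" if "e > 0" for e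
    using cauchy that cb by meson
  from coeff_bounded_Cauchy_limit[OF this] obtain l where
    l: "\<And>e N n. (\<And>m n. m \<ge> N \<Longrightarrow> n \<ge> N \<Longrightarrow> coeff_bounded e (\<lambda>\<alpha>. a m \<alpha> - a n \<alpha>)) \<Longrightarrow> n \<ge> N \<Longrightarrow>
       coeff_bounded e (\<lambda>\<alpha>. a n \<alpha> - l \<alpha>)" by blast
  obtain N1 where N1: "\<forall>m\<ge>N1. \<forall>n\<ge>N1. ip_norm (dirichlet_inner \<mu>) (X m - X n) < 1" using cauchy by (meson zero_less_one)
  \<comment> \<open>\<open>l\<close> is \<open>a N1\<close> minus a bounded family, hence bounded
    itself and the coefficient family of a function.\<close>
  have "coeff_bounded (1\<^sup>2) (\<lambda>\<alpha>. a N1 \<alpha> - l \<alpha>)" by (rule l[of N1], rule cb) (use N1 in auto)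
  from coeff_bounded_diff[OF a(2)[of N1] this]
  have "coeff_bounded (2 * enn2real (hardy_norm_sq (X N1)) + 2 * 1\<^sup>2) l" by simp
  then obtain f where f: "power_series_on_ball f l" "\<And>z. z \<notin> ball 0 1 \<Longrightarrow> f z = 0"
    using power_series_of_coeff_bounded by blast
  have d': "X n - f = (\<lambda>z. X n z - f z)" for n by (simp add: fun_eq_iff)
  have ps': "power_series_on_ball (X n - f) (\<lambda>\<alpha>. a n \<alpha> - l \<alpha>)" for n
    unfolding d' by (rule power_series_diff[OF a(1) f(1)])
  note hol = power_series_holomorphic[OF a(1)] power_series_holomorphic[OF f(1)]
  have pd: "(\<lambda>n. partial_deriv j (X n) z) \<longlonglongrightarrow> partial_deriv j f z" if z: "z \<in> ball 0 1" for j z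
  proof (rule LIMSEQ_I)
    fix e :: real assume e: "e > 0"
    obtain C where C: "C \<ge> 0"
      "\<And>f a B. power_series_on_ball f a \<Longrightarrow> coeff_bounded B a \<Longrightarrow> (cmod (partial_deriv j f z))\<^sup>2 \<le> B * C"
      using partial_deriv_bound[OF z, of j] by blast
    \<comment> \<open>\<open>C < (C + 1)\<^sup>2\<close> holds even for \<open>C = 0\<close>, so
      \<open>\<epsilon>\<^sup>2 * C\<close> stays strictly below \<open>e\<^sup>2\<close>.\<close>
    define \<epsilon> where "\<epsilon> = e / (C + 1)"
    have \<epsilon>: "\<epsilon> > 0" using e C by (simp add: \<epsilon>_def)
    then obtain N where N: "\<forall>m\<ge>N. \<forall>n\<ge>N. ip_norm (dirichlet_inner \<mu>) (X m - X n) < \<epsilon>" using cauchy by meson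
    have "norm (partial_deriv j (X n) z - partial_deriv j f z) < e" if n: "n \<ge> N" for n
    proof -
      have "coeff_bounded (\<epsilon>\<^sup>2) (\<lambda>\<alpha>. a n \<alpha> - l \<alpha>)" by (rule l[OF _ n]) (use N in \<open>auto intro!: cb\<close>)
      from C(2)[OF ps' this]
      have "(cmod (partial_deriv j (X n) z - partial_deriv j f z))\<^sup>2 \<le> \<epsilon>\<^sup>2 * C"
        unfolding d' partial_deriv_diff[OF hol z] .
      also have "\<dots> < \<epsilon>\<^sup>2 * (C + 1)\<^sup>2"
      proof (rule mult_strict_left_mono)
        show "C < (C + 1)\<^sup>2" using C(1) by (simp add: power2_sum add_nonneg_pos)
      qed (use \<epsilon> in simp)
      also have "\<dots> = e\<^sup>2" using C(1) by (simp add: \<epsilon>_def power_divide)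
      finally show ?thesis using e by (simp add: power_less_imp_less_base)
    qed
    then show "\<exists>N. \<forall>n\<ge>N. norm (partial_deriv j (X n) z - partial_deriv j f z) < e" by blast
  qed
  \<comment> \<open>The factor 2 adds \<open>e\<^sup>2\<close> from the Hardy part to
    \<open>e\<^sup>2\<close> from the energy, which is at most d times \<open>e\<^sup>2\<close> and
    carries the weight 1 / d.\<close>
  have main: "X n - f \<in> dirichlet_space \<mu> \<and> dirichlet_norm_sq \<mu> (X n - f) \<le> ennreal (2 * e\<^sup>2)"
    if N: "\<And>m n. m \<ge> N \<Longrightarrow> n \<ge> N \<Longrightarrow> ip_norm (dirichlet_inner \<mu>) (X m - X n) < e" and n: "n \<ge> N" for e N n
  proof -
    have "coeff_bounded (e\<^sup>2) (\<lambda>\<alpha>. a n \<alpha> - l \<alpha>)" by (rule l[OF _ n]) (use N in \<open>auto intro!: cb\<close>)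
    then have h: "hardy_norm_sq (X n - f) \<le> ennreal (e\<^sup>2)"
      using coeff_bounded_iff_hardy_norm_sq[OF ps', of "e\<^sup>2"] by simp
    have "energy \<mu> (X n - f) = (\<integral>\<^sup>+z. liminf (\<lambda>m. ennreal (grad_sq (X n - X m) z * poisson_integral \<mu> z)) \<partial>ball_volume)"
      unfolding energy_def
    proof (rule nn_integral_cong)
      fix z :: "complex ^ 'd" assume "z \<in> space ball_volume"
      then have z: "z \<in> ball 0 1" by simp
      have "(\<lambda>m. ennreal (grad_sq (X n - X m) z * poisson_integral \<mu> z)) \<longlonglongrightarrow> ennreal (grad_sq (X n - f) z * poisson_integral \<mu> z)"
        unfolding d d' grad_sq_def partial_deriv_diff[OF hol z] partial_deriv_diff[OF hol(1) hol(1) z]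
        by (intro tendsto_intros pd z)
      from lim_imp_Liminf[OF _ this]
      show "ennreal (grad_sq (X n - f) z * poisson_integral \<mu> z) = liminf (\<lambda>m. ennreal (grad_sq (X n - X m) z * poisson_integral \<mu> z))"
        by simp
    qed
    also have "\<dots> \<le> liminf (\<lambda>m. energy \<mu> (X n - X m))"
      unfolding energy_def
    proof (rule nn_integral_liminf)
      fix m
      note [measurable] = power_series_measurable(3)[OF ps] poisson_integral_measurable_ball_volume
      show "(\<lambda>z. ennreal (grad_sq (X n - X m) z * poisson_integral \<mu> z)) \<in> borel_measurable ball_volume"
        by measurable
    qed
    also have "\<dots> \<le> liminf (\<lambda>m. ennreal (CARD('d) * e\<^sup>2))"
    proof (rule Liminf_mono)
      show "\<forall>\<^sub>F m in sequentially. energy \<mu> (X n - X m) \<le> ennreal (CARD('d) * e\<^sup>2)"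
        unfolding eventually_sequentially
      proof (intro exI allI impI)
        fix m assume "m \<ge> N"
        have "energy \<mu> (X n - X m) \<le> ennreal CARD('d) * dirichlet_norm_sq \<mu> (X n - X m)"
          by (rule energy_le_dirichlet_norm_sq)
        also have "\<dots> \<le> ennreal CARD('d) * ennreal (e\<^sup>2)"
          by (intro mult_left_mono nsq N n \<open>m \<ge> N\<close>) auto
        finally show "energy \<mu> (X n - X m) \<le> ennreal (CARD('d) * e\<^sup>2)" by (simp add: ennreal_mult')
      qed
    qed
    also have "\<dots> = ennreal (CARD('d) * e\<^sup>2)" by (simp add: Liminf_const)
    finally have en: "energy \<mu> (X n - f) \<le> ennreal (CARD('d) * e\<^sup>2)" .
    have "X n - f \<in> dirichlet_space \<mu>"
      unfolding dirichlet_space_iff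
    proof (intro conjI)
      show "\<forall>z. z \<notin> ball 0 1 \<longrightarrow> (X n - f) z = 0" using X[of n] f(2) by (auto simp: dirichlet_space_iff)
      show "\<exists>b. power_series_on_ball (X n - f) b" using ps' by blast
      show "hardy_norm_sq (X n - f) < \<infinity>" "energy \<mu> (X n - f) < \<infinity>"
        using h en by (auto intro: le_less_trans)
    qed
    moreover have "dirichlet_norm_sq \<mu> (X n - f) \<le> ennreal (e\<^sup>2) + ennreal (1 / CARD('d)) * ennreal (CARD('d) * e\<^sup>2)"
      unfolding dirichlet_norm_sq_eq by (intro add_mono mult_left_mono h en) auto
    then have "dirichlet_norm_sq \<mu> (X n - f) \<le> ennreal (2 * e\<^sup>2)"
      by (simp add: ennreal_mult[symmetric] ennreal_plus[symmetric] del: ennreal_plus)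
    ultimately show ?thesis ..
  qed
  \<comment> \<open>\<open>f\<close> is recovered as \<open>X N1 - (X N1 - f)\<close>, a difference
    of two members of the space.\<close>
  have "X N1 - f \<in> dirichlet_space \<mu>" using main[of N1 1 N1] N1 by auto
  from diff[OF X[of N1] this] have "f \<in> dirichlet_space \<mu>" by simp
  moreover have "(\<lambda>n. ip_norm (dirichlet_inner \<mu>) (X n - f)) \<longlonglongrightarrow> 0"
  proof (rule LIMSEQ_I)
    fix e :: real assume e: "e > 0"
    then obtain N where N: "\<forall>m\<ge>N. \<forall>n\<ge>N. ip_norm (dirichlet_inner \<mu>) (X m - X n) < e / 2" using cauchy by (meson half_gt_zero)
    have "norm (ip_norm (dirichlet_inner \<mu>) (X n - f) - 0) < e" if n: "n \<ge> N" for n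
    proof -
      have m: "X n - f \<in> dirichlet_space \<mu>" "dirichlet_norm_sq \<mu> (X n - f) \<le> ennreal (2 * (e / 2)\<^sup>2)"
        using main[of N "e / 2" n] N n by auto
      have "ip_norm (dirichlet_inner \<mu>) (X n - f) \<le> sqrt (2 * (e / 2)\<^sup>2)"
        using iff[OF m(1), of "sqrt (2 * (e / 2)\<^sup>2)"] m(2) by simp
      also have "\<dots> < e" using e by (intro real_less_lsqrt) (auto simp: power_divide)
      finally show ?thesis using ip_norm_dirichlet[OF m(1)] by simp
    qed
    then show "\<exists>N. \<forall>n\<ge>N. norm (ip_norm (dirichlet_inner \<mu>) (X n - f) - 0) < e" by blast
  qed
  ultimately show ?thesis by blast
qed

section \<open>The coordinate tuple on the Hilbert space\<close>

lemma dirichlet_hilbert_space: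
  "complex_hilbert_space pointwise_scale (dirichlet_space \<mu>) (dirichlet_inner \<mu>)"
proof -
  interpret vs: vector_space "pointwise_scale :: complex \<Rightarrow> (complex ^ 'd \<Rightarrow> complex) \<Rightarrow> _"
    by (rule vector_space_pointwise_scale)
  note E = dirichlet_spaceE
  note summable = dirichlet_inner_summable
  note integrable = dirichlet_inner_integrable
  show ?thesis
  proof
    show "vs.subspace (dirichlet_space \<mu>)"
      by (rule vs.subspaceI)
        (auto intro: dirichlet_space_0 dirichlet_space_add dirichlet_space_scale)
  next
    fix f g h assume f: "f \<in> dirichlet_space \<mu>" and g: "g \<in> dirichlet_space \<mu>" and h: "h \<in> dirichlet_space \<mu>"
    obtain a b where a: "power_series_on_ball f a" "power_coeff f = a" and b: "power_series_on_ball g b" "power_coeff g = b"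
      using E[OF f] E[OF g] by metis
    note hol = power_series_holomorphic[OF a(1)] power_series_holomorphic[OF b(1)]
    have e: "f + g = (\<lambda>z. f z + g z)" by (simp add: fun_eq_iff)
    have c: "power_coeff (f + g) = (\<lambda>\<alpha>. a \<alpha> + b \<alpha>)"
      unfolding e by (rule power_coeff_eq[OF power_series_add[OF a(1) b(1)]])
    have 1: "(\<Sum>\<^sub>\<infinity>\<alpha>. power_coeff (f + g) \<alpha> * cnj (power_coeff h \<alpha>) * of_real (hardy_weight \<alpha>)) =
       (\<Sum>\<^sub>\<infinity>\<alpha>. power_coeff f \<alpha> * cnj (power_coeff h \<alpha>) * of_real (hardy_weight \<alpha>)) +
       (\<Sum>\<^sub>\<infinity>\<alpha>. power_coeff g \<alpha> * cnj (power_coeff h \<alpha>) * of_real (hardy_weight \<alpha>))"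
      unfolding infsum_add[OF summable[OF f h] summable[OF g h], symmetric]
      by (rule infsum_cong) (simp add: c a(2) b(2) algebra_simps)
    have 2: "(\<integral>z. (\<Sum>j\<in>UNIV. partial_deriv j (f + g) z * cnj (partial_deriv j h z)) * of_real (poisson_integral \<mu> z) \<partial>ball_volume) =
       (\<integral>z. (\<Sum>j\<in>UNIV. partial_deriv j f z * cnj (partial_deriv j h z)) * of_real (poisson_integral \<mu> z) \<partial>ball_volume) +
       (\<integral>z. (\<Sum>j\<in>UNIV. partial_deriv j g z * cnj (partial_deriv j h z)) * of_real (poisson_integral \<mu> z) \<partial>ball_volume)"
      unfolding Bochner_Integration.integral_add[OF integrable[OF f h] integrable[OF g h], symmetric]
      by (rule Bochner_Integration.integral_cong[OF refl])
         (simp add: e partial_deriv_add[OF hol] distrib_right sum.distrib)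
    show "dirichlet_inner \<mu> (f + g) h = dirichlet_inner \<mu> f h + dirichlet_inner \<mu> g h"
      unfolding dirichlet_inner_def 1 2 by (simp add: algebra_simps)
  next
    fix f h c assume f: "f \<in> dirichlet_space \<mu>" and h: "h \<in> dirichlet_space \<mu>"
    obtain a where a: "power_series_on_ball f a" "power_coeff f = a" using E[OF f] by metis
    note hol = power_series_holomorphic[OF a(1)]
    have c: "power_coeff (pointwise_scale c f) = (\<lambda>\<alpha>. c * a \<alpha>)"
      unfolding pointwise_scale_def by (rule power_coeff_eq[OF power_series_cmult[OF a(1)]])
    have 1: "(\<Sum>\<^sub>\<infinity>\<alpha>. power_coeff (pointwise_scale c f) \<alpha> * cnj (power_coeff h \<alpha>) * of_real (hardy_weight \<alpha>)) =
       c * (\<Sum>\<^sub>\<infinity>\<alpha>. power_coeff f \<alpha> * cnj (power_coeff h \<alpha>) * of_real (hardy_weight \<alpha>))"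
      unfolding c a(2) mult.assoc by (rule infsum_cmult_right) (use summable[OF f h] a(2) in \<open>simp add: mult.assoc\<close>)
    have 2: "(\<integral>z. (\<Sum>j\<in>UNIV. partial_deriv j (pointwise_scale c f) z * cnj (partial_deriv j h z)) * of_real (poisson_integral \<mu> z) \<partial>ball_volume) =
       c * (\<integral>z. (\<Sum>j\<in>UNIV. partial_deriv j f z * cnj (partial_deriv j h z)) * of_real (poisson_integral \<mu> z) \<partial>ball_volume)"
      unfolding integral_mult_right_zero[symmetric]
      by (rule Bochner_Integration.integral_cong[OF refl])
         (simp add: pointwise_scale_def partial_deriv_cmult[OF hol] sum_distrib_left mult.assoc)
    show "dirichlet_inner \<mu> (pointwise_scale c f) h = c * dirichlet_inner \<mu> f h"
      unfolding dirichlet_inner_def 1 2 by (simp add: algebra_simps)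
  next
    fix f g assume f: "f \<in> dirichlet_space \<mu>" and g: "g \<in> dirichlet_space \<mu>"
    have 1: "(\<Sum>\<^sub>\<infinity>\<alpha>. power_coeff g \<alpha> * cnj (power_coeff f \<alpha>) * of_real (hardy_weight \<alpha>)) =
        cnj (\<Sum>\<^sub>\<infinity>\<alpha>. power_coeff f \<alpha> * cnj (power_coeff g \<alpha>) * of_real (hardy_weight \<alpha>))"
      unfolding infsum_cnj[symmetric] by (rule infsum_cong) simp
    have 2: "(\<integral>z. (\<Sum>j\<in>UNIV. partial_deriv j g z * cnj (partial_deriv j f z)) * of_real (poisson_integral \<mu> z) \<partial>ball_volume) =
        cnj (\<integral>z. (\<Sum>j\<in>UNIV. partial_deriv j f z * cnj (partial_deriv j g z)) * of_real (poisson_integral \<mu> z) \<partial>ball_volume)"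
      unfolding Bochner_Integration.integral_cnj[symmetric] by (rule Bochner_Integration.integral_cong[OF refl]) (simp add: mult.commute)
    show "dirichlet_inner \<mu> g f = cnj (dirichlet_inner \<mu> f g)"
      unfolding dirichlet_inner_def 1 2 by simp
  next
    fix f assume "f \<in> dirichlet_space \<mu>" "f \<noteq> 0"
    then show "0 < Re (dirichlet_inner \<mu> f f)" by (rule dirichlet_space_nondegenerate)
  next
    fix X assume "\<And>n. X n \<in> dirichlet_space \<mu>" "\<forall>e>0. \<exists>N::nat. \<forall>m\<ge>N. \<forall>n\<ge>N. ip_norm (dirichlet_inner \<mu>) (X m - X n) < e"
    then show "\<exists>f\<in>dirichlet_space \<mu>. (\<lambda>n. ip_norm (dirichlet_inner \<mu>) (X n - f)) \<longlonglongrightarrow> 0"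
      by (rule dirichlet_space_complete)
  qed
qed

lemma coord_mult_bounded_operator:
  "bounded_operator_on pointwise_scale (dirichlet_space \<mu>) (dirichlet_inner \<mu>) (coord_mult j)"
proof -
  obtain C where C: "0 \<le> C"
    "\<And>f j. f \<in> dirichlet_space \<mu> \<Longrightarrow> coord_mult j f \<in> dirichlet_space \<mu> \<and>
      dirichlet_norm_sq \<mu> (coord_mult j f) \<le> ennreal C * dirichlet_norm_sq \<mu> f"
    using coord_mult_dirichlet_bound by blast
  have "ip_norm (dirichlet_inner \<mu>) (coord_mult j f) \<le> sqrt C * ip_norm (dirichlet_inner \<mu>) f"
    if f: "f \<in> dirichlet_space \<mu>" for f
  proof -
    define N where "N = enn2real (dirichlet_norm_sq \<mu> f)"
    have N: "dirichlet_norm_sq \<mu> f = ennreal N" "0 \<le> N"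
      using f by (auto simp: N_def dirichlet_space_def)
    have "dirichlet_norm_sq \<mu> (coord_mult j f) \<le> ennreal (C * N)"
      using C(2)[OF f, of j] C(1) N by (simp add: ennreal_mult')
    then have "enn2real (dirichlet_norm_sq \<mu> (coord_mult j f)) \<le> C * N"
      by (rule enn2real_le) (use C(1) N in auto)
    then show ?thesis
      using C(2)[OF f, of j] f
      by (simp add: ip_norm_dirichlet N_def[symmetric] real_sqrt_mult[symmetric])
  qed
  then show ?thesis
    unfolding bounded_operator_on_def using C(2)
    by (auto simp: coord_mult_def pointwise_scale_def fun_eq_iff algebra_simps)
qed

theorem coord_mult_joint_2_isometry:
  "joint_isometry 2 pointwise_scale (dirichlet_space \<mu>) (dirichlet_inner \<mu>) coord_mult"
proof -
  interpret complex_hilbert_space pointwise_scale "dirichlet_space \<mu>" "dirichlet_inner \<mu>"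
    by (rule dirichlet_hilbert_space)
  show ?thesis
  proof (rule joint_2_isometryI)
    show "coord_mult i (coord_mult j f) = coord_mult j (coord_mult i f)" for i j f
      by (simp add: coord_mult_def fun_eq_iff)
  qed (use coord_mult_bounded_operator dirichlet_second_difference in auto)
qed

end

text \<open>The surface measure has total mass 1, so a bound for \<open>w\<close> bounds the mass of
  the weighted measure.\<close>

lemma finite_weighted_surface_measure:
  assumes "w \<in> borel_measurable (surface_measure :: (complex ^ 'd::finite) measure)" "bounded (w ` sphere 0 1)"
  shows "finite_measure (weighted_surface_measure w)"
proof (rule finite_measureI)
  let ?\<sigma> = "surface_measure :: (complex ^ 'd) measure"
  obtain B where B: "\<And>\<zeta>. \<zeta> \<in> sphere 0 1 \<Longrightarrow> \<bar>w \<zeta>\<bar> \<le> B"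
    using assms(2) unfolding bounded_iff by (metis image_eqI real_norm_def)
  have sp: "space ?\<sigma> = sphere 0 1" by (simp add: surface_measure_def space_restrict_space)
  have "emeasure (weighted_surface_measure w) (space ?\<sigma>) = (\<integral>\<^sup>+\<zeta>. ennreal (w \<zeta>) * indicator (space ?\<sigma>) \<zeta> \<partial>?\<sigma>)"
    unfolding weighted_surface_measure_def by (rule emeasure_density) (use assms(1) in auto)
  also have "\<dots> \<le> (\<integral>\<^sup>+\<zeta>. ennreal B \<partial>?\<sigma>)"
  proof (rule nn_integral_mono)
    fix \<zeta> assume "\<zeta> \<in> space ?\<sigma>"
    then show "ennreal (w \<zeta>) * indicator (space ?\<sigma>) \<zeta> \<le> ennreal B"
      using B[of \<zeta>] by (auto simp: sp intro!: ennreal_leI)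
  qed
  also have "\<dots> = ennreal B" by (simp add: emeasure_surface_measure_space)
  finally show "emeasure (weighted_surface_measure w) (space (weighted_surface_measure w)) \<noteq> \<infinity>"
    by (auto simp: weighted_surface_measure_def top_unique)
qed

theorem corollary3p7:
  fixes w :: "complex ^ 'd::finite \<Rightarrow> real"
  assumes "w \<in> borel_measurable surface_measure"
    and "\<And>\<zeta>. \<zeta> \<in> sphere 0 1 \<Longrightarrow> 0 \<le> w \<zeta>"
    and "bounded (w ` sphere 0 1)"
  shows "(\<forall>j. multiplier (weighted_surface_measure w) (\<lambda>z. z $ j)) \<and>
         joint_isometry 2 pointwise_scale
           (dirichlet_space (weighted_surface_measure w))
           (dirichlet_inner (weighted_surface_measure w)) coord_mult"
proof -
  have fin: "finite_measure (weighted_surface_measure w)"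
    by (rule finite_weighted_surface_measure[OF assms(1,3)])
  have sets: "sets (weighted_surface_measure w) = sets surface_measure"
    by (simp add: weighted_surface_measure_def)
  show ?thesis
    using coord_mult_joint_2_isometry[OF fin sets] coord_mult_dirichlet_space[OF fin sets]
    by (auto simp: multiplier_def coord_mult_def)
qed

end
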